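(* (1) For any Jordan pair $P=(P_-,P_+)$ over $k$, the $k$-module $\widehat{\mathrm{TKK}}(P)=P_-\oplus\langle P_-,P_+\rangle\oplus P_+$ together with the bracket $$[a+X+b,\,c+Y+d]=(Xc-Ya)+([X,Y]+\langle a,d\rangle-\langle c,b\rangle)+(Xd-Yb)$$ for $X,Y\in\langle P_-,P_+\rangle$, $a,c\in P_-$, $b,d\in P_+$, is a $3$-graded Lie algebra (with components $P_-$, $\langle P_-,P_+\rangle$, $P_+$ in degrees $-1,0,1$), and the map $\upsilon:\widehat{\mathrm{TKK}}(P)\to\mathrm{TKK}(P)$ defined by $\upsilon(a+X+b)=a+\mu(X)+b$ is a graded central extension. (2) In the special case when $P=(T,T)$ is the Jordan pair of a Jordan triple system $T$, the map $\widehat\kappa(a_-+\langle c,d\rangle+b_+)=b_--\langle d,c\rangle+a_+$ is an anti-graded involution of $\widehat{\mathrm{TKK}}(P)$, and $\upsilon$ is an involutary morphism from $(\widehat{\mathrm{TKK}}(P),\widehat\kappa)$ to $(\mathrm{TKK}(P),\bar\kappa)$. (3) In the special case when $P=(J,J)$ is the Jordan pair of a unital Jordan algebra $J$, the triple $\widehat{\mathfrak s}=\langle-\langle1,2\rangle,2_+,1_-\rangle$ is an $\mathfrak{sl}_2$-triple of $\widehat{\mathrm{TKK}}(P)$, the $3$-grading defined by this triple coincides with the canonical grading, and $\upsilon$ is an $\mathrm{A}_1$-graded morphism from $(\widehat{\mathrm{TKK}}(P),\widehat{\mathfrak s})$ to $(\mathrm{TKK}(P),\bar{\mathfrak s})$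.
   Context: $k$ is a unital commutative ring with no $2$- or $3$-torsion; all modules, algebras and tensor products are over $k$. A subscript $\sigma$ denotes an element of $\{-,+\}$. Jordan pair: a pair of $k$-modules $P=(P_-,P_+)$ with trilinear maps $\{\,,\,,\,\}_\sigma:P_\sigma\times P_{-\sigma}\times P_\sigma\to P_\sigma$ such that, with $V_{a,b}c=\{a,b,c\}_\sigma$, $\{a,b,c\}=\{c,b,a\}$ and $[V_{a,b},V_{c,d}]=V_{V_{a,b}c,d}-V_{c,V_{b,a}d}$ for $a,c\in P_\sigma$, $b,d\in P_{-\sigma}$. Jordan triple system: a $k$-module $T$ with a trilinear product $\{\,,\,,\,\}$ satisfying the same two identities for all $a,b,c,d\in T$; its Jordan pair is $(T,T)$ with both products equal to that of $T$. Unital Jordan algebra $J$: bilinear product with $ab=ba$, $(a^2b)a=a^2(ba)$ and identity $1$; it is a triple system under $\{a,b,c\}=(ab)c+a(bc)-b(ca)$, and its Jordan pair is $(J,J)$. For $x$ in $T$ or $J$, $x_\pm$ denotes its copy in $P_\pm$; $2$ means $2\cdot1\in J$. For $a\in P_-$, $b\in P_+$ put $\nu(a,b)=(V_{a,b},-V_{b,a})\in\mathfrak{gl}(P_-)\oplus\mathfrak{gl}(P_+)$. The span of all $\nu(a,b)$ is a Lie algebra $\mathfrak{instr}(P)$. $\mathrm{TKK}(P)=P_-\oplus\mathfrak{instr}(P)\oplus P_+$ is the $3$-graded Lie algebra with bracket $[a+X+b,c+Y+d]=(Xc-Ya)+([X,Y]+\nu(a,d)-\nu(c,b))+(Xd-Yb)$.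 $\mathfrak{instr}(P)$ acts on $P_-\otimes P_+$ by $X(a\otimes b)=Xa\otimes b+a\otimes Xb$. Let $\lambda:P_-\otimes P_+\to\mathfrak{instr}(P)$, $\lambda(a\otimes b)=\nu(a,b)$, and $A(P_-\otimes P_+)=\mathrm{span}\{\lambda(m)m:m\in P_-\otimes P_+\}$. Put $\langle P_-,P_+\rangle=(P_-\otimes P_+)/A(P_-\otimes P_+)$, with $\langle a,b\rangle$ the coset of $a\otimes b$; it is a Lie algebra under $[\langle a,b\rangle,\langle c,d\rangle]=\langle\{a,b,c\},d\rangle-\langle c,\{b,a,d\}\rangle$. The map $\mu:\langle P_-,P_+\rangle\to\mathfrak{instr}(P)$, $\mu(\langle a,b\rangle)=\nu(a,b)$, is a Lie algebra homomorphism, and $\langle P_-,P_+\rangle$ acts on $P_\pm$ via $\mu$: $\langle a,b\rangle c=\{a,b,c\}$ for $c\in P_-$, $\langle a,b\rangle d=-\{b,a,d\}$ for $d\in P_+$. A $3$-graded Lie algebra is $L=L_{-1}\oplus L_0\oplus L_1$ with $[L_i,L_j]\subseteq L_{i+j}$ ($L_i=0$ for $|i|>1$). A graded central extension is a surjective graded Lie homomorphism whose kernel lies in the center. An anti-graded involution of $L$ is a Lie homomorphism $\varepsilon:L\to L$ with $\varepsilon^2=\mathrm{id}$, $\varepsilon(L_i)\subseteq L_{-i}$. An involutary morphism $(L,\varepsilon_L)\to(K,\varepsilon_K)$ is a graded homomorphism $\alpha$ with $\alpha\varepsilon_L=\varepsilon_K\alpha$. For $P=(T,T)$, $\bar\kappa$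 is the anti-graded involution of $\mathrm{TKK}(P)$ given by $\bar\kappa(a_-+\nu(c,d)+b_+)=b_--\nu(d,c)+a_+$. An $\mathfrak{sl}_2$-triple is an ordered triple $\langle h,e,f\rangle$ with $[e,f]=h$, $[h,e]=2e$, $[h,f]=-2f$. The $3$-grading defined by it on $L$ is $L=L_{-1}\oplus L_0\oplus L_1$ with $L_i=\{x:[h,x]=2ix\}$. An $\mathrm{A}_1$-graded Lie algebra is a pair $(L,\mathfrak s)$ with $\mathfrak s$ an $\mathfrak{sl}_2$-triple such that $L$ is the direct sum of these $L_i$, $i\in\{0,\pm1\}$, and $L_0=[L_{-1},L_1]$; an $\mathrm{A}_1$-graded morphism is a Lie homomorphism sending $\mathfrak{sl}_2$-triple to $\mathfrak{sl}_2$-triple elementwise. For $P=(J,J)$, $\mathrm{TKK}(P)$ is $\mathrm{A}_1$-graded with $\mathfrak{sl}_2$-triple $\bar{\mathfrak s}=\langle-\nu(1,2),2_+,1_-\rangle$.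
   Formalization: In (3), J is assumed to have no 2-torsion and, for the grading and A_1-graded morphism claims, ⟨J,J⟩ too; no 2-torsion in k alone is not enough: for k=Z, J=Z[x], X=⟨x^3,x⟩-⟨x^4,1⟩ is nonzero with 2X=0, so X lies in both L_0 and L_1. *)

theory Defs
  imports "HOL-Algebra.Module" "HOL-Algebra.AbelCoset"
begin

text \<open>
  Modules over a commutative ring are \<open>module\<close> records of \<open>HOL-Algebra\<close>. Their fields \<open>mult\<close> and
  \<open>one\<close> are ignored by the locale \<open>module\<close>. For a nonassociative algebra \<open>mult\<close> is its product
  (for a Lie algebra, the bracket), and \<open>one\<close> is used only for unital Jordan algebras.
\<close>

definition no_torsion :: "nat \<Rightarrow> ('a, 'b) ring_scheme \<Rightarrow> bool" where
  "no_torsion n M \<longleftrightarrow> (\<forall>x\<in>carrier M. add_pow M n x = \<zero>\<^bsub>M\<^esub> \<longrightarrow> x = \<zero>\<^bsub>M\<^esub>)"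


section \<open>Linear algebra over a commutative ring\<close>

definition linear_map ::
  "'k ring \<Rightarrow> ('k, 'a) module \<Rightarrow> ('k, 'b) module \<Rightarrow> ('a \<Rightarrow> 'b) \<Rightarrow> bool" where
  "linear_map R M N f \<longleftrightarrow>
     f \<in> carrier M \<rightarrow> carrier N \<and>
     (\<forall>x\<in>carrier M. \<forall>y\<in>carrier M. f (x \<oplus>\<^bsub>M\<^esub> y) = f x \<oplus>\<^bsub>N\<^esub> f y) \<and>
     (\<forall>r\<in>carrier R. \<forall>x\<in>carrier M. f (r \<odot>\<^bsub>M\<^esub> x) = r \<odot>\<^bsub>N\<^esub> f x)"

definition bilinear_map ::
  "'k ring \<Rightarrow> ('k, 'a) module \<Rightarrow> ('k, 'b) module \<Rightarrow> ('k, 'c) module \<Rightarrow> ('a \<Rightarrow> 'b \<Rightarrow> 'c) \<Rightarrow> bool" where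
  "bilinear_map R M N Q f \<longleftrightarrow>
     (\<forall>x\<in>carrier M. linear_map R N Q (\<lambda>y. f x y)) \<and>
     (\<forall>y\<in>carrier N. linear_map R M Q (\<lambda>x. f x y))"

definition trilinear_map ::
  "'k ring \<Rightarrow> ('k, 'a) module \<Rightarrow> ('k, 'b) module \<Rightarrow> ('k, 'c) module \<Rightarrow> ('k, 'd) module \<Rightarrow>
   ('a \<Rightarrow> 'b \<Rightarrow> 'c \<Rightarrow> 'd) \<Rightarrow> bool" where
  "trilinear_map R M N Q S f \<longleftrightarrow>
     (\<forall>x\<in>carrier M. bilinear_map R N Q S (\<lambda>y z. f x y z)) \<and>
     (\<forall>y\<in>carrier N. \<forall>z\<in>carrier Q. linear_map R M S (\<lambda>x. f x y z))"

definition submodule_span :: "'k ring \<Rightarrow> ('k, 'a) module \<Rightarrow> 'a set \<Rightarrow> 'a set" where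
  "submodule_span R M S = \<Inter>{N. submodule N R M \<and> S \<subseteq> N}"

text \<open>
  A linear map \<open>f : M \<rightarrow> N\<close> with \<open>f (g s) = y s\<close> for \<open>s \<in> S\<close>. It is only used when the elements
  \<open>g s\<close> span \<open>M\<close> and such a map exists, so that its values on \<open>M\<close> are determined.
\<close>
definition linear_ext ::
  "'k ring \<Rightarrow> ('k, 'a) module \<Rightarrow> ('k, 'b) module \<Rightarrow> 's set \<Rightarrow> ('s \<Rightarrow> 'a) \<Rightarrow> ('s \<Rightarrow> 'b) \<Rightarrow> 'a \<Rightarrow> 'b" where
  "linear_ext R M N S g y = (SOME f. linear_map R M N f \<and> (\<forall>s\<in>S. f (g s) = y s))"

definition quotient_module :: "('k, 'a) module \<Rightarrow> 'a set \<Rightarrow> ('k, 'a set) module" where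
  "quotient_module M N =
     \<lparr>carrier = a_rcosets\<^bsub>M\<^esub> N, mult = undefined, one = undefined,
      zero = N, add = set_add M, smult = (\<lambda>r X. \<Union>x\<in>X. N +>\<^bsub>M\<^esub> (r \<odot>\<^bsub>M\<^esub> x))\<rparr>"

definition direct_sum_algebra ::
  "('k, 'a) module \<Rightarrow> ('k, 'b) module \<Rightarrow> ('k, 'a \<times> 'b) module" where
  "direct_sum_algebra M N =
     \<lparr>carrier = carrier M \<times> carrier N,
      mult = (\<lambda>(a, b) (c, d). (a \<otimes>\<^bsub>M\<^esub> c, b \<otimes>\<^bsub>N\<^esub> d)),
      one = undefined,
      zero = (\<zero>\<^bsub>M\<^esub>, \<zero>\<^bsub>N\<^esub>),
      add = (\<lambda>(a, b) (c, d). (a \<oplus>\<^bsub>M\<^esub> c, b \<oplus>\<^bsub>N\<^esub> d)),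
      smult = (\<lambda>r (a, b). (r \<odot>\<^bsub>M\<^esub> a, r \<odot>\<^bsub>N\<^esub> b))\<rparr>"

definition free_module :: "'k ring \<Rightarrow> 's set \<Rightarrow> ('k, 's \<Rightarrow> 'k) module" where
  "free_module R S =
     \<lparr>carrier = {f. range f \<subseteq> carrier R \<and> finite {s. f s \<noteq> \<zero>\<^bsub>R\<^esub>} \<and> {s. f s \<noteq> \<zero>\<^bsub>R\<^esub>} \<subseteq> S},
      mult = undefined, one = undefined,
      zero = (\<lambda>s. \<zero>\<^bsub>R\<^esub>), add = (\<lambda>f g s. f s \<oplus>\<^bsub>R\<^esub> g s), smult = (\<lambda>r f s. r \<otimes>\<^bsub>R\<^esub> f s)\<rparr>"

definition free_gen :: "'k ring \<Rightarrow> 's \<Rightarrow> 's \<Rightarrow> 'k" where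
  "free_gen R s = (\<lambda>t. if t = s then \<one>\<^bsub>R\<^esub> else \<zero>\<^bsub>R\<^esub>)"

definition tensor_relations ::
  "'k ring \<Rightarrow> ('k, 'a) module \<Rightarrow> ('k, 'b) module \<Rightarrow> ('a \<times> 'b \<Rightarrow> 'k) set" where
  "tensor_relations R M N = (let F = free_module R (carrier M \<times> carrier N); \<delta> = free_gen R in
     {\<delta> (a \<oplus>\<^bsub>M\<^esub> a', b) \<ominus>\<^bsub>F\<^esub> (\<delta> (a, b) \<oplus>\<^bsub>F\<^esub> \<delta> (a', b)) | a a' b.
        a \<in> carrier M \<and> a' \<in> carrier M \<and> b \<in> carrier N} \<union>
     {\<delta> (a, b \<oplus>\<^bsub>N\<^esub> b') \<ominus>\<^bsub>F\<^esub> (\<delta> (a, b) \<oplus>\<^bsub>F\<^esub> \<delta> (a, b')) | a b b'.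
        a \<in> carrier M \<and> b \<in> carrier N \<and> b' \<in> carrier N} \<union>
     {\<delta> (r \<odot>\<^bsub>M\<^esub> a, b) \<ominus>\<^bsub>F\<^esub> (r \<odot>\<^bsub>F\<^esub> \<delta> (a, b)) | r a b.
        r \<in> carrier R \<and> a \<in> carrier M \<and> b \<in> carrier N} \<union>
     {\<delta> (a, r \<odot>\<^bsub>N\<^esub> b) \<ominus>\<^bsub>F\<^esub> (r \<odot>\<^bsub>F\<^esub> \<delta> (a, b)) | r a b.
        r \<in> carrier R \<and> a \<in> carrier M \<and> b \<in> carrier N})"

definition tensor_null ::
  "'k ring \<Rightarrow> ('k, 'a) module \<Rightarrow> ('k, 'b) module \<Rightarrow> ('a \<times> 'b \<Rightarrow> 'k) set" where
  "tensor_null R M N =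
     submodule_span R (free_module R (carrier M \<times> carrier N)) (tensor_relations R M N)"

definition tensor_module ::
  "'k ring \<Rightarrow> ('k, 'a) module \<Rightarrow> ('k, 'b) module \<Rightarrow> ('k, ('a \<times> 'b \<Rightarrow> 'k) set) module" where
  "tensor_module R M N =
     quotient_module (free_module R (carrier M \<times> carrier N)) (tensor_null R M N)"

definition tensor ::
  "'k ring \<Rightarrow> ('k, 'a) module \<Rightarrow> ('k, 'b) module \<Rightarrow> 'a \<Rightarrow> 'b \<Rightarrow> ('a \<times> 'b \<Rightarrow> 'k) set" where
  "tensor R M N a b =
     tensor_null R M N +>\<^bsub>free_module R (carrier M \<times> carrier N)\<^esub> free_gen R (a, b)"


section \<open>Lie algebras\<close>

locale lie_algebra = module R L for R :: "'k ring" and L :: "('k, 'a) module" (structure) +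
  assumes bracket_bilinear: "bilinear_map R L L L (\<lambda>x y. x \<otimes>\<^bsub>L\<^esub> y)"
    and bracket_alternating: "x \<in> carrier L \<Longrightarrow> x \<otimes>\<^bsub>L\<^esub> x = \<zero>\<^bsub>L\<^esub>"
    and jacobi: "\<lbrakk>x \<in> carrier L; y \<in> carrier L; z \<in> carrier L\<rbrakk> \<Longrightarrow>
      x \<otimes>\<^bsub>L\<^esub> (y \<otimes>\<^bsub>L\<^esub> z) \<oplus>\<^bsub>L\<^esub> y \<otimes>\<^bsub>L\<^esub> (z \<otimes>\<^bsub>L\<^esub> x) \<oplus>\<^bsub>L\<^esub> z \<otimes>\<^bsub>L\<^esub> (x \<otimes>\<^bsub>L\<^esub> y) = \<zero>\<^bsub>L\<^esub>"

definition lie_hom ::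
  "'k ring \<Rightarrow> ('k, 'a) module \<Rightarrow> ('k, 'b) module \<Rightarrow> ('a \<Rightarrow> 'b) \<Rightarrow> bool" where
  "lie_hom R L K f \<longleftrightarrow>
     lie_algebra R L \<and> lie_algebra R K \<and> linear_map R L K f \<and>
     (\<forall>x\<in>carrier L. \<forall>y\<in>carrier L. f (x \<otimes>\<^bsub>L\<^esub> y) = f x \<otimes>\<^bsub>K\<^esub> f y)"

definition lie_center :: "('k, 'a) module \<Rightarrow> 'a set" where
  "lie_center L = {z \<in> carrier L. \<forall>x\<in>carrier L. z \<otimes>\<^bsub>L\<^esub> x = \<zero>\<^bsub>L\<^esub>}"

text \<open>A family \<open>G\<close> of subsets indexed by degree; \<open>L\<close> is the internal direct sum of
  \<open>G (-1)\<close>, \<open>G 0\<close> and \<open>G 1\<close>.\<close>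
definition is_direct_sum3 :: "'k ring \<Rightarrow> ('k, 'a) module \<Rightarrow> (int \<Rightarrow> 'a set) \<Rightarrow> bool" where
  "is_direct_sum3 R L G \<longleftrightarrow>
     (\<forall>i\<in>{-1, 0, 1}. submodule (G i) R L) \<and>
     (\<forall>x\<in>carrier L. \<exists>!t. t \<in> G (-1) \<times> G 0 \<times> G 1 \<and>
        x = (case t of (a, b, c) \<Rightarrow> a \<oplus>\<^bsub>L\<^esub> b \<oplus>\<^bsub>L\<^esub> c))"

definition three_graded :: "'k ring \<Rightarrow> ('k, 'a) module \<Rightarrow> (int \<Rightarrow> 'a set) \<Rightarrow> bool" where
  "three_graded R L G \<longleftrightarrow>
     lie_algebra R L \<and> is_direct_sum3 R L G \<and>
     (\<forall>i. \<bar>i\<bar> > 1 \<longrightarrow> G i = {\<zero>\<^bsub>L\<^esub>}) \<and>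
     (\<forall>i j. \<forall>x\<in>G i. \<forall>y\<in>G j. x \<otimes>\<^bsub>L\<^esub> y \<in> G (i + j))"

definition graded_lie_hom ::
  "'k ring \<Rightarrow> ('k, 'a) module \<Rightarrow> (int \<Rightarrow> 'a set) \<Rightarrow> ('k, 'b) module \<Rightarrow> (int \<Rightarrow> 'b set) \<Rightarrow>
   ('a \<Rightarrow> 'b) \<Rightarrow> bool" where
  "graded_lie_hom R L G K H f \<longleftrightarrow>
     three_graded R L G \<and> three_graded R K H \<and> lie_hom R L K f \<and> (\<forall>i. f ` G i \<subseteq> H i)"

definition graded_central_extension ::
  "'k ring \<Rightarrow> ('k, 'a) module \<Rightarrow> (int \<Rightarrow> 'a set) \<Rightarrow> ('k, 'b) module \<Rightarrow> (int \<Rightarrow> 'b set) \<Rightarrow>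
   ('a \<Rightarrow> 'b) \<Rightarrow> bool" where
  "graded_central_extension R L G K H f \<longleftrightarrow>
     graded_lie_hom R L G K H f \<and> f ` carrier L = carrier K \<and> a_kernel L K f \<subseteq> lie_center L"

definition anti_graded_involution ::
  "'k ring \<Rightarrow> ('k, 'a) module \<Rightarrow> (int \<Rightarrow> 'a set) \<Rightarrow> ('a \<Rightarrow> 'a) \<Rightarrow> bool" where
  "anti_graded_involution R L G \<epsilon> \<longleftrightarrow>
     three_graded R L G \<and> lie_hom R L L \<epsilon> \<and>
     (\<forall>x\<in>carrier L. \<epsilon> (\<epsilon> x) = x) \<and> (\<forall>i. \<epsilon> ` G i \<subseteq> G (- i))"

definition involutary_morphism ::
  "'k ring \<Rightarrow> ('k, 'a) module \<Rightarrow> (int \<Rightarrow> 'a set) \<Rightarrow> ('a \<Rightarrow> 'a) \<Rightarrow>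
   ('k, 'b) module \<Rightarrow> (int \<Rightarrow> 'b set) \<Rightarrow> ('b \<Rightarrow> 'b) \<Rightarrow> ('a \<Rightarrow> 'b) \<Rightarrow> bool" where
  "involutary_morphism R L G \<epsilon> K H \<eta> f \<longleftrightarrow>
     anti_graded_involution R L G \<epsilon> \<and> anti_graded_involution R K H \<eta> \<and>
     graded_lie_hom R L G K H f \<and> (\<forall>x\<in>carrier L. f (\<epsilon> x) = \<eta> (f x))"

definition sl2_triple :: "('k, 'a) module \<Rightarrow> 'a \<times> 'a \<times> 'a \<Rightarrow> bool" where
  "sl2_triple L = (\<lambda>(h, e, f).
     h \<in> carrier L \<and> e \<in> carrier L \<and> f \<in> carrier L \<and>
     e \<otimes>\<^bsub>L\<^esub> f = h \<and> h \<otimes>\<^bsub>L\<^esub> e = add_pow L (2::nat) e \<and> h \<otimes>\<^bsub>L\<^esub> f = \<ominus>\<^bsub>L\<^esub> (add_pow L (2::nat) f))"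

definition sl2_grading :: "('k, 'a) module \<Rightarrow> 'a \<times> 'a \<times> 'a \<Rightarrow> int \<Rightarrow> 'a set" where
  "sl2_grading L = (\<lambda>(h, e, f) i.
     if i \<in> {-1, 0, 1} then {x \<in> carrier L. h \<otimes>\<^bsub>L\<^esub> x = add_pow L (2 * i) x} else {\<zero>\<^bsub>L\<^esub>})"

definition a1_graded :: "'k ring \<Rightarrow> ('k, 'a) module \<Rightarrow> 'a \<times> 'a \<times> 'a \<Rightarrow> bool" where
  "a1_graded R L s \<longleftrightarrow>
     lie_algebra R L \<and> sl2_triple L s \<and> is_direct_sum3 R L (sl2_grading L s) \<and>
     sl2_grading L s 0 =
       submodule_span R L {x \<otimes>\<^bsub>L\<^esub> y | x y. x \<in> sl2_grading L s (-1) \<and> y \<in> sl2_grading L s 1}"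

definition a1_graded_morphism ::
  "'k ring \<Rightarrow> ('k, 'a) module \<Rightarrow> 'a \<times> 'a \<times> 'a \<Rightarrow> ('k, 'b) module \<Rightarrow> 'b \<times> 'b \<times> 'b \<Rightarrow>
   ('a \<Rightarrow> 'b) \<Rightarrow> bool" where
  "a1_graded_morphism R L s K t \<phi> \<longleftrightarrow>
     a1_graded R L s \<and> a1_graded R K t \<and> lie_hom R L K \<phi> \<and>
     (case s of (h, e, f) \<Rightarrow> (\<phi> h, \<phi> e, \<phi> f)) = t"

text \<open>Endomorphisms are taken extensional on the carrier, so that equality of elements is equality
  of endomorphisms.\<close>
definition gl :: "'k ring \<Rightarrow> ('k, 'a) module \<Rightarrow> ('k, 'a \<Rightarrow> 'a) module" where
  "gl R M =
     \<lparr>carrier = {f \<in> extensional (carrier M). linear_map R M M f},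
      mult = (\<lambda>f g. \<lambda>x\<in>carrier M. f (g x) \<ominus>\<^bsub>M\<^esub> g (f x)),
      one = undefined,
      zero = (\<lambda>x\<in>carrier M. \<zero>\<^bsub>M\<^esub>),
      add = (\<lambda>f g. \<lambda>x\<in>carrier M. f x \<oplus>\<^bsub>M\<^esub> g x),
      smult = (\<lambda>r f. \<lambda>x\<in>carrier M. r \<odot>\<^bsub>M\<^esub> f x)\<rparr>"


section \<open>Jordan structures\<close>

text \<open>The two identities for the product \<open>s\<close> of \<open>P\<^sub>\<sigma> = M\<close>, where \<open>t\<close> is the product of
  \<open>P\<^sub>-\<^sub>\<sigma> = N\<close>; the operator identity is evaluated at \<open>e\<close>.\<close>
definition jordan_triple_identities ::
  "'k ring \<Rightarrow> ('k, 'a) module \<Rightarrow> ('k, 'b) module \<Rightarrow>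
   ('a \<Rightarrow> 'b \<Rightarrow> 'a \<Rightarrow> 'a) \<Rightarrow> ('b \<Rightarrow> 'a \<Rightarrow> 'b \<Rightarrow> 'b) \<Rightarrow> bool" where
  "jordan_triple_identities R M N s t \<longleftrightarrow>
     trilinear_map R M N M M s \<and>
     (\<forall>a\<in>carrier M. \<forall>b\<in>carrier N. \<forall>c\<in>carrier M. s a b c = s c b a) \<and>
     (\<forall>a\<in>carrier M. \<forall>b\<in>carrier N. \<forall>c\<in>carrier M. \<forall>d\<in>carrier N. \<forall>e\<in>carrier M.
        s a b (s c d e) \<ominus>\<^bsub>M\<^esub> s c d (s a b e) = s (s a b c) d e \<ominus>\<^bsub>M\<^esub> s c (t b a d) e)"

record ('k, 'm, 'p) pair =
  neg_part :: "('k, 'm) module"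
  pos_part :: "('k, 'p) module"
  neg_prod :: "'m \<Rightarrow> 'p \<Rightarrow> 'm \<Rightarrow> 'm"
  pos_prod :: "'p \<Rightarrow> 'm \<Rightarrow> 'p \<Rightarrow> 'p"

definition jordan_pair :: "'k ring \<Rightarrow> ('k, 'm, 'p) pair \<Rightarrow> bool" where
  "jordan_pair R P \<longleftrightarrow>
     module R (neg_part P) \<and> module R (pos_part P) \<and>
     jordan_triple_identities R (neg_part P) (pos_part P) (neg_prod P) (pos_prod P) \<and>
     jordan_triple_identities R (pos_part P) (neg_part P) (pos_prod P) (neg_prod P)"

definition jordan_triple_system ::
  "'k ring \<Rightarrow> ('k, 't) module \<Rightarrow> ('t \<Rightarrow> 't \<Rightarrow> 't \<Rightarrow> 't) \<Rightarrow> bool" where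
  "jordan_triple_system R T p \<longleftrightarrow> module R T \<and> jordan_triple_identities R T T p p"

definition triple_pair ::
  "('k, 't) module \<Rightarrow> ('t \<Rightarrow> 't \<Rightarrow> 't \<Rightarrow> 't) \<Rightarrow> ('k, 't, 't) pair" where
  "triple_pair T p = \<lparr>neg_part = T, pos_part = T, neg_prod = p, pos_prod = p\<rparr>"

locale unital_jordan_algebra = module R J
  for R :: "'k ring" and J :: "('k, 'j) module" (structure) +
  assumes product_bilinear: "bilinear_map R J J J (\<lambda>x y. x \<otimes>\<^bsub>J\<^esub> y)"
    and product_commute: "\<lbrakk>a \<in> carrier J; b \<in> carrier J\<rbrakk> \<Longrightarrow> a \<otimes>\<^bsub>J\<^esub> b = b \<otimes>\<^bsub>J\<^esub> a"
    and jordan_identity: "\<lbrakk>a \<in> carrier J; b \<in> carrier J\<rbrakk> \<Longrightarrow>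
      ((a \<otimes>\<^bsub>J\<^esub> a) \<otimes>\<^bsub>J\<^esub> b) \<otimes>\<^bsub>J\<^esub> a = (a \<otimes>\<^bsub>J\<^esub> a) \<otimes>\<^bsub>J\<^esub> (b \<otimes>\<^bsub>J\<^esub> a)"
    and unit_in_carrier: "\<one>\<^bsub>J\<^esub> \<in> carrier J"
    and unit_neutral: "a \<in> carrier J \<Longrightarrow> \<one>\<^bsub>J\<^esub> \<otimes>\<^bsub>J\<^esub> a = a"

definition algebra_triple_product :: "('k, 'j) module \<Rightarrow> 'j \<Rightarrow> 'j \<Rightarrow> 'j \<Rightarrow> 'j" where
  "algebra_triple_product J a b c =
     ((a \<otimes>\<^bsub>J\<^esub> b) \<otimes>\<^bsub>J\<^esub> c \<oplus>\<^bsub>J\<^esub> a \<otimes>\<^bsub>J\<^esub> (b \<otimes>\<^bsub>J\<^esub> c)) \<ominus>\<^bsub>J\<^esub> b \<otimes>\<^bsub>J\<^esub> (c \<otimes>\<^bsub>J\<^esub> a)"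

definition algebra_pair :: "('k, 'j) module \<Rightarrow> ('k, 'j, 'j) pair" where
  "algebra_pair J = triple_pair J (algebra_triple_product J)"


section \<open>The Lie algebra \<open>TKK(P)\<close>\<close>

definition pair_gl :: "'k ring \<Rightarrow> ('k, 'm, 'p) pair \<Rightarrow> ('k, ('m \<Rightarrow> 'm) \<times> ('p \<Rightarrow> 'p)) module" where
  "pair_gl R P = direct_sum_algebra (gl R (neg_part P)) (gl R (pos_part P))"

definition nu :: "('k, 'm, 'p) pair \<Rightarrow> 'm \<Rightarrow> 'p \<Rightarrow> ('m \<Rightarrow> 'm) \<times> ('p \<Rightarrow> 'p)" where
  "nu P a b =
     ((\<lambda>c\<in>carrier (neg_part P). neg_prod P a b c),
      (\<lambda>d\<in>carrier (pos_part P). \<ominus>\<^bsub>pos_part P\<^esub> (pos_prod P b a d)))"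

definition instr :: "'k ring \<Rightarrow> ('k, 'm, 'p) pair \<Rightarrow> ('k, ('m \<Rightarrow> 'm) \<times> ('p \<Rightarrow> 'p)) module" where
  "instr R P = (pair_gl R P)
     \<lparr>carrier := submodule_span R (pair_gl R P)
        {nu P a b | a b. a \<in> carrier (neg_part P) \<and> b \<in> carrier (pos_part P)}\<rparr>"

text \<open>The common shape of \<open>TKK(P)\<close> and of its central cover: \<open>P\<^sub>- \<oplus> D \<oplus> P\<^sub>+\<close>, where
  \<open>X \<in> D\<close> acts on \<open>P\<^sub>-\<close> and \<open>P\<^sub>+\<close> through the two components of \<open>\<rho> X\<close>, and \<open>\<beta>\<close> is the bracket
  \<open>P\<^sub>- \<times> P\<^sub>+ \<rightarrow> D\<close>. The element \<open>a + X + b\<close> is the triple \<open>(a, X, b)\<close>.\<close>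
definition tkk_algebra ::
  "('k, 'm, 'p) pair \<Rightarrow> ('k, 'd) module \<Rightarrow> ('d \<Rightarrow> ('m \<Rightarrow> 'm) \<times> ('p \<Rightarrow> 'p)) \<Rightarrow>
   ('m \<Rightarrow> 'p \<Rightarrow> 'd) \<Rightarrow> ('k, 'm \<times> 'd \<times> 'p) module" where
  "tkk_algebra P D \<rho> \<beta> = (let M = neg_part P; N = pos_part P in
     \<lparr>carrier = carrier M \<times> carrier D \<times> carrier N,
      mult = (\<lambda>(a, X, b) (c, Y, d).
        (fst (\<rho> X) c \<ominus>\<^bsub>M\<^esub> fst (\<rho> Y) a,
         (X \<otimes>\<^bsub>D\<^esub> Y \<oplus>\<^bsub>D\<^esub> \<beta> a d) \<ominus>\<^bsub>D\<^esub> \<beta> c b,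
         snd (\<rho> X) d \<ominus>\<^bsub>N\<^esub> snd (\<rho> Y) b)),
      one = undefined,
      zero = (\<zero>\<^bsub>M\<^esub>, \<zero>\<^bsub>D\<^esub>, \<zero>\<^bsub>N\<^esub>),
      add = (\<lambda>(a, X, b) (c, Y, d). (a \<oplus>\<^bsub>M\<^esub> c, X \<oplus>\<^bsub>D\<^esub> Y, b \<oplus>\<^bsub>N\<^esub> d)),
      smult = (\<lambda>r (a, X, b). (r \<odot>\<^bsub>M\<^esub> a, r \<odot>\<^bsub>D\<^esub> X, r \<odot>\<^bsub>N\<^esub> b))\<rparr>)"

definition canonical_grading ::
  "('k, 'm, 'p) pair \<Rightarrow> ('k, 'd) module \<Rightarrow> int \<Rightarrow> ('m \<times> 'd \<times> 'p) set" where
  "canonical_grading P D i = (let M = neg_part P; N = pos_part P in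
     if i = -1 then carrier M \<times> {\<zero>\<^bsub>D\<^esub>} \<times> {\<zero>\<^bsub>N\<^esub>}
     else if i = 0 then {\<zero>\<^bsub>M\<^esub>} \<times> carrier D \<times> {\<zero>\<^bsub>N\<^esub>}
     else if i = 1 then {\<zero>\<^bsub>M\<^esub>} \<times> {\<zero>\<^bsub>D\<^esub>} \<times> carrier N
     else {(\<zero>\<^bsub>M\<^esub>, \<zero>\<^bsub>D\<^esub>, \<zero>\<^bsub>N\<^esub>)})"

definition TKK ::
  "'k ring \<Rightarrow> ('k, 'm, 'p) pair \<Rightarrow> ('k, 'm \<times> (('m \<Rightarrow> 'm) \<times> ('p \<Rightarrow> 'p)) \<times> 'p) module" where
  "TKK R P = tkk_algebra P (instr R P) (\<lambda>X. X) (nu P)"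

definition TKK_grading ::
  "'k ring \<Rightarrow> ('k, 'm, 'p) pair \<Rightarrow> int \<Rightarrow> ('m \<times> (('m \<Rightarrow> 'm) \<times> ('p \<Rightarrow> 'p)) \<times> 'p) set" where
  "TKK_grading R P = canonical_grading P (instr R P)"


section \<open>The Lie algebra \<open>\<langle>P\<^sub>-, P\<^sub>+\<rangle>\<close> and the cover of \<open>TKK(P)\<close>\<close>

type_synonym ('k, 'm, 'p) pair_tensor = "('m \<times> 'p \<Rightarrow> 'k) set"

abbreviation pair_carrier :: "('k, 'm, 'p) pair \<Rightarrow> ('m \<times> 'p) set" where
  "pair_carrier P \<equiv> carrier (neg_part P) \<times> carrier (pos_part P)"

definition ptensor_module ::
  "'k ring \<Rightarrow> ('k, 'm, 'p) pair \<Rightarrow> ('k, ('k, 'm, 'p) pair_tensor) module" where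
  "ptensor_module R P = tensor_module R (neg_part P) (pos_part P)"

definition ptensor ::
  "'k ring \<Rightarrow> ('k, 'm, 'p) pair \<Rightarrow> 'm \<Rightarrow> 'p \<Rightarrow> ('k, 'm, 'p) pair_tensor" where
  "ptensor R P = tensor R (neg_part P) (pos_part P)"

definition tensor_act ::
  "'k ring \<Rightarrow> ('k, 'm, 'p) pair \<Rightarrow> ('m \<Rightarrow> 'm) \<times> ('p \<Rightarrow> 'p) \<Rightarrow>
   ('k, 'm, 'p) pair_tensor \<Rightarrow> ('k, 'm, 'p) pair_tensor" where
  "tensor_act R P X = linear_ext R (ptensor_module R P) (ptensor_module R P) (pair_carrier P)
     (\<lambda>(a, b). ptensor R P a b)
     (\<lambda>(a, b). ptensor R P (fst X a) b \<oplus>\<^bsub>ptensor_module R P\<^esub> ptensor R P a (snd X b))"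

definition tensor_lambda ::
  "'k ring \<Rightarrow> ('k, 'm, 'p) pair \<Rightarrow> ('k, 'm, 'p) pair_tensor \<Rightarrow> ('m \<Rightarrow> 'm) \<times> ('p \<Rightarrow> 'p)" where
  "tensor_lambda R P = linear_ext R (ptensor_module R P) (instr R P) (pair_carrier P)
     (\<lambda>(a, b). ptensor R P a b) (\<lambda>(a, b). nu P a b)"

definition tensor_squares ::
  "'k ring \<Rightarrow> ('k, 'm, 'p) pair \<Rightarrow> ('k, 'm, 'p) pair_tensor set" where
  "tensor_squares R P = submodule_span R (ptensor_module R P)
     {tensor_act R P (tensor_lambda R P m) m | m. m \<in> carrier (ptensor_module R P)}"

definition angle_module ::
  "'k ring \<Rightarrow> ('k, 'm, 'p) pair \<Rightarrow> ('k, ('k, 'm, 'p) pair_tensor set) module" where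
  "angle_module R P = quotient_module (ptensor_module R P) (tensor_squares R P)"

definition angle ::
  "'k ring \<Rightarrow> ('k, 'm, 'p) pair \<Rightarrow> 'm \<Rightarrow> 'p \<Rightarrow> ('k, 'm, 'p) pair_tensor set" where
  "angle R P a b = tensor_squares R P +>\<^bsub>ptensor_module R P\<^esub> ptensor R P a b"

text \<open>As with \<open>linear_ext\<close>, the values of the bracket on \<open>\<langle>P\<^sub>-, P\<^sub>+\<rangle>\<close> are determined, because the
  elements \<open>\<langle>a, b\<rangle>\<close> span.\<close>
definition angle_bracket ::
  "'k ring \<Rightarrow> ('k, 'm, 'p) pair \<Rightarrow> ('k, 'm, 'p) pair_tensor set \<Rightarrow>
   ('k, 'm, 'p) pair_tensor set \<Rightarrow> ('k, 'm, 'p) pair_tensor set" where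
  "angle_bracket R P = (SOME \<beta>.
     bilinear_map R (angle_module R P) (angle_module R P) (angle_module R P) \<beta> \<and>
     (\<forall>a\<in>carrier (neg_part P). \<forall>b\<in>carrier (pos_part P).
      \<forall>c\<in>carrier (neg_part P). \<forall>d\<in>carrier (pos_part P).
        \<beta> (angle R P a b) (angle R P c d) =
          angle R P (neg_prod P a b c) d \<ominus>\<^bsub>angle_module R P\<^esub> angle R P c (pos_prod P b a d)))"

definition angle_algebra ::
  "'k ring \<Rightarrow> ('k, 'm, 'p) pair \<Rightarrow> ('k, ('k, 'm, 'p) pair_tensor set) module" where
  "angle_algebra R P = (angle_module R P)\<lparr>mult := angle_bracket R P\<rparr>"

definition mu ::
  "'k ring \<Rightarrow> ('k, 'm, 'p) pair \<Rightarrow> ('k, 'm, 'p) pair_tensor set \<Rightarrow> ('m \<Rightarrow> 'm) \<times> ('p \<Rightarrow> 'p)" where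
  "mu R P = linear_ext R (angle_algebra R P) (instr R P) (pair_carrier P)
     (\<lambda>(a, b). angle R P a b) (\<lambda>(a, b). nu P a b)"

definition TKK_hat ::
  "'k ring \<Rightarrow> ('k, 'm, 'p) pair \<Rightarrow>
   ('k, 'm \<times> ('k, 'm, 'p) pair_tensor set \<times> 'p) module" where
  "TKK_hat R P = tkk_algebra P (angle_algebra R P) (mu R P) (angle R P)"

definition TKK_hat_grading ::
  "'k ring \<Rightarrow> ('k, 'm, 'p) pair \<Rightarrow> int \<Rightarrow>
   ('m \<times> ('k, 'm, 'p) pair_tensor set \<times> 'p) set" where
  "TKK_hat_grading R P = canonical_grading P (angle_algebra R P)"

definition upsilon ::
  "'k ring \<Rightarrow> ('k, 'm, 'p) pair \<Rightarrow> 'm \<times> ('k, 'm, 'p) pair_tensor set \<times> 'p \<Rightarrow>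
   'm \<times> (('m \<Rightarrow> 'm) \<times> ('p \<Rightarrow> 'p)) \<times> 'p" where
  "upsilon R P = (\<lambda>(a, X, b). (a, mu R P X, b))"


section \<open>Involutions and \<open>sl\<^sub>2\<close>-triples\<close>

definition kappa_bar ::
  "'k ring \<Rightarrow> ('k, 't, 't) pair \<Rightarrow> 't \<times> (('t \<Rightarrow> 't) \<times> ('t \<Rightarrow> 't)) \<times> 't \<Rightarrow>
   't \<times> (('t \<Rightarrow> 't) \<times> ('t \<Rightarrow> 't)) \<times> 't" where
  "kappa_bar R P = (\<lambda>(a, X, b).
     (b,
      linear_ext R (instr R P) (instr R P) (pair_carrier P)
        (\<lambda>(c, d). nu P c d) (\<lambda>(c, d). \<ominus>\<^bsub>instr R P\<^esub> (nu P d c)) X,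
      a))"

definition kappa_hat ::
  "'k ring \<Rightarrow> ('k, 't, 't) pair \<Rightarrow> 't \<times> ('k, 't, 't) pair_tensor set \<times> 't \<Rightarrow>
   't \<times> ('k, 't, 't) pair_tensor set \<times> 't" where
  "kappa_hat R P = (\<lambda>(a, X, b).
     (b,
      linear_ext R (angle_algebra R P) (angle_algebra R P) (pair_carrier P)
        (\<lambda>(c, d). angle R P c d) (\<lambda>(c, d). \<ominus>\<^bsub>angle_algebra R P\<^esub> (angle R P d c)) X,
      a))"

text \<open>Triples are listed in the order \<open>(h, e, f)\<close>; the copies \<open>x\<^sub>-\<close> and \<open>x\<^sub>+\<close> of \<open>x \<in> J\<close> are
  \<open>(x, 0, 0)\<close> and \<open>(0, 0, x)\<close>.\<close>

definition sl2_bar ::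
  "'k ring \<Rightarrow> ('k, 'j) module \<Rightarrow>
   (('j \<times> (('j \<Rightarrow> 'j) \<times> ('j \<Rightarrow> 'j)) \<times> 'j) \<times> ('j \<times> (('j \<Rightarrow> 'j) \<times> ('j \<Rightarrow> 'j)) \<times> 'j) \<times>
    ('j \<times> (('j \<Rightarrow> 'j) \<times> ('j \<Rightarrow> 'j)) \<times> 'j))" where
  "sl2_bar R J = (let P = algebra_pair J; D = instr R P; two = add_pow J (2::nat) \<one>\<^bsub>J\<^esub> in
     ((\<zero>\<^bsub>J\<^esub>, \<ominus>\<^bsub>D\<^esub> (nu P \<one>\<^bsub>J\<^esub> two), \<zero>\<^bsub>J\<^esub>), (\<zero>\<^bsub>J\<^esub>, \<zero>\<^bsub>D\<^esub>, two), (\<one>\<^bsub>J\<^esub>, \<zero>\<^bsub>D\<^esub>, \<zero>\<^bsub>J\<^esub>)))"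

definition sl2_hat ::
  "'k ring \<Rightarrow> ('k, 'j) module \<Rightarrow>
   (('j \<times> ('k, 'j, 'j) pair_tensor set \<times> 'j) \<times> ('j \<times> ('k, 'j, 'j) pair_tensor set \<times> 'j) \<times>
    ('j \<times> ('k, 'j, 'j) pair_tensor set \<times> 'j))" where
  "sl2_hat R J = (let P = algebra_pair J; D = angle_algebra R P; two = add_pow J (2::nat) \<one>\<^bsub>J\<^esub> in
     ((\<zero>\<^bsub>J\<^esub>, \<ominus>\<^bsub>D\<^esub> (angle R P \<one>\<^bsub>J\<^esub> two), \<zero>\<^bsub>J\<^esub>), (\<zero>\<^bsub>J\<^esub>, \<zero>\<^bsub>D\<^esub>, two), (\<one>\<^bsub>J\<^esub>, \<zero>\<^bsub>D\<^esub>, \<zero>\<^bsub>J\<^esub>)))"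

end

theory Submission
  imports Defs
begin

text \<open>
  The proof separates two questions: why \<open>\<langle>P\<^sub>-, P\<^sub>+\<rangle>\<close> is a Lie algebra, and what may be put in the
  middle of a Tits-Kantor-Koecher algebra.

  \<^emph>\<open>The middle term.\<close> Let \<open>g\<close> be a Lie algebra, \<open>T\<close> a \<open>g\<close>-module and \<open>\<lambda> : T \<rightarrow> g\<close> an equivariant
  map into the adjoint module. The product \<open>[m, n] = \<lambda>(m) n\<close> on \<open>T\<close> satisfies the Leibniz identity,
  because \<open>\<lambda>(\<lambda>(m) n) = [\<lambda>(m), \<lambda>(n)]\<close>. It fails to be alternating exactly by the squares
  \<open>\<lambda>(m) m\<close>. Their span is \<open>g\<close>-stable (polarize the squares) and is killed by \<open>\<lambda>\<close> (as
  \<open>[\<lambda>(m), \<lambda>(m)] = 0\<close>), so the product descends to the quotient, which is a Lie algebra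
  (\<open>quotient_lie_algebra\<close>). For \<open>g = instr(P)\<close>, \<open>T = P\<^sub>- \<otimes> P\<^sub>+\<close> and \<open>\<lambda>(a \<otimes> b) = \<nu>(a, b)\<close> this is
  \<open>\<langle>P\<^sub>-, P\<^sub>+\<rangle>\<close>; equivariance is the five-linear Jordan identity, first for generators
  (\<open>nu_bracket\<close>) and then for all of \<open>instr(P)\<close> (\<open>instr_nu\<close>).

  \<^emph>\<open>Covers.\<close> Let a Lie algebra \<open>L\<close> be spanned by the values of a bilinear map
  \<open>\<beta> : P\<^sub>- \<times> P\<^sub>+ \<rightarrow> L\<close>, and let \<open>\<rho> : L \<rightarrow> instr(P)\<close> be linear with \<open>\<rho>(\<beta>(a, b)) = \<nu>(a, b)\<close> and
  \<open>[X, \<beta>(a, b)] = \<beta>(\<rho>(X) a, b) + \<beta>(a, \<rho>(X) b)\<close> (locale \<open>tkk_cover\<close>). Then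
  \<open>P\<^sub>- \<oplus> L \<oplus> P\<^sub>+\<close> is a three-graded Lie algebra (\<open>E_lie_algebra\<close>, \<open>E_three_graded\<close>), and
  \<open>a + X + b \<mapsto> a + \<rho>(X) + b\<close> is a central extension of \<open>TKK(P)\<close> (\<open>proj_central\<close>): an \<open>X\<close> with
  \<open>\<rho>(X) = 0\<close> kills each \<open>\<beta>(a, b)\<close> by the displayed formula, and these span \<open>L\<close>. Both \<open>TKK(P)\<close>
  (with \<open>\<rho>\<close> the identity) and the algebra built from \<open>\<langle>P\<^sub>-, P\<^sub>+\<rangle>\<close> (with \<open>\<rho> = \<mu>\<close>) are covers, so
  everything is proved once, for covers.

  \<^emph>\<open>Involution.\<close> For \<open>P = (T, T)\<close> suppose that \<open>\<beta>(a, b) \<mapsto> -\<beta>(b, a)\<close> extends to a linear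
  \<open>\<theta> : L \<rightarrow> L\<close>. Then \<open>\<rho>(\<theta> X)\<close> is \<open>\<rho>(X)\<close> with its two components exchanged, which makes \<open>\<theta>\<close> a Lie
  involution and its extension by the exchange of \<open>P\<^sub>-\<close> and \<open>P\<^sub>+\<close> an anti-graded one. On
  \<open>\<langle>P\<^sub>-, P\<^sub>+\<rangle>\<close> the map \<open>\<theta>\<close> exists because the flip of \<open>T \<otimes> T\<close> preserves the squares.

  \<^emph>\<open>Unital Jordan algebras.\<close> The linearized Jordan identity shows that a unital Jordan algebra is a
  triple system (\<open>algebra_triple_system\<close>). Since \<open>{1, 2, c} = {2, 1, c} = 2c\<close>, the element
  \<open>h = -\<beta>(1, 2)\<close> acts on \<open>P\<^sub>-\<close> by \<open>-2\<close> and on \<open>P\<^sub>+\<close> by \<open>2\<close>, hence by \<open>0\<close> on every \<open>\<beta>(a, b)\<close>; in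
  the absence of 2-torsion its eigenspaces are the three components.
\<close>

section \<open>Linear maps and spans\<close>

lemma (in abelian_group) neg_zero [simp]: "\<ominus> \<zero> = \<zero>"
  by (rule minus_equality) simp_all

text \<open>
  These rules make the method \<open>algebra\<close> decide identities between sums and differences in an
  abelian group; the closure facts of the atoms have to be supplied.
\<close>

lemmas (in abelian_group) abelian_group_simprules
  [algebra add: abelian_group "zero G" "add G" "a_inv G" "a_minus G"] =
  a_closed zero_closed a_inv_closed minus_closed a_assoc l_zero l_neg a_comm minus_eq
  r_zero r_neg r_neg2 r_neg1 minus_add minus_minus neg_zero a_lcomm

lemma (in abelian_group) minus_eq_zero_iff:
  assumes "x \<in> carrier G" "y \<in> carrier G"
  shows "x \<ominus> y = \<zero> \<longleftrightarrow> x = y"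
proof -
  have "x = x \<ominus> y \<oplus> y" using assms by algebra
  then show ?thesis using assms by (auto simp: minus_eq r_neg)
qed

lemma linear_mapI:
  assumes "\<And>x. x \<in> carrier M \<Longrightarrow> f x \<in> carrier N"
    and "\<And>x y. x \<in> carrier M \<Longrightarrow> y \<in> carrier M \<Longrightarrow> f (x \<oplus>\<^bsub>M\<^esub> y) = f x \<oplus>\<^bsub>N\<^esub> f y"
    and "\<And>r x. r \<in> carrier R \<Longrightarrow> x \<in> carrier M \<Longrightarrow> f (r \<odot>\<^bsub>M\<^esub> x) = r \<odot>\<^bsub>N\<^esub> f x"
  shows "linear_map R M N f"
  using assms by (simp add: linear_map_def)

lemma linear_map_closed: "linear_map R M N f \<Longrightarrow> x \<in> carrier M \<Longrightarrow> f x \<in> carrier N"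
  and linear_map_add: "linear_map R M N f \<Longrightarrow> x \<in> carrier M \<Longrightarrow> y \<in> carrier M \<Longrightarrow>
    f (x \<oplus>\<^bsub>M\<^esub> y) = f x \<oplus>\<^bsub>N\<^esub> f y"
  and linear_map_smult: "linear_map R M N f \<Longrightarrow> r \<in> carrier R \<Longrightarrow> x \<in> carrier M \<Longrightarrow>
    f (r \<odot>\<^bsub>M\<^esub> x) = r \<odot>\<^bsub>N\<^esub> f x"
  by (auto simp: linear_map_def)

lemma linear_map_zero:
  assumes "module R M" "module R N" "linear_map R M N f"
  shows "f \<zero>\<^bsub>M\<^esub> = \<zero>\<^bsub>N\<^esub>"
proof -
  interpret M: module R M by fact
  interpret N: module R N by fact
  have "f (\<zero>\<^bsub>M\<^esub> \<oplus>\<^bsub>M\<^esub> \<zero>\<^bsub>M\<^esub>) = f \<zero>\<^bsub>M\<^esub> \<oplus>\<^bsub>N\<^esub> f \<zero>\<^bsub>M\<^esub>"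
    by (rule linear_map_add[OF assms(3)]) simp_all
  moreover have "f \<zero>\<^bsub>M\<^esub> \<in> carrier N" using assms(3) by (rule linear_map_closed) simp
  ultimately show ?thesis by (simp add: N.add.l_cancel_one)
qed

lemma linear_map_neg:
  assumes "module R M" "module R N" "linear_map R M N f" "x \<in> carrier M"
  shows "f (\<ominus>\<^bsub>M\<^esub> x) = \<ominus>\<^bsub>N\<^esub> f x"
proof -
  interpret M: module R M by fact
  interpret N: module R N by fact
  have "f (\<ominus>\<^bsub>M\<^esub> x) \<oplus>\<^bsub>N\<^esub> f x = f (\<ominus>\<^bsub>M\<^esub> x \<oplus>\<^bsub>M\<^esub> x)"
    using assms(4) by (simp add: linear_map_add[OF assms(3)])
  also have "\<dots> = \<zero>\<^bsub>N\<^esub>" using assms(4) linear_map_zero[OF assms(1-3)] by (simp add: M.l_neg)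
  finally have "\<ominus>\<^bsub>N\<^esub> f x = f (\<ominus>\<^bsub>M\<^esub> x)"
    by (rule N.minus_equality) (simp_all add: linear_map_closed[OF assms(3)] assms(4))
  then show ?thesis by simp
qed

lemma linear_map_minus:
  assumes "module R M" "module R N" "linear_map R M N f" "x \<in> carrier M" "y \<in> carrier M"
  shows "f (x \<ominus>\<^bsub>M\<^esub> y) = f x \<ominus>\<^bsub>N\<^esub> f y"
proof -
  interpret M: module R M by fact
  show ?thesis
    using assms by (simp add: a_minus_def linear_map_add[OF assms(3)] linear_map_neg)
qed

lemma linear_map_id: "linear_map R M M (\<lambda>x. x)"
  by (auto intro: linear_mapI)

lemma linear_map_compose:
  assumes "linear_map R M N f" "linear_map R N Q g"
  shows "linear_map R M Q (\<lambda>x. g (f x))"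
  using assms by (simp add: linear_map_def Pi_iff)

lemma linear_map_const_zero:
  assumes "module R N"
  shows "linear_map R M N (\<lambda>x. \<zero>\<^bsub>N\<^esub>)"
proof -
  interpret N: module R N by fact
  show ?thesis by (auto intro!: linear_mapI)
qed

lemma linear_map_sum:
  assumes "module R N" "linear_map R M N f" "linear_map R M N g"
  shows "linear_map R M N (\<lambda>x. f x \<oplus>\<^bsub>N\<^esub> g x)"
proof -
  interpret N: module R N by fact
  note c = linear_map_closed[OF assms(2)] linear_map_closed[OF assms(3)]
  show ?thesis
    by (rule linear_mapI)
      (simp_all add: c linear_map_add[OF assms(2)] linear_map_add[OF assms(3)]
        linear_map_smult[OF assms(2)] linear_map_smult[OF assms(3)] N.smult_r_distr N.a_ac)
qed

lemma linear_map_uminus: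
  assumes "module R N" "linear_map R M N f"
  shows "linear_map R M N (\<lambda>x. \<ominus>\<^bsub>N\<^esub> f x)"
proof -
  interpret N: module R N by fact
  note c = linear_map_closed[OF assms(2)]
  show ?thesis
    by (rule linear_mapI)
      (simp_all add: c linear_map_add[OF assms(2)] N.minus_add
        linear_map_smult[OF assms(2)] N.smult_r_minus)
qed

lemma linear_map_diff:
  assumes "module R N" "linear_map R M N f" "linear_map R M N g"
  shows "linear_map R M N (\<lambda>x. f x \<ominus>\<^bsub>N\<^esub> g x)"
  unfolding a_minus_def by (intro linear_map_sum linear_map_uminus assms)

lemma linear_map_scaled:
  assumes "module R N" "linear_map R M N f" "r \<in> carrier R"
  shows "linear_map R M N (\<lambda>x. r \<odot>\<^bsub>N\<^esub> f x)"
proof -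
  interpret N: module R N by fact
  note c = linear_map_closed[OF assms(2)]
  show ?thesis
    by (rule linear_mapI)
      (simp_all add: c assms(3) linear_map_add[OF assms(2)] N.smult_r_distr
        linear_map_smult[OF assms(2)] N.smult_assoc1[symmetric] N.m_comm)
qed

lemma linear_map_cong:
  assumes "linear_map R M N f" "module R M" "\<And>x. x \<in> carrier M \<Longrightarrow> g x = f x"
  shows "linear_map R M N g"
proof -
  interpret M: module R M by fact
  show ?thesis using assms by (simp add: linear_map_def Pi_iff)
qed

lemma linear_map_mult_update [simp]:
  "linear_map R (M\<lparr>mult := x\<rparr>) N f = linear_map R M N f"
  "linear_map R M (N\<lparr>mult := y\<rparr>) f = linear_map R M N f"
  by (simp_all add: linear_map_def)

lemma bilinear_mapI:
  assumes "\<And>x. x \<in> carrier M \<Longrightarrow> linear_map R N Q (\<lambda>y. f x y)"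
    "\<And>y. y \<in> carrier N \<Longrightarrow> linear_map R M Q (\<lambda>x. f x y)"
  shows "bilinear_map R M N Q f"
  using assms by (simp add: bilinear_map_def)

lemma bilinear_map_left: "bilinear_map R M N Q f \<Longrightarrow> y \<in> carrier N \<Longrightarrow> linear_map R M Q (\<lambda>x. f x y)"
  and bilinear_map_right: "bilinear_map R M N Q f \<Longrightarrow> x \<in> carrier M \<Longrightarrow> linear_map R N Q (\<lambda>y. f x y)"
  by (simp_all add: bilinear_map_def)

lemma bilinear_map_closed:
  "bilinear_map R M N Q f \<Longrightarrow> x \<in> carrier M \<Longrightarrow> y \<in> carrier N \<Longrightarrow> f x y \<in> carrier Q"
  by (drule (1) bilinear_map_left) (rule linear_map_closed)

lemma submodule_subset: "submodule N R M \<Longrightarrow> N \<subseteq> carrier M"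
  using subgroup.subset[OF submodule.axioms(1)] by fastforce

lemma submodule_zero: "submodule N R M \<Longrightarrow> \<zero>\<^bsub>M\<^esub> \<in> N"
  by (auto simp: submodule_def subgroup_def)

lemma span_is_submodule:
  assumes "module R M" "S \<subseteq> carrier M"
  shows "submodule (submodule_span R M S) R M"
proof -
  interpret M: module R M by fact
  have c: "carrier M \<in> {N. submodule N R M \<and> S \<subseteq> N}"
    using M.carrier_is_submodule assms by simp
  show ?thesis
  proof (rule M.submoduleI)
    show "submodule_span R M S \<subseteq> carrier M" unfolding submodule_span_def using c by blast
    show "\<zero>\<^bsub>M\<^esub> \<in> submodule_span R M S"
      by (auto simp: submodule_span_def submodule_def subgroup_def)
  qed (simp_all add: submodule_span_def M.submoduleE)
qed

lemma span_subset_carrier: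
  assumes "module R M" "S \<subseteq> carrier M" shows "submodule_span R M S \<subseteq> carrier M"
  using span_is_submodule[OF assms] by (rule submodule_subset)

lemma span_superset: "S \<subseteq> submodule_span R M S"
  by (auto simp: submodule_span_def)

lemma span_least: "submodule N R M \<Longrightarrow> S \<subseteq> N \<Longrightarrow> submodule_span R M S \<subseteq> N"
  by (auto simp: submodule_span_def)

lemma span_induct [consumes 3, case_names gen zero add smult]:
  assumes "module R M" "S \<subseteq> carrier M" "x \<in> submodule_span R M S"
    and "\<And>s. s \<in> S \<Longrightarrow> P s"
    and "P \<zero>\<^bsub>M\<^esub>"
    and "\<And>x y. x \<in> submodule_span R M S \<Longrightarrow> y \<in> submodule_span R M S \<Longrightarrow> P x \<Longrightarrow> P y \<Longrightarrow> P (x \<oplus>\<^bsub>M\<^esub> y)"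
    and "\<And>r x. r \<in> carrier R \<Longrightarrow> x \<in> submodule_span R M S \<Longrightarrow> P x \<Longrightarrow> P (r \<odot>\<^bsub>M\<^esub> x)"
  shows "P x"
proof -
  interpret M: module R M by fact
  let ?W = "submodule_span R M S"
  note W = span_is_submodule[OF assms(1,2)]
  note sub = submodule_subset[OF W]
  have z: "\<zero>\<^bsub>M\<^esub> \<in> ?W" using W by (auto simp: submodule_def subgroup_def)
  have "submodule {x \<in> ?W. P x} R M"
  proof (rule M.submoduleI)
    fix a assume a: "a \<in> {x \<in> ?W. P x}"
    have "\<ominus>\<^bsub>M\<^esub> a = (\<ominus>\<^bsub>R\<^esub> \<one>\<^bsub>R\<^esub>) \<odot>\<^bsub>M\<^esub> a" using a sub by (auto simp: M.smult_l_minus)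
    moreover have "P ((\<ominus>\<^bsub>R\<^esub> \<one>\<^bsub>R\<^esub>) \<odot>\<^bsub>M\<^esub> a)" using a by (intro assms(7)) auto
    ultimately show "\<ominus>\<^bsub>M\<^esub> a \<in> {x \<in> ?W. P x}" using a M.submoduleE(3)[OF W, of a] by simp
  qed (use sub z assms M.submoduleE[OF W] in auto)
  moreover have "S \<subseteq> {x \<in> ?W. P x}" using span_superset assms(4) by fast
  ultimately show ?thesis using assms(3) span_least by blast
qed

lemma linear_map_eq_on_span:
  assumes "module R M" "module R N" "linear_map R M N f" "linear_map R M N g" "S \<subseteq> carrier M"
    and "\<And>s. s \<in> S \<Longrightarrow> f s = g s" "x \<in> submodule_span R M S"
  shows "f x = g x"
proof -
  note sub = subsetD[OF span_subset_carrier[OF assms(1,5)]]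
  from assms(1,5,7) show ?thesis
  proof (induction rule: span_induct)
    case (add x y) then show ?case
      using linear_map_add[OF assms(3)] linear_map_add[OF assms(4)] sub by simp
  next
    case (smult r x) then show ?case
      using linear_map_smult[OF assms(3)] linear_map_smult[OF assms(4)] sub by simp
  qed (simp_all add: assms(6) linear_map_zero[OF assms(1,2,3)] linear_map_zero[OF assms(1,2,4)])
qed

lemma linear_map_image_span:
  assumes "module R M" "module R N" "linear_map R M N f" "S \<subseteq> carrier M" "submodule W R N"
    and "\<And>s. s \<in> S \<Longrightarrow> f s \<in> W" "x \<in> submodule_span R M S"
  shows "f x \<in> W"
proof -
  interpret N: module R N by fact
  note sub = subsetD[OF span_subset_carrier[OF assms(1,4)]]
  from assms(1,4,7) show ?thesis
  proof (induction rule: span_induct)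
    case zero
    then show ?case using linear_map_zero[OF assms(1-3)] assms(5) by (auto simp: submodule_def subgroup_def)
  next
    case (add x y) then show ?case
      using linear_map_add[OF assms(3)] sub N.submoduleE(5)[OF assms(5)] by simp
  next
    case (smult r x) then show ?case
      using linear_map_smult[OF assms(3)] sub N.submoduleE(4)[OF assms(5)] by simp
  qed (use assms in auto)
qed

text \<open>
  A map chosen by \<open>linear_ext\<close> has its defining properties as soon as one such map is known.
\<close>

lemma linear_ext_eq:
  assumes "linear_map R M N f" "\<And>s. s \<in> S \<Longrightarrow> f (g s) = y s"
  shows "linear_map R M N (linear_ext R M N S g y)"
    and "s \<in> S \<Longrightarrow> linear_ext R M N S g y (g s) = y s"
proof -
  have "linear_map R M N (linear_ext R M N S g y) \<and> (\<forall>s\<in>S. linear_ext R M N S g y (g s) = y s)"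
    unfolding linear_ext_def by (rule someI[of _ f]) (use assms in auto)
  then show "linear_map R M N (linear_ext R M N S g y)"
    and "s \<in> S \<Longrightarrow> linear_ext R M N S g y (g s) = y s" by auto
qed

section \<open>Quotient modules\<close>

locale quotient_by_submodule = module R M for R :: "'k ring" and M :: "('k, 'a) module" (structure) +
  fixes N assumes N: "submodule N R M"
begin

abbreviation "Q \<equiv> quotient_module M N"
abbreviation "\<pi> x \<equiv> N +>\<^bsub>M\<^esub> x"

lemma N_sub: "N \<subseteq> carrier M" using N by (rule submodule_subset)

sublocale N: abelian_subgroup N M
proof (rule abelian_subgroupI3)
  show "additive_subgroup N M" using N by (simp add: additive_subgroup_def submodule_def)
qed (rule M.abelian_group_axioms)

lemma proj_eq_iff:
  assumes "x \<in> carrier M" "y \<in> carrier M"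
  shows "\<pi> x = \<pi> y \<longleftrightarrow> x \<ominus>\<^bsub>M\<^esub> y \<in> N"
proof -
  have "\<pi> x = \<pi> y \<longleftrightarrow> x \<in> \<pi> y"
    using N.a_rcos_self[OF assms(1)] N.a_repr_independence'[OF _ assms(2), of x] by auto
  also have "\<dots> \<longleftrightarrow> x \<ominus>\<^bsub>M\<^esub> y \<in> N"
    using N.a_rcos_module[OF assms(2,1)] by (simp add: a_minus_def)
  finally show ?thesis .
qed

lemma carrier_Q: "carrier Q = \<pi> ` carrier M"
  by (auto simp: quotient_module_def A_RCOSETS_def')

lemma add_Q: "x \<in> carrier M \<Longrightarrow> y \<in> carrier M \<Longrightarrow> \<pi> x \<oplus>\<^bsub>Q\<^esub> \<pi> y = \<pi> (x \<oplus>\<^bsub>M\<^esub> y)"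
  by (simp add: quotient_module_def N.a_rcos_sum)

lemma zero_Q: "\<zero>\<^bsub>Q\<^esub> = \<pi> \<zero>\<^bsub>M\<^esub>"
  using N_sub by (simp add: quotient_module_def)

lemma smult_Q:
  assumes "r \<in> carrier R" "x \<in> carrier M"
  shows "r \<odot>\<^bsub>Q\<^esub> \<pi> x = \<pi> (r \<odot>\<^bsub>M\<^esub> x)"
proof -
  have "\<pi> (r \<odot>\<^bsub>M\<^esub> y) = \<pi> (r \<odot>\<^bsub>M\<^esub> x)" if "y \<in> \<pi> x" for y
  proof -
    from that obtain n where n: "n \<in> N" "y = n \<oplus>\<^bsub>M\<^esub> x" by (auto simp: a_r_coset_def')
    then have c: "n \<in> carrier M" "y \<in> carrier M" using N_sub assms by auto
    have "r \<odot>\<^bsub>M\<^esub> y \<ominus>\<^bsub>M\<^esub> r \<odot>\<^bsub>M\<^esub> x = r \<odot>\<^bsub>M\<^esub> n"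
      using n(2) c assms M.r_neg by (simp add: smult_r_distr a_minus_def M.a_assoc)
    also have "\<dots> \<in> N" using submoduleE(4)[OF N] n assms by simp
    finally show ?thesis using proj_eq_iff c assms by simp
  qed
  then have "(\<Union>y\<in>\<pi> x. \<pi> (r \<odot>\<^bsub>M\<^esub> y)) = (\<Union>y\<in>\<pi> x. \<pi> (r \<odot>\<^bsub>M\<^esub> x))"
    by (rule SUP_cong[OF refl])
  also have "\<dots> = \<pi> (r \<odot>\<^bsub>M\<^esub> x)" using N.a_rcos_self[OF assms(2)] by blast
  finally show ?thesis by (simp only: quotient_module_def module.simps)
qed

lemma module_Q: "module R Q"
proof (rule moduleI)
  show "cring R" by (rule R.cring_axioms)
  show "abelian_group Q"
  proof (rule abelian_groupI)
    fix x assume "x \<in> carrier Q"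
    then obtain a where a: "x = \<pi> a" "a \<in> carrier M" by (auto simp: carrier_Q)
    then have "\<pi> (\<ominus>\<^bsub>M\<^esub> a) \<oplus>\<^bsub>Q\<^esub> x = \<zero>\<^bsub>Q\<^esub>" by (simp add: add_Q zero_Q M.l_neg del: M.a_coset_add_zero)
    then show "\<exists>y\<in>carrier Q. y \<oplus>\<^bsub>Q\<^esub> x = \<zero>\<^bsub>Q\<^esub>" using a by (auto simp: carrier_Q)
  qed (auto simp: carrier_Q add_Q zero_Q M.a_ac simp del: M.a_coset_add_zero)
qed (auto simp: carrier_Q add_Q smult_Q smult_l_distr smult_r_distr smult_assoc1)

lemma proj_linear: "linear_map R M Q \<pi>"
  by (rule linear_mapI) (auto simp: carrier_Q add_Q smult_Q)

lemma proj_eq_zero_iff: "x \<in> carrier M \<Longrightarrow> \<pi> x = \<zero>\<^bsub>Q\<^esub> \<longleftrightarrow> x \<in> N"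
  unfolding zero_Q using proj_eq_iff[of x "\<zero>\<^bsub>M\<^esub>"] by (simp add: a_minus_def del: M.a_coset_add_zero)

lemma quotient_lift:
  assumes "module R K" "linear_map R M K f" "\<And>n. n \<in> N \<Longrightarrow> f n = \<zero>\<^bsub>K\<^esub>"
  obtains g where "linear_map R Q K g" "\<And>x. x \<in> carrier M \<Longrightarrow> g (\<pi> x) = f x"
proof
  interpret K: module R K by fact
  define g where "g X = f (SOME x. x \<in> carrier M \<and> \<pi> x = X)" for X
  show 1: "g (\<pi> x) = f x" if x: "x \<in> carrier M" for x
  proof -
    define y where "y = (SOME y. y \<in> carrier M \<and> \<pi> y = \<pi> x)"
    have y: "y \<in> carrier M \<and> \<pi> y = \<pi> x" unfolding y_def by (rule someI[of _ x]) (simp add: x)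
    then have "f (y \<ominus>\<^bsub>M\<^esub> x) = \<zero>\<^bsub>K\<^esub>" using assms(3) proj_eq_iff[of y x] x by simp
    then have "f y = f x"
      using linear_map_minus[OF module_axioms assms(1,2)] x y linear_map_closed[OF assms(2)]
      by (simp add: K.minus_eq_zero_iff)
    then show ?thesis by (simp add: g_def y_def)
  qed
  show "linear_map R Q K g"
    by (rule linear_mapI) (auto simp: carrier_Q 1 add_Q smult_Q linear_map_closed[OF assms(2)]
        linear_map_add[OF assms(2)] linear_map_smult[OF assms(2)])
qed

end

section \<open>Free modules and tensor products\<close>

locale free_module_setup = R?: cring R for R :: "'k ring" (structure) + fixes S :: "'s set"
begin

abbreviation "F \<equiv> free_module R S"
abbreviation "\<delta> \<equiv> free_gen R"

lemma carrier_F: "f \<in> carrier F \<longleftrightarrow>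
    (\<forall>s. f s \<in> carrier R) \<and> finite {s. f s \<noteq> \<zero>} \<and> (\<forall>s. f s \<noteq> \<zero> \<longrightarrow> s \<in> S)"
  by (auto simp: free_module_def)

lemma F_ops [simp]: "(f \<oplus>\<^bsub>F\<^esub> g) s = f s \<oplus> g s" "\<zero>\<^bsub>F\<^esub> s = \<zero>" "(r \<odot>\<^bsub>F\<^esub> f) s = r \<otimes> f s"
  by (simp_all add: free_module_def)

lemma F_add_closed: "f \<in> carrier F \<Longrightarrow> g \<in> carrier F \<Longrightarrow> f \<oplus>\<^bsub>F\<^esub> g \<in> carrier F"
  unfolding carrier_F F_ops
  by (auto intro: finite_subset[of _ "{s. f s \<noteq> \<zero>} \<union> {s. g s \<noteq> \<zero>}"]) (metis r_zero)

lemma F_smult_closed: "r \<in> carrier R \<Longrightarrow> f \<in> carrier F \<Longrightarrow> r \<odot>\<^bsub>F\<^esub> f \<in> carrier F"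
  unfolding carrier_F F_ops
  by (auto intro: finite_subset[of _ "{s. f s \<noteq> \<zero>}"]) (metis r_null)

lemma module_F: "module R F"
proof (rule moduleI)
  show "abelian_group F"
  proof (rule abelian_groupI)
    fix f assume f: "f \<in> carrier F"
    have "(\<ominus> \<one>) \<odot>\<^bsub>F\<^esub> f \<in> carrier F" by (rule F_smult_closed) (simp_all add: f)
    moreover have "(\<ominus> \<one>) \<odot>\<^bsub>F\<^esub> f \<oplus>\<^bsub>F\<^esub> f = \<zero>\<^bsub>F\<^esub>"
      using f by (auto simp: carrier_F l_minus l_neg)
    ultimately show "\<exists>g\<in>carrier F. g \<oplus>\<^bsub>F\<^esub> f = \<zero>\<^bsub>F\<^esub>" by blast
  next
    show "\<zero>\<^bsub>F\<^esub> \<in> carrier F" by (simp add: carrier_F)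
  qed (simp_all add: F_add_closed, auto simp: carrier_F a_ac)
qed (simp_all add: R.cring_axioms F_smult_closed, auto simp: carrier_F l_distr r_distr m_assoc)

lemma gen_closed: "s \<in> S \<Longrightarrow> \<delta> s \<in> carrier F"
  by (auto simp: carrier_F free_gen_def)

lemma F_spanned: "carrier F = submodule_span R F (\<delta> ` S)"
proof
  have sub: "\<delta> ` S \<subseteq> carrier F" using gen_closed by blast
  note W = span_is_submodule[OF module_F sub]
  interpret F: module R F by (rule module_F)
  show "submodule_span R F (\<delta> ` S) \<subseteq> carrier F"
    by (rule span_subset_carrier[OF module_F sub])
  \<comment> \<open>Induction on a finite set that contains the support: split off one value at a time.\<close>
  have *: "f \<in> submodule_span R F (\<delta> ` S)"
    if "finite A" "f \<in> carrier F" "{s. f s \<noteq> \<zero>} \<subseteq> A" for A f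
    using that
  proof (induction A arbitrary: f rule: finite_induct)
    case empty
    then have "f = \<zero>\<^bsub>F\<^esub>" by (auto simp del: F_ops simp: free_module_def)
    then show ?case using submodule_zero[OF W] by (simp only:)
  next
    case (insert a A)
    show ?case
    proof (cases "f a = \<zero>")
      case True
      then have "{s. f s \<noteq> \<zero>} \<subseteq> A" using insert.prems by auto
      then show ?thesis using insert by blast
    next
      case False
      let ?g = "f(a := \<zero>)"
      have aS: "a \<in> S" "f a \<in> carrier R" using False insert.prems(1) by (auto simp: carrier_F)
      have "finite {s. f s \<noteq> \<zero>}" using insert.prems(1) by (simp add: carrier_F)
      then have "finite {s. ?g s \<noteq> \<zero>}" by (rule rev_finite_subset) auto
      then have "?g \<in> carrier F" using insert.prems(1) unfolding carrier_F by auto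
      moreover have "{s. ?g s \<noteq> \<zero>} \<subseteq> A" using insert.prems(2) by auto
      ultimately have "?g \<in> submodule_span R F (\<delta> ` S)" by (rule insert.IH)
      moreover have "\<delta> a \<in> submodule_span R F (\<delta> ` S)"
        using aS(1) span_superset by (rule subsetD[rotated, OF imageI])
      then have "f a \<odot>\<^bsub>F\<^esub> \<delta> a \<in> submodule_span R F (\<delta> ` S)"
        by (rule F.submoduleE(4)[OF W aS(2)])
      ultimately have "?g \<oplus>\<^bsub>F\<^esub> f a \<odot>\<^bsub>F\<^esub> \<delta> a \<in> submodule_span R F (\<delta> ` S)"
        by (rule F.submoduleE(5)[OF W])
      moreover have "f = ?g \<oplus>\<^bsub>F\<^esub> f a \<odot>\<^bsub>F\<^esub> \<delta> a"
        using insert.prems(1) by (auto simp: carrier_F free_gen_def fun_eq_iff)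
      ultimately show ?thesis by (simp only:)
    qed
  qed
  show "carrier F \<subseteq> submodule_span R F (\<delta> ` S)"
  proof
    fix f assume "f \<in> carrier F"
    then show "f \<in> submodule_span R F (\<delta> ` S)" using *[of "{s. f s \<noteq> \<zero>}" f] by (simp add: carrier_F)
  qed
qed

lemma free_lift:
  assumes "module R K" "\<And>s. s \<in> S \<Longrightarrow> \<phi> s \<in> carrier K"
  obtains f where "linear_map R F K f" "\<And>s. s \<in> S \<Longrightarrow> f (\<delta> s) = \<phi> s"
proof
  interpret K: module R K by fact
  define f where "f g = finsum K (\<lambda>s. g s \<odot>\<^bsub>K\<^esub> \<phi> s) {s. g s \<noteq> \<zero>}" for g
  \<comment> \<open>The sum over the support of two functions has to be compared over a common finite set.\<close>
  have f_eq: "f g = finsum K (\<lambda>s. g s \<odot>\<^bsub>K\<^esub> \<phi> s) A"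
    if "g \<in> carrier F" "finite A" "{s. g s \<noteq> \<zero>} \<subseteq> A" "A \<subseteq> S" for g A
    unfolding f_def
  proof (rule K.add.finprod_mono_neutral_cong_left)
    show "(\<lambda>s. g s \<odot>\<^bsub>K\<^esub> \<phi> s) \<in> A \<rightarrow> carrier K" using that assms(2) by (auto simp: carrier_F)
    show "\<And>i. i \<in> A - {s. g s \<noteq> \<zero>} \<Longrightarrow> g i \<odot>\<^bsub>K\<^esub> \<phi> i = \<zero>\<^bsub>K\<^esub>" using that assms(2) by auto
  qed (use that in auto)
  have c: "g s \<odot>\<^bsub>K\<^esub> \<phi> s \<in> carrier K" if "g \<in> carrier F" "s \<in> S" for g s
    using that assms(2) by (auto simp: carrier_F)
  show "linear_map R F K f"
  proof (rule linear_mapI)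
    fix g assume g: "g \<in> carrier F"
    then show "f g \<in> carrier K"
      unfolding f_def using assms(2) by (intro K.finsum_closed) (auto simp: carrier_F)
    fix h assume h: "h \<in> carrier F"
    let ?A = "{s. g s \<noteq> \<zero>} \<union> {s. h s \<noteq> \<zero>}"
    have A: "finite ?A" "?A \<subseteq> S" using g h by (auto simp: carrier_F)
    have "{s. (g \<oplus>\<^bsub>F\<^esub> h) s \<noteq> \<zero>} \<subseteq> ?A" by auto
    then have "f (g \<oplus>\<^bsub>F\<^esub> h) = finsum K (\<lambda>s. (g \<oplus>\<^bsub>F\<^esub> h) s \<odot>\<^bsub>K\<^esub> \<phi> s) ?A"
      using A g h by (intro f_eq F_add_closed) auto
    also have "\<dots> = finsum K (\<lambda>s. g s \<odot>\<^bsub>K\<^esub> \<phi> s \<oplus>\<^bsub>K\<^esub> h s \<odot>\<^bsub>K\<^esub> \<phi> s) ?A"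
    proof (rule K.finsum_cong')
      fix s assume "s \<in> ?A"
      then have "s \<in> S" using A by blast
      then show "(g \<oplus>\<^bsub>F\<^esub> h) s \<odot>\<^bsub>K\<^esub> \<phi> s = g s \<odot>\<^bsub>K\<^esub> \<phi> s \<oplus>\<^bsub>K\<^esub> h s \<odot>\<^bsub>K\<^esub> \<phi> s"
        using g h assms(2) by (simp add: K.smult_l_distr carrier_F)
    qed (use A c g h in auto)
    also have "\<dots> = f g \<oplus>\<^bsub>K\<^esub> f h"
      using A g h c by (subst K.finsum_addf) (auto simp: f_eq[of _ ?A])
    finally show "f (g \<oplus>\<^bsub>F\<^esub> h) = f g \<oplus>\<^bsub>K\<^esub> f h" .
  next
    fix r g assume r: "r \<in> carrier R" and g: "g \<in> carrier F"
    let ?A = "{s. g s \<noteq> \<zero>}"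
    have A: "finite ?A" "?A \<subseteq> S" using g by (auto simp: carrier_F)
    have "{s. (r \<odot>\<^bsub>F\<^esub> g) s \<noteq> \<zero>} \<subseteq> ?A" using r by auto
    then have "f (r \<odot>\<^bsub>F\<^esub> g) = finsum K (\<lambda>s. (r \<odot>\<^bsub>F\<^esub> g) s \<odot>\<^bsub>K\<^esub> \<phi> s) ?A"
      using A g r by (intro f_eq F_smult_closed) auto
    also have "\<dots> = finsum K (\<lambda>s. r \<odot>\<^bsub>K\<^esub> (g s \<odot>\<^bsub>K\<^esub> \<phi> s)) ?A"
    proof (rule K.finsum_cong')
      fix s assume "s \<in> ?A"
      then have "s \<in> S" using A by blast
      then show "(r \<odot>\<^bsub>F\<^esub> g) s \<odot>\<^bsub>K\<^esub> \<phi> s = r \<odot>\<^bsub>K\<^esub> (g s \<odot>\<^bsub>K\<^esub> \<phi> s)"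
        using g r assms(2) by (simp add: K.smult_assoc1 carrier_F)
    qed (use A c g r in auto)
    also have "\<dots> = r \<odot>\<^bsub>K\<^esub> f g"
      unfolding f_def using A g r c by (subst K.finsum_smult_ldistr) auto
    finally show "f (r \<odot>\<^bsub>F\<^esub> g) = r \<odot>\<^bsub>K\<^esub> f g" .
  qed
  fix s assume s: "s \<in> S"
  have "f (\<delta> s) = finsum K (\<lambda>t. \<delta> s t \<odot>\<^bsub>K\<^esub> \<phi> t) {s}"
    using s gen_closed by (intro f_eq) (auto simp: free_gen_def)
  also have "\<dots> = \<phi> s" using s assms(2) by (simp add: free_gen_def)
  finally show "f (\<delta> s) = \<phi> s" .
qed

end

locale tensor_product = M: module R M + N: module R N
  for R :: "'k ring" and M :: "('k, 'a) module" and N :: "('k, 'b) module"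
begin

sublocale free_module_setup R "carrier M \<times> carrier N"
  by unfold_locales

abbreviation "T \<equiv> tensor_module R M N"

lemma gen_M_closed [simp]: "a \<in> carrier M \<Longrightarrow> b \<in> carrier N \<Longrightarrow> \<delta> (a, b) \<in> carrier F"
  by (simp add: gen_closed)

lemma relations_closed: "tensor_relations R M N \<subseteq> carrier F"
proof -
  interpret F: module R F by (rule module_F)
  show ?thesis by (auto simp: tensor_relations_def Let_def)
qed

sublocale Q: quotient_by_submodule R F "tensor_null R M N"
proof (intro quotient_by_submodule.intro quotient_by_submodule_axioms.intro module_F)
  show "submodule (tensor_null R M N) R F"
    unfolding tensor_null_def by (rule span_is_submodule[OF module_F relations_closed])
qed

lemma tensor_eq: "tensor R M N a b = Q.\<pi> (\<delta> (a, b))"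
  by (simp add: tensor_def)

lemma T_eq: "T = Q.Q" by (simp add: tensor_module_def)

lemma module_T: "module R T" unfolding T_eq by (rule Q.module_Q)

lemma tensor_closed: "a \<in> carrier M \<Longrightarrow> b \<in> carrier N \<Longrightarrow> tensor R M N a b \<in> carrier T"
  unfolding T_eq tensor_eq Q.carrier_Q by simp

lemma relation_trivial:
  assumes "x \<in> carrier F" "y \<in> carrier F" "x \<ominus>\<^bsub>F\<^esub> y \<in> tensor_relations R M N"
  shows "Q.\<pi> x = Q.\<pi> y"
proof -
  have "x \<ominus>\<^bsub>F\<^esub> y \<in> tensor_null R M N"
    unfolding tensor_null_def using assms(3) span_superset by (rule rev_subsetD)
  then show ?thesis using Q.proj_eq_iff[OF assms(1,2)] by (rule iffD2[rotated])
qed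

lemma tensor_relations_intros:
  assumes "a \<in> carrier M" "b \<in> carrier N"
  shows "a' \<in> carrier M \<Longrightarrow>
      \<delta> (a \<oplus>\<^bsub>M\<^esub> a', b) \<ominus>\<^bsub>F\<^esub> (\<delta> (a, b) \<oplus>\<^bsub>F\<^esub> \<delta> (a', b)) \<in> tensor_relations R M N"
    and "b' \<in> carrier N \<Longrightarrow>
      \<delta> (a, b \<oplus>\<^bsub>N\<^esub> b') \<ominus>\<^bsub>F\<^esub> (\<delta> (a, b) \<oplus>\<^bsub>F\<^esub> \<delta> (a, b')) \<in> tensor_relations R M N"
    and "r \<in> carrier R \<Longrightarrow>
      \<delta> (r \<odot>\<^bsub>M\<^esub> a, b) \<ominus>\<^bsub>F\<^esub> (r \<odot>\<^bsub>F\<^esub> \<delta> (a, b)) \<in> tensor_relations R M N"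
    and "r \<in> carrier R \<Longrightarrow>
      \<delta> (a, r \<odot>\<^bsub>N\<^esub> b) \<ominus>\<^bsub>F\<^esub> (r \<odot>\<^bsub>F\<^esub> \<delta> (a, b)) \<in> tensor_relations R M N"
  unfolding tensor_relations_def Let_def
  subgoal by (rule UnI1, rule UnI1, rule UnI1, intro CollectI exI conjI, rule refl) (use assms in simp_all)
  subgoal by (rule UnI1, rule UnI1, rule UnI2, intro CollectI exI conjI, rule refl) (use assms in simp_all)
  subgoal by (rule UnI1, rule UnI2, intro CollectI exI conjI, rule refl) (use assms in simp_all)
  subgoal by (rule UnI2, intro CollectI exI conjI, rule refl) (use assms in simp_all)
  done

lemma tensor_bilinear: "bilinear_map R M N T (tensor R M N)"
proof (intro bilinear_mapI linear_mapI; (rule tensor_closed, assumption+)?)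
  interpret F: module R F by (rule module_F)
  note eqs = T_eq tensor_eq Q.add_Q Q.smult_Q
  fix a b assume ab: "a \<in> carrier M" "b \<in> carrier N"
  { fix b' assume "b' \<in> carrier N"
    with ab show "tensor R M N a (b \<oplus>\<^bsub>N\<^esub> b') = tensor R M N a b \<oplus>\<^bsub>T\<^esub> tensor R M N a b'"
      by (simp add: eqs) (rule relation_trivial, simp_all add: tensor_relations_intros) }
  { fix a' assume "a' \<in> carrier M"
    with ab show "tensor R M N (a \<oplus>\<^bsub>M\<^esub> a') b = tensor R M N a b \<oplus>\<^bsub>T\<^esub> tensor R M N a' b"
      by (simp add: eqs) (rule relation_trivial, simp_all add: tensor_relations_intros) }
  fix r assume "r \<in> carrier R"
  with ab show "tensor R M N (r \<odot>\<^bsub>M\<^esub> a) b = r \<odot>\<^bsub>T\<^esub> tensor R M N a b"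
    by (simp add: eqs) (rule relation_trivial, simp_all add: tensor_relations_intros)
  from ab \<open>r \<in> carrier R\<close> show "tensor R M N a (r \<odot>\<^bsub>N\<^esub> b) = r \<odot>\<^bsub>T\<^esub> tensor R M N a b"
    by (simp add: eqs) (rule relation_trivial, simp_all add: tensor_relations_intros)
qed

abbreviation "pure \<equiv> (\<lambda>(a, b). tensor R M N a b) ` (carrier M \<times> carrier N)"

lemma pure_closed: "pure \<subseteq> carrier T" using tensor_closed by auto

lemma tensor_spanned: "carrier T = submodule_span R T pure"
proof
  show "submodule_span R T pure \<subseteq> carrier T" by (rule span_subset_carrier[OF module_T pure_closed])
  show "carrier T \<subseteq> submodule_span R T pure"
  proof
    fix t assume "t \<in> carrier T"
    then obtain x where x: "x \<in> carrier F" "t = Q.\<pi> x" by (auto simp: T_eq Q.carrier_Q)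
    have "Q.\<pi> x \<in> submodule_span R T pure"
    proof (rule linear_map_image_span[OF module_F module_T, where S = "\<delta> ` (carrier M \<times> carrier N)"])
      show "linear_map R F T Q.\<pi>" unfolding T_eq by (rule Q.proj_linear)
      show "\<delta> ` (carrier M \<times> carrier N) \<subseteq> carrier F" using gen_closed by blast
      show "submodule (submodule_span R T pure) R T" by (rule span_is_submodule[OF module_T pure_closed])
      show "x \<in> submodule_span R F (\<delta> ` (carrier M \<times> carrier N))" using x F_spanned by simp
      fix s assume "s \<in> \<delta> ` (carrier M \<times> carrier N)"
      then have "Q.\<pi> s \<in> pure" by (auto simp: tensor_eq)
      then show "Q.\<pi> s \<in> submodule_span R T pure" by (rule subsetD[OF span_superset])
    qed
    then show "t \<in> submodule_span R T pure" using x by simp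
  qed
qed

text \<open>
  The linear extension of \<open>\<phi>\<close> to the free module kills the defining relations because \<open>\<phi>\<close> is
  bilinear, so it descends.
\<close>

lemma tensor_lift:
  assumes K: "module R K" and \<phi>: "bilinear_map R M N K \<phi>"
  obtains f where "linear_map R T K f"
    "\<And>a b. a \<in> carrier M \<Longrightarrow> b \<in> carrier N \<Longrightarrow> f (tensor R M N a b) = \<phi> a b"
proof -
  interpret K: module R K by fact
  interpret F: module R F by (rule module_F)
  note \<phi>_rules = bilinear_map_closed[OF \<phi>]
    linear_map_add[OF bilinear_map_left[OF \<phi>]] linear_map_smult[OF bilinear_map_left[OF \<phi>]]
    linear_map_add[OF bilinear_map_right[OF \<phi>]] linear_map_smult[OF bilinear_map_right[OF \<phi>]]
  obtain g where g: "linear_map R F K g"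
    "\<And>s. s \<in> carrier M \<times> carrier N \<Longrightarrow> g (\<delta> s) = (case s of (a, b) \<Rightarrow> \<phi> a b)"
    by (rule free_lift[OF K, of "\<lambda>(a, b). \<phi> a b"]) (auto simp: \<phi>_rules)
  note g_rules = linear_map_minus[OF module_F K g(1)] linear_map_add[OF g(1)] linear_map_smult[OF g(1)] g(2)
  have rel: "g x = \<zero>\<^bsub>K\<^esub>" if "x \<in> tensor_relations R M N" for x
    using that by (auto simp: tensor_relations_def Let_def g_rules \<phi>_rules K.minus_eq_zero_iff)
  have "g x = \<zero>\<^bsub>K\<^esub>" if "x \<in> tensor_null R M N" for x
    by (rule linear_map_eq_on_span[OF module_F K g(1) linear_map_const_zero[OF K] relations_closed])
      (use rel that in \<open>auto simp: tensor_null_def\<close>)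
  then obtain f where "linear_map R T K f" "\<And>x. x \<in> carrier F \<Longrightarrow> f (Q.\<pi> x) = g x"
    using Q.quotient_lift[OF K g(1)] unfolding T_eq by blast
  then show thesis using that by (simp add: tensor_eq g(2))
qed

end

section \<open>Lie algebras from equivariant maps to the adjoint module\<close>

lemma module_mult_update [simp]: "module R (M\<lparr>mult := f\<rparr>) \<longleftrightarrow> module R M"
  by (simp add: module_def module_axioms_def abelian_group_def abelian_group_axioms_def
      abelian_monoid_def)

lemma bilinear_map_rules:
  assumes "module R M" "module R N" "module R Q" "bilinear_map R M N Q f"
  shows "x \<in> carrier M \<Longrightarrow> y \<in> carrier N \<Longrightarrow> f x y \<in> carrier Q"
    and "x \<in> carrier M \<Longrightarrow> x' \<in> carrier M \<Longrightarrow> y \<in> carrier N \<Longrightarrow> f (x \<oplus>\<^bsub>M\<^esub> x') y = f x y \<oplus>\<^bsub>Q\<^esub> f x' y"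
    and "x \<in> carrier M \<Longrightarrow> y \<in> carrier N \<Longrightarrow> y' \<in> carrier N \<Longrightarrow> f x (y \<oplus>\<^bsub>N\<^esub> y') = f x y \<oplus>\<^bsub>Q\<^esub> f x y'"
    and "x \<in> carrier M \<Longrightarrow> x' \<in> carrier M \<Longrightarrow> y \<in> carrier N \<Longrightarrow> f (x \<ominus>\<^bsub>M\<^esub> x') y = f x y \<ominus>\<^bsub>Q\<^esub> f x' y"
    and "x \<in> carrier M \<Longrightarrow> y \<in> carrier N \<Longrightarrow> y' \<in> carrier N \<Longrightarrow> f x (y \<ominus>\<^bsub>N\<^esub> y') = f x y \<ominus>\<^bsub>Q\<^esub> f x y'"
    and "x \<in> carrier M \<Longrightarrow> y \<in> carrier N \<Longrightarrow> f (\<ominus>\<^bsub>M\<^esub> x) y = \<ominus>\<^bsub>Q\<^esub> f x y"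
    and "x \<in> carrier M \<Longrightarrow> y \<in> carrier N \<Longrightarrow> f x (\<ominus>\<^bsub>N\<^esub> y) = \<ominus>\<^bsub>Q\<^esub> f x y"
    and "r \<in> carrier R \<Longrightarrow> x \<in> carrier M \<Longrightarrow> y \<in> carrier N \<Longrightarrow> f (r \<odot>\<^bsub>M\<^esub> x) y = r \<odot>\<^bsub>Q\<^esub> f x y"
    and "r \<in> carrier R \<Longrightarrow> x \<in> carrier M \<Longrightarrow> y \<in> carrier N \<Longrightarrow> f x (r \<odot>\<^bsub>N\<^esub> y) = r \<odot>\<^bsub>Q\<^esub> f x y"
    and "y \<in> carrier N \<Longrightarrow> f \<zero>\<^bsub>M\<^esub> y = \<zero>\<^bsub>Q\<^esub>"
    and "x \<in> carrier M \<Longrightarrow> f x \<zero>\<^bsub>N\<^esub> = \<zero>\<^bsub>Q\<^esub>"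
  using bilinear_map_closed[OF assms(4)]
    linear_map_add[OF bilinear_map_left[OF assms(4)]] linear_map_add[OF bilinear_map_right[OF assms(4)]]
    linear_map_minus[OF assms(1,3) bilinear_map_left[OF assms(4)]]
    linear_map_minus[OF assms(2,3) bilinear_map_right[OF assms(4)]]
    linear_map_neg[OF assms(1,3) bilinear_map_left[OF assms(4)]]
    linear_map_neg[OF assms(2,3) bilinear_map_right[OF assms(4)]]
    linear_map_smult[OF bilinear_map_left[OF assms(4)]] linear_map_smult[OF bilinear_map_right[OF assms(4)]]
    linear_map_zero[OF assms(1,3) bilinear_map_left[OF assms(4)]]
    linear_map_zero[OF assms(2,3) bilinear_map_right[OF assms(4)]]
  by simp_all

lemma bilinear_map_eq_on_span:
  assumes "module R M" "module R N" "module R Q" "bilinear_map R M N Q f" "bilinear_map R M N Q g"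
    and S: "S \<subseteq> carrier M" "S' \<subseteq> carrier N"
    and eq: "\<And>s t. s \<in> S \<Longrightarrow> t \<in> S' \<Longrightarrow> f s t = g s t"
    and x: "x \<in> submodule_span R M S" and y: "y \<in> submodule_span R N S'"
  shows "f x y = g x y"
proof -
  have y': "y \<in> carrier N" using y span_subset_carrier[OF assms(2) S(2)] by blast
  have "f s y = g s y" if s: "s \<in> S" for s
    using S(1) s eq
    by (intro linear_map_eq_on_span[OF assms(2,3) bilinear_map_right[OF assms(4)]
          bilinear_map_right[OF assms(5)] S(2) _ y]) auto
  then show ?thesis
    by (intro linear_map_eq_on_span[OF assms(1,3) bilinear_map_left[OF assms(4) y']
          bilinear_map_left[OF assms(5) y'] S(1) _ x])
qed

lemma alternating_bilinear_antisym:
  assumes "module R M" "module R Q" "bilinear_map R M M Q f" "\<And>x. x \<in> carrier M \<Longrightarrow> f x x = \<zero>\<^bsub>Q\<^esub>"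
    "x \<in> carrier M" "y \<in> carrier M"
  shows "f x y = \<ominus>\<^bsub>Q\<^esub> f y x"
proof -
  interpret M: module R M by fact
  interpret Q: module R Q by fact
  note [simp] = bilinear_map_rules[OF assms(1,1,2,3)]
  have "f (x \<oplus>\<^bsub>M\<^esub> y) (x \<oplus>\<^bsub>M\<^esub> y) = f x x \<oplus>\<^bsub>Q\<^esub> f y y \<oplus>\<^bsub>Q\<^esub> (f x y \<oplus>\<^bsub>Q\<^esub> f y x)"
    using assms(5,6) by (simp add: Q.a_ac)
  moreover have "f (x \<oplus>\<^bsub>M\<^esub> y) (x \<oplus>\<^bsub>M\<^esub> y) = \<zero>\<^bsub>Q\<^esub>" using assms(5,6) by (intro assms(4)) simp
  ultimately have "f x y \<oplus>\<^bsub>Q\<^esub> f y x = \<zero>\<^bsub>Q\<^esub>" using assms(4-6) by simp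
  then show ?thesis using Q.minus_equality[of "f x y" "f y x"] assms(5,6) by simp
qed

context lie_algebra
begin

lemma module_L: "module R L" by (rule module_axioms)

lemmas bracket_rules = bilinear_map_rules[OF module_L module_L module_L bracket_bilinear]

end

text \<open>
  A Lie algebra \<open>g\<close>, a \<open>g\<close>-module \<open>T\<close> and an equivariant map from \<open>T\<close> to the adjoint module: the
  data from which \<open>\<langle>P\<^sub>-, P\<^sub>+\<rangle>\<close> and its Lie bracket arise.
\<close>

locale equivariant_to_adjoint =
  g: lie_algebra R g + T: module R T
  for R :: "'k ring" and g :: "('k, 'a) module" and T :: "('k, 'b) module" +
  fixes act :: "'a \<Rightarrow> 'b \<Rightarrow> 'b" and lam :: "'b \<Rightarrow> 'a"
  assumes act_bilinear: "bilinear_map R g T T act"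
    and act_bracket: "x \<in> carrier g \<Longrightarrow> y \<in> carrier g \<Longrightarrow> m \<in> carrier T \<Longrightarrow>
      act (x \<otimes>\<^bsub>g\<^esub> y) m = act x (act y m) \<ominus>\<^bsub>T\<^esub> act y (act x m)"
    and lam_linear: "linear_map R T g lam"
    and lam_act: "x \<in> carrier g \<Longrightarrow> m \<in> carrier T \<Longrightarrow> lam (act x m) = x \<otimes>\<^bsub>g\<^esub> lam m"
begin

definition "squares = submodule_span R T {act (lam m) m | m. m \<in> carrier T}"

lemmas act_rules = bilinear_map_rules[OF g.module_L T.module_axioms T.module_axioms act_bilinear]

lemmas lam_rules = linear_map_closed[OF lam_linear] linear_map_add[OF lam_linear]
  linear_map_smult[OF lam_linear] linear_map_zero[OF T.module_axioms g.module_L lam_linear]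
  linear_map_minus[OF T.module_axioms g.module_L lam_linear]

lemma square_gens: "{act (lam m) m | m. m \<in> carrier T} \<subseteq> carrier T"
  by (auto simp: act_rules lam_rules)

sublocale Q: quotient_by_submodule R T squares
proof (intro quotient_by_submodule.intro quotient_by_submodule_axioms.intro T.module_axioms)
  show "submodule squares R T"
    unfolding squares_def by (rule span_is_submodule[OF T.module_axioms square_gens])
qed

lemma square_mem: "m \<in> carrier T \<Longrightarrow> act (lam m) m \<in> squares"
  unfolding squares_def using span_superset[of "{act (lam m) m | m. m \<in> carrier T}" R T] by blast

text \<open>
  Polarization of \<open>m \<mapsto> \<lambda>(m) m\<close>. Modulo the squares it says that the product \<open>\<lambda>(m) n\<close> is
  skew-symmetric.
\<close>

lemma polarized_square_mem:
  assumes "m \<in> carrier T" "n \<in> carrier T"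
  shows "act (lam m) n \<oplus>\<^bsub>T\<^esub> act (lam n) m \<in> squares"
proof -
  have c: "act (lam m) n \<in> carrier T" "act (lam n) m \<in> carrier T"
    "act (lam m) m \<in> carrier T" "act (lam n) n \<in> carrier T"
    using assms by (simp_all add: act_rules lam_rules)
  have "act (lam (m \<oplus>\<^bsub>T\<^esub> n)) (m \<oplus>\<^bsub>T\<^esub> n) =
      (act (lam m) m \<oplus>\<^bsub>T\<^esub> act (lam n) m) \<oplus>\<^bsub>T\<^esub> (act (lam m) n \<oplus>\<^bsub>T\<^esub> act (lam n) n)"
    using assms by (simp add: act_rules lam_rules)
  then have "act (lam m) n \<oplus>\<^bsub>T\<^esub> act (lam n) m =
      act (lam (m \<oplus>\<^bsub>T\<^esub> n)) (m \<oplus>\<^bsub>T\<^esub> n) \<ominus>\<^bsub>T\<^esub> act (lam m) m \<ominus>\<^bsub>T\<^esub> act (lam n) n"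
    using c by (simp only:) algebra
  also have "\<dots> \<in> squares"
    unfolding a_minus_def
    by (intro T.submoduleE(5)[OF Q.N] T.submoduleE(3)[OF Q.N] square_mem) (use assms in simp_all)
  finally show ?thesis .
qed

text \<open>
  By equivariance \<open>\<lambda>(\<lambda>(m) m) = [\<lambda>(m), \<lambda>(m)]\<close>, and the bracket of \<open>g\<close> is alternating.
\<close>

lemma lam_squares: "m \<in> squares \<Longrightarrow> lam m = \<zero>\<^bsub>g\<^esub>"
  unfolding squares_def
  by (rule linear_map_eq_on_span[OF T.module_axioms g.module_L lam_linear
        linear_map_const_zero[OF g.module_L] square_gens])
    (auto simp: lam_act lam_rules g.bracket_alternating)

text \<open>
  With \<open>n' = x n\<close> one has \<open>x (\<lambda>(n) n) = \<lambda>(n') n + \<lambda>(n) n'\<close>, a polarized square.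
\<close>

lemma act_squares:
  assumes "x \<in> carrier g" "m \<in> squares"
  shows "act x m \<in> squares"
proof (rule linear_map_image_span[OF T.module_axioms T.module_axioms
        bilinear_map_right[OF act_bilinear assms(1)] square_gens Q.N])
  show "m \<in> submodule_span R T {act (lam m) m |m. m \<in> carrier T}"
    using assms(2) by (simp add: squares_def)
  fix s assume "s \<in> {act (lam m) m |m. m \<in> carrier T}"
  then obtain n where n: "n \<in> carrier T" "s = act (lam n) n" by blast
  have c: "act x (act (lam n) n) \<in> carrier T" "act (lam n) (act x n) \<in> carrier T"
    using n assms by (simp_all add: act_rules lam_rules)
  have "act (lam (act x n)) n = act x (act (lam n) n) \<ominus>\<^bsub>T\<^esub> act (lam n) (act x n)"
    using n assms by (simp add: lam_act act_bracket lam_rules)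
  then have "act x s = act (lam (act x n)) n \<oplus>\<^bsub>T\<^esub> act (lam n) (act x n)"
    using c n by (simp only:) algebra
  also have "\<dots> \<in> squares" using n assms by (intro polarized_square_mem) (simp_all add: act_rules)
  finally show "act x s \<in> squares" .
qed

lemma bracket_well_defined:
  assumes "m \<in> carrier T" "m' \<in> carrier T" "n \<in> carrier T" "n' \<in> carrier T"
    and "Q.\<pi> m = Q.\<pi> m'" "Q.\<pi> n = Q.\<pi> n'"
  shows "Q.\<pi> (act (lam m) n) = Q.\<pi> (act (lam m') n')"
proof -
  have mn: "m \<ominus>\<^bsub>T\<^esub> m' \<in> squares" "n \<ominus>\<^bsub>T\<^esub> n' \<in> squares" using assms Q.proj_eq_iff by simp_all
  have "lam m = lam m'"
    using lam_squares[OF mn(1)] assms by (simp add: lam_rules g.minus_eq_zero_iff)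
  moreover have "act (lam m') n \<ominus>\<^bsub>T\<^esub> act (lam m') n' \<in> squares"
    using act_squares[OF _ mn(2), of "lam m'"] assms by (simp add: lam_rules act_rules)
  ultimately show ?thesis using assms Q.proj_eq_iff by (simp add: lam_rules act_rules)
qed

text \<open>
  The product is defined through arbitrary representatives.
\<close>

lemma quotient_bracket_exists:
  obtains \<beta> where "bilinear_map R Q.Q Q.Q Q.Q \<beta>"
    "\<And>m n. m \<in> carrier T \<Longrightarrow> n \<in> carrier T \<Longrightarrow> \<beta> (Q.\<pi> m) (Q.\<pi> n) = Q.\<pi> (act (lam m) n)"
proof
  define rep where "rep X = (SOME m. m \<in> carrier T \<and> Q.\<pi> m = X)" for X
  have rep: "rep (Q.\<pi> m) \<in> carrier T \<and> Q.\<pi> (rep (Q.\<pi> m)) = Q.\<pi> m" if "m \<in> carrier T" for m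
    unfolding rep_def by (rule someI[of _ m]) (simp add: that)
  show \<beta>: "Q.\<pi> (act (lam (rep (Q.\<pi> m))) (rep (Q.\<pi> n))) = Q.\<pi> (act (lam m) n)"
    if "m \<in> carrier T" "n \<in> carrier T" for m n
    using rep[OF that(1)] rep[OF that(2)] that by (intro bracket_well_defined) simp_all
  show "bilinear_map R Q.Q Q.Q Q.Q (\<lambda>X Y. Q.\<pi> (act (lam (rep X)) (rep Y)))"
    by (intro bilinear_mapI linear_mapI)
      (auto simp: Q.carrier_Q Q.add_Q Q.smult_Q \<beta> lam_rules act_rules)
qed

context
  fixes \<beta>
  assumes \<beta>_bilinear: "bilinear_map R Q.Q Q.Q Q.Q \<beta>"
    and \<beta>_eq: "m \<in> carrier T \<Longrightarrow> n \<in> carrier T \<Longrightarrow> \<beta> (Q.\<pi> m) (Q.\<pi> n) = Q.\<pi> (act (lam m) n)"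
begin

text \<open>
  The squares vanish, so the bracket is alternating; together with the Leibniz identity inherited
  from the module structure this gives the Jacobi identity. The bracket is a parameter because
  only its values on cosets matter.
\<close>

lemma quotient_lie_algebra: "lie_algebra R (Q.Q\<lparr>mult := \<beta>\<rparr>)"
proof (intro lie_algebra.intro lie_algebra_axioms.intro)
  interpret QQ: module R Q.Q by (rule Q.module_Q)
  show "module R (Q.Q\<lparr>mult := \<beta>\<rparr>)" by (simp add: Q.module_Q)
  show "bilinear_map R (Q.Q\<lparr>mult := \<beta>\<rparr>) (Q.Q\<lparr>mult := \<beta>\<rparr>) (Q.Q\<lparr>mult := \<beta>\<rparr>)
     (\<lambda>x y. x \<otimes>\<^bsub>Q.Q\<lparr>mult := \<beta>\<rparr>\<^esub> y)"
    using \<beta>_bilinear by (simp add: bilinear_map_def)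
  have alt: "\<beta> x x = \<zero>\<^bsub>Q.Q\<^esub>" if "x \<in> carrier Q.Q" for x
  proof -
    from that obtain m where m: "m \<in> carrier T" "x = Q.\<pi> m" by (auto simp: Q.carrier_Q)
    then show ?thesis
      using Q.proj_eq_zero_iff[of "act (lam m) m"] square_mem[of m]
      by (simp add: \<beta>_eq act_rules lam_rules)
  qed
  then show "x \<otimes>\<^bsub>Q.Q\<lparr>mult := \<beta>\<rparr>\<^esub> x = \<zero>\<^bsub>Q.Q\<lparr>mult := \<beta>\<rparr>\<^esub>" if "x \<in> carrier (Q.Q\<lparr>mult := \<beta>\<rparr>)" for x
    using that by simp
  note rules = bilinear_map_rules[OF Q.module_Q Q.module_Q Q.module_Q \<beta>_bilinear]
  note anti = alternating_bilinear_antisym[OF Q.module_Q Q.module_Q \<beta>_bilinear alt]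
  have leib: "\<beta> (\<beta> x y) z = \<beta> x (\<beta> y z) \<ominus>\<^bsub>Q.Q\<^esub> \<beta> y (\<beta> x z)"
    if "x \<in> carrier Q.Q" "y \<in> carrier Q.Q" "z \<in> carrier Q.Q" for x y z
    using that linear_map_minus[OF T.module_axioms Q.module_Q Q.proj_linear]
    by (auto simp: Q.carrier_Q \<beta>_eq act_rules lam_rules lam_act act_bracket)
  fix x y z assume "x \<in> carrier (Q.Q\<lparr>mult := \<beta>\<rparr>)" "y \<in> carrier (Q.Q\<lparr>mult := \<beta>\<rparr>)"
    "z \<in> carrier (Q.Q\<lparr>mult := \<beta>\<rparr>)"
  then have x: "x \<in> carrier Q.Q" "y \<in> carrier Q.Q" "z \<in> carrier Q.Q" by simp_all
  then have "\<beta> z (\<beta> x y) = \<ominus>\<^bsub>Q.Q\<^esub> \<beta> (\<beta> x y) z" "\<beta> y (\<beta> z x) = \<ominus>\<^bsub>Q.Q\<^esub> \<beta> y (\<beta> x z)"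
    using anti[of z "\<beta> x y"] anti[of z x] by (simp_all add: rules)
  moreover have "\<beta> x (\<beta> y z) \<in> carrier Q.Q" "\<beta> y (\<beta> x z) \<in> carrier Q.Q" using x by (simp_all add: rules)
  ultimately have "\<beta> x (\<beta> y z) \<oplus>\<^bsub>Q.Q\<^esub> \<beta> y (\<beta> z x) \<oplus>\<^bsub>Q.Q\<^esub> \<beta> z (\<beta> x y) = \<zero>\<^bsub>Q.Q\<^esub>"
    unfolding leib[OF x] by (simp only:) algebra
  then show "x \<otimes>\<^bsub>Q.Q\<lparr>mult := \<beta>\<rparr>\<^esub> (y \<otimes>\<^bsub>Q.Q\<lparr>mult := \<beta>\<rparr>\<^esub> z) \<oplus>\<^bsub>Q.Q\<lparr>mult := \<beta>\<rparr>\<^esub>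
      y \<otimes>\<^bsub>Q.Q\<lparr>mult := \<beta>\<rparr>\<^esub> (z \<otimes>\<^bsub>Q.Q\<lparr>mult := \<beta>\<rparr>\<^esub> x) \<oplus>\<^bsub>Q.Q\<lparr>mult := \<beta>\<rparr>\<^esub>
      z \<otimes>\<^bsub>Q.Q\<lparr>mult := \<beta>\<rparr>\<^esub> (x \<otimes>\<^bsub>Q.Q\<lparr>mult := \<beta>\<rparr>\<^esub> y) = \<zero>\<^bsub>Q.Q\<lparr>mult := \<beta>\<rparr>\<^esub>" by simp
qed

end

end

section \<open>Endomorphism algebras and Lie subalgebras\<close>

lemma gl_carrier: "f \<in> carrier (gl R M) \<longleftrightarrow> f \<in> extensional (carrier M) \<and> linear_map R M M f"
  by (simp add: gl_def)

lemma gl_apply: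
  assumes "x \<in> carrier M"
  shows "(f \<oplus>\<^bsub>gl R M\<^esub> g) x = f x \<oplus>\<^bsub>M\<^esub> g x" "(r \<odot>\<^bsub>gl R M\<^esub> f) x = r \<odot>\<^bsub>M\<^esub> f x"
    "\<zero>\<^bsub>gl R M\<^esub> x = \<zero>\<^bsub>M\<^esub>" "(f \<otimes>\<^bsub>gl R M\<^esub> g) x = f (g x) \<ominus>\<^bsub>M\<^esub> g (f x)"
  using assms by (simp_all add: gl_def)

lemma gl_ext:
  assumes "f \<in> carrier (gl R M)" "g \<in> carrier (gl R M)" "\<And>x. x \<in> carrier M \<Longrightarrow> f x = g x"
  shows "f = g"
  using assms unfolding gl_carrier by (blast intro: extensionalityI)

lemma restrict_in_gl:
  assumes "module R M" "linear_map R M M f"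
  shows "restrict f (carrier M) \<in> carrier (gl R M)"
  using assms linear_map_cong[OF assms(2,1), of "restrict f (carrier M)"] by (simp add: gl_carrier)

locale endomorphisms = module R M for R :: "'k ring" and M :: "('k, 'a) module"
begin

lemma gl_linear: "f \<in> carrier (gl R M) \<Longrightarrow> linear_map R M M f"
  by (simp add: gl_carrier)

lemmas gl_closed = linear_map_closed[OF gl_linear]
lemmas gl_rules = gl_closed linear_map_add[OF gl_linear] linear_map_smult[OF gl_linear]
  linear_map_minus[OF module_axioms module_axioms gl_linear]
  linear_map_neg[OF module_axioms module_axioms gl_linear]
  linear_map_zero[OF module_axioms module_axioms gl_linear]

lemma gl_op_closed [simp]:
  shows "f \<in> carrier (gl R M) \<Longrightarrow> g \<in> carrier (gl R M) \<Longrightarrow> f \<oplus>\<^bsub>gl R M\<^esub> g \<in> carrier (gl R M)"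
    "r \<in> carrier R \<Longrightarrow> f \<in> carrier (gl R M) \<Longrightarrow> r \<odot>\<^bsub>gl R M\<^esub> f \<in> carrier (gl R M)"
    "\<zero>\<^bsub>gl R M\<^esub> \<in> carrier (gl R M)"
    "f \<in> carrier (gl R M) \<Longrightarrow> g \<in> carrier (gl R M) \<Longrightarrow> f \<otimes>\<^bsub>gl R M\<^esub> g \<in> carrier (gl R M)"
proof -
  note add = linear_map_sum[OF module_axioms] and sc = linear_map_scaled[OF module_axioms]
    and df = linear_map_diff[OF module_axioms]
  note res = restrict_in_gl[OF module_axioms]
  show "f \<in> carrier (gl R M) \<Longrightarrow> g \<in> carrier (gl R M) \<Longrightarrow> f \<oplus>\<^bsub>gl R M\<^esub> g \<in> carrier (gl R M)"
    using res[OF add[OF gl_linear gl_linear]] by (simp add: gl_def)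
  show "r \<in> carrier R \<Longrightarrow> f \<in> carrier (gl R M) \<Longrightarrow> r \<odot>\<^bsub>gl R M\<^esub> f \<in> carrier (gl R M)"
    using res[OF sc[OF gl_linear]] by (simp add: gl_def)
  show "\<zero>\<^bsub>gl R M\<^esub> \<in> carrier (gl R M)"
    using res[OF linear_map_const_zero[OF module_axioms]] by (simp add: gl_def)
  show "f \<in> carrier (gl R M) \<Longrightarrow> g \<in> carrier (gl R M) \<Longrightarrow> f \<otimes>\<^bsub>gl R M\<^esub> g \<in> carrier (gl R M)"
    using res[OF df[OF linear_map_compose[OF gl_linear gl_linear] linear_map_compose[OF gl_linear gl_linear]]]
    by (simp add: gl_def)
qed

lemma module_gl: "module R (gl R M)"
proof (rule moduleI)
  show "abelian_group (gl R M)"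
  proof (rule abelian_groupI)
    fix f assume f: "f \<in> carrier (gl R M)"
    \<comment> \<open>The inverse is multiplication by \<open>-1\<close>, whose membership is already known.\<close>
    have n: "(\<ominus>\<^bsub>R\<^esub> \<one>\<^bsub>R\<^esub>) \<odot>\<^bsub>gl R M\<^esub> f \<in> carrier (gl R M)" using f by simp
    moreover have "(\<ominus>\<^bsub>R\<^esub> \<one>\<^bsub>R\<^esub>) \<odot>\<^bsub>gl R M\<^esub> f \<oplus>\<^bsub>gl R M\<^esub> f = \<zero>\<^bsub>gl R M\<^esub>"
      using f n by (intro gl_ext[of _ R M]) (simp_all add: gl_apply gl_closed smult_l_minus M.l_neg)
    ultimately show "\<exists>g\<in>carrier (gl R M). g \<oplus>\<^bsub>gl R M\<^esub> f = \<zero>\<^bsub>gl R M\<^esub>" by blast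
  qed (simp_all, (rule gl_ext[of _ R M], simp_all add: gl_apply gl_closed M.a_ac)+)
qed (simp_all add: R.cring_axioms, (rule gl_ext[of _ R M],
      simp_all add: gl_apply gl_closed smult_l_distr smult_r_distr smult_assoc1)+)

lemma gl_lie_algebra: "lie_algebra R (gl R M)"
proof (intro lie_algebra.intro lie_algebra_axioms.intro module_gl bilinear_mapI linear_mapI)
  fix f g h assume fgh: "f \<in> carrier (gl R M)" "g \<in> carrier (gl R M)" "h \<in> carrier (gl R M)"
  show "f \<otimes>\<^bsub>gl R M\<^esub> (g \<otimes>\<^bsub>gl R M\<^esub> h) \<oplus>\<^bsub>gl R M\<^esub> g \<otimes>\<^bsub>gl R M\<^esub> (h \<otimes>\<^bsub>gl R M\<^esub> f) \<oplus>\<^bsub>gl R M\<^esub>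
      h \<otimes>\<^bsub>gl R M\<^esub> (f \<otimes>\<^bsub>gl R M\<^esub> g) = \<zero>\<^bsub>gl R M\<^esub>"
  proof (rule gl_ext[of _ R M])
    fix x assume x: "x \<in> carrier M"
    have c: "f (g (h x)) \<in> carrier M" "f (h (g x)) \<in> carrier M" "g (f (h x)) \<in> carrier M"
      "g (h (f x)) \<in> carrier M" "h (f (g x)) \<in> carrier M" "h (g (f x)) \<in> carrier M"
      using fgh x by (simp_all add: gl_closed)
    show "(f \<otimes>\<^bsub>gl R M\<^esub> (g \<otimes>\<^bsub>gl R M\<^esub> h) \<oplus>\<^bsub>gl R M\<^esub> g \<otimes>\<^bsub>gl R M\<^esub> (h \<otimes>\<^bsub>gl R M\<^esub> f) \<oplus>\<^bsub>gl R M\<^esub>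
      h \<otimes>\<^bsub>gl R M\<^esub> (f \<otimes>\<^bsub>gl R M\<^esub> g)) x = \<zero>\<^bsub>gl R M\<^esub> x"
      apply (simp add: gl_apply gl_rules fgh x)
      using c apply algebra
      done
  qed (simp_all add: fgh)
next
  fix f assume f: "f \<in> carrier (gl R M)"
  then show "f \<otimes>\<^bsub>gl R M\<^esub> f = \<zero>\<^bsub>gl R M\<^esub>"
    by (intro gl_ext[of _ R M]) (simp_all add: gl_apply gl_closed M.minus_eq M.r_neg)
next
  fix f g h assume fgh: "f \<in> carrier (gl R M)" "g \<in> carrier (gl R M)" "h \<in> carrier (gl R M)"
  show "f \<otimes>\<^bsub>gl R M\<^esub> (g \<oplus>\<^bsub>gl R M\<^esub> h) = f \<otimes>\<^bsub>gl R M\<^esub> g \<oplus>\<^bsub>gl R M\<^esub> f \<otimes>\<^bsub>gl R M\<^esub> h"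
    using fgh by (intro gl_ext[of _ R M]) (simp_all add: gl_apply gl_rules M.minus_eq M.minus_add M.a_ac)
next
  fix f g h assume fgh: "f \<in> carrier (gl R M)" "g \<in> carrier (gl R M)" "h \<in> carrier (gl R M)"
  show "(g \<oplus>\<^bsub>gl R M\<^esub> h) \<otimes>\<^bsub>gl R M\<^esub> f = g \<otimes>\<^bsub>gl R M\<^esub> f \<oplus>\<^bsub>gl R M\<^esub> h \<otimes>\<^bsub>gl R M\<^esub> f"
    using fgh by (intro gl_ext[of _ R M]) (simp_all add: gl_apply gl_rules M.minus_eq M.minus_add M.a_ac)
qed (simp_all, (rule gl_ext[of _ R M], simp_all add: gl_apply gl_rules M.minus_eq
     smult_r_distr smult_r_minus)+)

end

lemma direct_sum_simps [simp]:
  "carrier (direct_sum_algebra M N) = carrier M \<times> carrier N"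
  "(a, b) \<otimes>\<^bsub>direct_sum_algebra M N\<^esub> (c, d) = (a \<otimes>\<^bsub>M\<^esub> c, b \<otimes>\<^bsub>N\<^esub> d)"
  "(a, b) \<oplus>\<^bsub>direct_sum_algebra M N\<^esub> (c, d) = (a \<oplus>\<^bsub>M\<^esub> c, b \<oplus>\<^bsub>N\<^esub> d)"
  "r \<odot>\<^bsub>direct_sum_algebra M N\<^esub> (a, b) = (r \<odot>\<^bsub>M\<^esub> a, r \<odot>\<^bsub>N\<^esub> b)"
  "\<zero>\<^bsub>direct_sum_algebra M N\<^esub> = (\<zero>\<^bsub>M\<^esub>, \<zero>\<^bsub>N\<^esub>)"
  by (simp_all add: direct_sum_algebra_def)

lemma direct_sum_lie_algebra:
  assumes "lie_algebra R M" "lie_algebra R N"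
  shows "lie_algebra R (direct_sum_algebra M N)"
proof -
  interpret M: lie_algebra R M by fact
  interpret N: lie_algebra R N by fact
  have "abelian_group (direct_sum_algebra M N)"
    by (rule abelian_groupI)
      (auto simp: M.a_ac N.a_ac intro: bexI[of _ "\<ominus>\<^bsub>M\<^esub> _"] M.l_neg N.l_neg)
  then have "module R (direct_sum_algebra M N)"
    by (intro moduleI M.R.cring_axioms)
      (auto simp: M.smult_l_distr N.smult_l_distr M.smult_r_distr N.smult_r_distr
        M.smult_assoc1 N.smult_assoc1)
  then show ?thesis
    by (intro lie_algebra.intro lie_algebra_axioms.intro bilinear_mapI linear_mapI)
      (auto simp: M.bracket_rules N.bracket_rules M.bracket_alternating N.bracket_alternating
        M.jacobi N.jacobi)
qed

lemma lie_subalgebra: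
  assumes "lie_algebra R L" "submodule W R L" "\<And>x y. x \<in> W \<Longrightarrow> y \<in> W \<Longrightarrow> x \<otimes>\<^bsub>L\<^esub> y \<in> W"
  shows "lie_algebra R (L\<lparr>carrier := W\<rparr>)"
proof -
  interpret L: lie_algebra R L by fact
  note sub = subsetD[OF submodule_subset[OF assms(2)]]
  have "module R (L\<lparr>carrier := W\<rparr>)"
    by (rule submodule.submodule_is_module[OF assms(2) L.module_L])
  then show ?thesis
    by (intro lie_algebra.intro lie_algebra_axioms.intro bilinear_mapI linear_mapI)
      (auto simp: sub assms(3) L.bracket_rules L.bracket_alternating L.jacobi)
qed

lemma span_bracket_closed:
  assumes "lie_algebra R L" "S \<subseteq> carrier L"
    and S: "\<And>x y. x \<in> S \<Longrightarrow> y \<in> S \<Longrightarrow> x \<otimes>\<^bsub>L\<^esub> y \<in> submodule_span R L S"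
    and x: "x \<in> submodule_span R L S" and y: "y \<in> submodule_span R L S"
  shows "x \<otimes>\<^bsub>L\<^esub> y \<in> submodule_span R L S"
proof -
  interpret L: lie_algebra R L by fact
  note W = span_is_submodule[OF L.module_L assms(2)]
  have y': "y \<in> carrier L" using span_subset_carrier[OF L.module_L assms(2)] y by blast
  have "s \<otimes>\<^bsub>L\<^esub> y \<in> submodule_span R L S" if s: "s \<in> S" for s
    by (rule linear_map_image_span[OF L.module_L L.module_L bilinear_map_right[OF L.bracket_bilinear]
          assms(2) W _ y]) (use S s assms(2) in auto)
  then show ?thesis
    by (rule linear_map_image_span[OF L.module_L L.module_L bilinear_map_left[OF L.bracket_bilinear y']
          assms(2) W _ x])
qed

section \<open>Jordan pairs and their inner structure algebra\<close>

lemma (in module) submodule_from_smult: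
  assumes "H \<subseteq> carrier M" "\<zero>\<^bsub>M\<^esub> \<in> H"
    "\<And>a b. a \<in> H \<Longrightarrow> b \<in> H \<Longrightarrow> a \<oplus>\<^bsub>M\<^esub> b \<in> H"
    "\<And>r a. r \<in> carrier R \<Longrightarrow> a \<in> H \<Longrightarrow> r \<odot>\<^bsub>M\<^esub> a \<in> H"
  shows "submodule H R M"
proof (rule submoduleI)
  fix a assume a: "a \<in> H"
  have "(\<ominus>\<^bsub>R\<^esub> \<one>\<^bsub>R\<^esub>) \<odot>\<^bsub>M\<^esub> a \<in> H" using a by (intro assms(4)) simp_all
  then show "\<ominus>\<^bsub>M\<^esub> a \<in> H" using a assms(1) by (auto simp: smult_l_minus)
qed (use assms in auto)

text \<open>
  The algebra \<open>instr\<close> is a span in an ambient module; this allows its generators to be used as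
  generators of the module itself.
\<close>

lemma span_in_span:
  assumes "module R L" "S \<subseteq> carrier L"
  shows "submodule_span R (L\<lparr>carrier := submodule_span R L S\<rparr>) S = submodule_span R L S"
proof -
  let ?W = "submodule_span R L S" let ?L = "L\<lparr>carrier := ?W\<rparr>"
  interpret L: module R L by fact
  note W = span_is_submodule[OF assms]
  interpret L': module R ?L by (rule submodule.submodule_is_module[OF W assms(1)])
  have S: "S \<subseteq> carrier ?L" using span_superset by simp
  note V = span_is_submodule[OF L'.module_axioms S]
  note sub = submodule_subset[OF V]
  have "submodule (submodule_span R ?L S) R L"
    using sub span_subset_carrier[OF assms] submodule_zero[OF V] L'.submoduleE(4,5)[OF V]
    by (intro L.submodule_from_smult) auto
  then show ?thesis using sub span_least span_superset by (metis partial_object.simps(1) partial_object.update_convs(1)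
        subset_antisym partial_object.surjective)
qed

lemma trilinear_map_slices:
  assumes "trilinear_map R M N Q K f"
  shows "x \<in> carrier M \<Longrightarrow> bilinear_map R N Q K (\<lambda>y z. f x y z)"
    and "y \<in> carrier N \<Longrightarrow> z \<in> carrier Q \<Longrightarrow> linear_map R M K (\<lambda>x. f x y z)"
  using assms by (simp_all add: trilinear_map_def)

lemma trilinear_map_rules:
  assumes "module R M" "module R N" "module R Q" "module R K" "trilinear_map R M N Q K f"
  shows "x \<in> carrier M \<Longrightarrow> y \<in> carrier N \<Longrightarrow> z \<in> carrier Q \<Longrightarrow> f x y z \<in> carrier K"
    and "x \<in> carrier M \<Longrightarrow> x' \<in> carrier M \<Longrightarrow> y \<in> carrier N \<Longrightarrow> z \<in> carrier Q \<Longrightarrow>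
      f (x \<oplus>\<^bsub>M\<^esub> x') y z = f x y z \<oplus>\<^bsub>K\<^esub> f x' y z"
    and "x \<in> carrier M \<Longrightarrow> y \<in> carrier N \<Longrightarrow> y' \<in> carrier N \<Longrightarrow> z \<in> carrier Q \<Longrightarrow>
      f x (y \<oplus>\<^bsub>N\<^esub> y') z = f x y z \<oplus>\<^bsub>K\<^esub> f x y' z"
    and "x \<in> carrier M \<Longrightarrow> y \<in> carrier N \<Longrightarrow> z \<in> carrier Q \<Longrightarrow> z' \<in> carrier Q \<Longrightarrow>
      f x y (z \<oplus>\<^bsub>Q\<^esub> z') = f x y z \<oplus>\<^bsub>K\<^esub> f x y z'"
    and "r \<in> carrier R \<Longrightarrow> x \<in> carrier M \<Longrightarrow> y \<in> carrier N \<Longrightarrow> z \<in> carrier Q \<Longrightarrow>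
      f (r \<odot>\<^bsub>M\<^esub> x) y z = r \<odot>\<^bsub>K\<^esub> f x y z"
    and "r \<in> carrier R \<Longrightarrow> x \<in> carrier M \<Longrightarrow> y \<in> carrier N \<Longrightarrow> z \<in> carrier Q \<Longrightarrow>
      f x (r \<odot>\<^bsub>N\<^esub> y) z = r \<odot>\<^bsub>K\<^esub> f x y z"
    and "r \<in> carrier R \<Longrightarrow> x \<in> carrier M \<Longrightarrow> y \<in> carrier N \<Longrightarrow> z \<in> carrier Q \<Longrightarrow>
      f x y (r \<odot>\<^bsub>Q\<^esub> z) = r \<odot>\<^bsub>K\<^esub> f x y z"
    and "x \<in> carrier M \<Longrightarrow> y \<in> carrier N \<Longrightarrow> z \<in> carrier Q \<Longrightarrow> f (\<ominus>\<^bsub>M\<^esub> x) y z = \<ominus>\<^bsub>K\<^esub> f x y z"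
    and "x \<in> carrier M \<Longrightarrow> y \<in> carrier N \<Longrightarrow> z \<in> carrier Q \<Longrightarrow> f x (\<ominus>\<^bsub>N\<^esub> y) z = \<ominus>\<^bsub>K\<^esub> f x y z"
    and "x \<in> carrier M \<Longrightarrow> y \<in> carrier N \<Longrightarrow> z \<in> carrier Q \<Longrightarrow> f x y (\<ominus>\<^bsub>Q\<^esub> z) = \<ominus>\<^bsub>K\<^esub> f x y z"
  using bilinear_map_rules[OF assms(2-4) trilinear_map_slices(1)[OF assms(5)]]
    linear_map_add[OF trilinear_map_slices(2)[OF assms(5)]]
    linear_map_smult[OF trilinear_map_slices(2)[OF assms(5)]]
    linear_map_neg[OF assms(1,4) trilinear_map_slices(2)[OF assms(5)]]
  by simp_all

locale jordan_pair_space =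
  fixes R :: "'k ring" and P :: "('k, 'm, 'p) pair"
  assumes jordan_pair: "jordan_pair R P"
begin

abbreviation "M \<equiv> neg_part P"
abbreviation "N \<equiv> pos_part P"
abbreviation "s \<equiv> neg_prod P"
abbreviation "t \<equiv> pos_prod P"
abbreviation "G \<equiv> pair_gl R P"
abbreviation "I \<equiv> instr R P"
abbreviation "\<nu> \<equiv> nu P"

sublocale M: endomorphisms R M
  using jordan_pair by (simp add: jordan_pair_def endomorphisms_def)
sublocale N: endomorphisms R N
  using jordan_pair by (simp add: jordan_pair_def endomorphisms_def)

lemma s_trilinear: "trilinear_map R M N M M s" and t_trilinear: "trilinear_map R N M N N t"
  using jordan_pair by (simp_all add: jordan_pair_def jordan_triple_identities_def)

lemmas s_rules = trilinear_map_rules[OF M.module_axioms N.module_axioms M.module_axioms M.module_axioms s_trilinear]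
lemmas t_rules = trilinear_map_rules[OF N.module_axioms M.module_axioms N.module_axioms N.module_axioms t_trilinear]

lemma s_sym: "a \<in> carrier M \<Longrightarrow> b \<in> carrier N \<Longrightarrow> c \<in> carrier M \<Longrightarrow> s a b c = s c b a"
  and t_sym: "b \<in> carrier N \<Longrightarrow> a \<in> carrier M \<Longrightarrow> d \<in> carrier N \<Longrightarrow> t b a d = t d a b"
  using jordan_pair unfolding jordan_pair_def jordan_triple_identities_def by blast+

lemma s_identity:
  "a \<in> carrier M \<Longrightarrow> b \<in> carrier N \<Longrightarrow> c \<in> carrier M \<Longrightarrow> d \<in> carrier N \<Longrightarrow> e \<in> carrier M \<Longrightarrow>
    s a b (s c d e) \<ominus>\<^bsub>M\<^esub> s c d (s a b e) = s (s a b c) d e \<ominus>\<^bsub>M\<^esub> s c (t b a d) e"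
  and t_identity:
  "b \<in> carrier N \<Longrightarrow> a \<in> carrier M \<Longrightarrow> d \<in> carrier N \<Longrightarrow> c \<in> carrier M \<Longrightarrow> f \<in> carrier N \<Longrightarrow>
    t b a (t d c f) \<ominus>\<^bsub>N\<^esub> t d c (t b a f) = t (t b a d) c f \<ominus>\<^bsub>N\<^esub> t d (s a b c) f"
  using jordan_pair unfolding jordan_pair_def jordan_triple_identities_def by blast+

lemma pair_gl_ops:
  "carrier G = carrier (gl R M) \<times> carrier (gl R N)"
  "fst (X \<oplus>\<^bsub>G\<^esub> Y) = fst X \<oplus>\<^bsub>gl R M\<^esub> fst Y" "snd (X \<oplus>\<^bsub>G\<^esub> Y) = snd X \<oplus>\<^bsub>gl R N\<^esub> snd Y"
  "fst (r \<odot>\<^bsub>G\<^esub> X) = r \<odot>\<^bsub>gl R M\<^esub> fst X" "snd (r \<odot>\<^bsub>G\<^esub> X) = r \<odot>\<^bsub>gl R N\<^esub> snd X"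
  "fst (X \<otimes>\<^bsub>G\<^esub> Y) = fst X \<otimes>\<^bsub>gl R M\<^esub> fst Y" "snd (X \<otimes>\<^bsub>G\<^esub> Y) = snd X \<otimes>\<^bsub>gl R N\<^esub> snd Y"
  by (cases X; cases Y; simp add: pair_gl_def)+

sublocale G: lie_algebra R G
  unfolding pair_gl_def by (rule direct_sum_lie_algebra[OF M.gl_lie_algebra N.gl_lie_algebra])

lemma pair_gl_ext:
  assumes "X \<in> carrier G" "Y \<in> carrier G" "\<And>a. a \<in> carrier M \<Longrightarrow> fst X a = fst Y a"
    "\<And>b. b \<in> carrier N \<Longrightarrow> snd X b = snd Y b"
  shows "X = Y"
  using assms by (intro prod_eqI gl_ext[of _ R]) (auto simp: pair_gl_ops)

lemma pair_gl_components: "X \<in> carrier G \<Longrightarrow> fst X \<in> carrier (gl R M)"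
  "X \<in> carrier G \<Longrightarrow> snd X \<in> carrier (gl R N)"
  by (auto simp: pair_gl_ops)

lemma fst_bilinear: "bilinear_map R G M M fst"
  by (intro bilinear_mapI linear_mapI)
    (simp_all add: pair_gl_components M.gl_rules pair_gl_ops(2-) gl_apply)

lemma snd_bilinear: "bilinear_map R G N N snd"
  by (intro bilinear_mapI linear_mapI)
    (simp_all add: pair_gl_components N.gl_rules pair_gl_ops(2-) gl_apply)

lemmas fst_rules = bilinear_map_rules[OF G.module_L M.module_axioms M.module_axioms fst_bilinear]
lemmas snd_rules = bilinear_map_rules[OF G.module_L N.module_axioms N.module_axioms snd_bilinear]

lemma bracket_apply:
  "a \<in> carrier M \<Longrightarrow> fst (X \<otimes>\<^bsub>G\<^esub> Y) a = fst X (fst Y a) \<ominus>\<^bsub>M\<^esub> fst Y (fst X a)"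
  "b \<in> carrier N \<Longrightarrow> snd (X \<otimes>\<^bsub>G\<^esub> Y) b = snd X (snd Y b) \<ominus>\<^bsub>N\<^esub> snd Y (snd X b)"
  by (simp_all add: pair_gl_ops gl_apply)

lemma nu_apply:
  "c \<in> carrier M \<Longrightarrow> fst (\<nu> a b) c = s a b c" "d \<in> carrier N \<Longrightarrow> snd (\<nu> a b) d = \<ominus>\<^bsub>N\<^esub> t b a d"
  by (simp_all add: nu_def)

lemma nu_closed:
  assumes "a \<in> carrier M" "b \<in> carrier N"
  shows "\<nu> a b \<in> carrier G"
proof -
  have "linear_map R M M (\<lambda>c. s a b c)" "linear_map R N N (\<lambda>d. \<ominus>\<^bsub>N\<^esub> t b a d)"
    using assms by (auto intro!: linear_mapI simp: s_rules t_rules N.minus_add N.smult_r_minus)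
  then show ?thesis unfolding nu_def pair_gl_ops
    by (intro SigmaI restrict_in_gl M.module_axioms N.module_axioms)
qed

lemma nu_bilinear_gl: "bilinear_map R M N G \<nu>"
  by (intro bilinear_mapI linear_mapI nu_closed; assumption?)
    (intro pair_gl_ext; simp add: nu_closed nu_apply fst_rules snd_rules s_rules t_rules
      N.minus_add N.smult_r_minus)+

lemmas nu_rules = bilinear_map_rules[OF M.module_axioms N.module_axioms G.module_L nu_bilinear_gl]

text \<open>
  On \<open>P\<^sub>-\<close> this is the five-linear identity. On \<open>P\<^sub>+\<close> the operators carry a sign, and the identity
  for the opposite product gives the same right-hand side.
\<close>

lemma nu_bracket:
  assumes "a \<in> carrier M" "b \<in> carrier N" "c \<in> carrier M" "d \<in> carrier N"
  shows "\<nu> a b \<otimes>\<^bsub>G\<^esub> \<nu> c d = \<nu> (s a b c) d \<ominus>\<^bsub>G\<^esub> \<nu> c (t b a d)"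
proof (rule pair_gl_ext)
  fix e assume e: "e \<in> carrier M"
  show "fst (\<nu> a b \<otimes>\<^bsub>G\<^esub> \<nu> c d) e = fst (\<nu> (s a b c) d \<ominus>\<^bsub>G\<^esub> \<nu> c (t b a d)) e"
    using assms e s_identity by (simp add: bracket_apply nu_apply fst_rules nu_closed s_rules t_rules)
next
  fix e assume e: "e \<in> carrier N"
  have "\<ominus>\<^bsub>N\<^esub> t d (s a b c) e \<oplus>\<^bsub>N\<^esub> t (t b a d) c e = t (t b a d) c e \<ominus>\<^bsub>N\<^esub> t d (s a b c) e"
    using assms e by (simp add: s_rules t_rules N.minus_eq N.a_comm)
  then show "snd (\<nu> a b \<otimes>\<^bsub>G\<^esub> \<nu> c d) e = snd (\<nu> (s a b c) d \<ominus>\<^bsub>G\<^esub> \<nu> c (t b a d)) e"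
    using assms e t_identity[of b a d c e]
    by (simp add: bracket_apply nu_apply snd_rules nu_closed s_rules t_rules N.minus_eq)
qed (use assms in \<open>simp_all add: G.bracket_rules nu_closed s_rules t_rules\<close>)

abbreviation "nu_set \<equiv> {\<nu> a b | a b. a \<in> carrier M \<and> b \<in> carrier N}"

lemma nu_set_closed: "nu_set \<subseteq> carrier G" using nu_closed by blast

lemma instr_ops [simp]: "carrier I = submodule_span R G nu_set"
  "add I = add G" "zero I = zero G" "smult I = smult G" "mult I = mult G"
  by (simp_all add: instr_def)

lemma nu_in_instr: "a \<in> carrier M \<Longrightarrow> b \<in> carrier N \<Longrightarrow> \<nu> a b \<in> carrier I"
  using span_superset[of nu_set R G] by auto

lemma instr_subset: "X \<in> carrier I \<Longrightarrow> X \<in> carrier G"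
  using span_subset_carrier[OF G.module_L nu_set_closed] by auto

lemma instr_submodule: "submodule (carrier I) R G"
  using span_is_submodule[OF G.module_L nu_set_closed] by simp

sublocale I: lie_algebra R I
  unfolding instr_def
proof (rule lie_subalgebra[OF G.lie_algebra_axioms])
  show "submodule (submodule_span R G nu_set) R G" using instr_submodule by simp
  fix X Y assume "X \<in> submodule_span R G nu_set" "Y \<in> submodule_span R G nu_set"
  then show "X \<otimes>\<^bsub>G\<^esub> Y \<in> submodule_span R G nu_set"
  proof (rule span_bracket_closed[OF G.lie_algebra_axioms nu_set_closed, rotated])
    fix X Y assume "X \<in> nu_set" "Y \<in> nu_set"
    then obtain a b c d where *: "X = \<nu> a b" "Y = \<nu> c d"
      "a \<in> carrier M" "b \<in> carrier N" "c \<in> carrier M" "d \<in> carrier N" by blast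
    then have "\<nu> (s a b c) d \<in> carrier I" "\<nu> c (t b a d) \<in> carrier I"
      by (simp_all only: nu_in_instr s_rules t_rules)
    then have "\<nu> (s a b c) d \<oplus>\<^bsub>G\<^esub> \<ominus>\<^bsub>G\<^esub> \<nu> c (t b a d) \<in> carrier I"
      using G.submoduleE(3,5)[OF instr_submodule] by (simp only:)
    then show "X \<otimes>\<^bsub>G\<^esub> Y \<in> submodule_span R G nu_set"
      using * by (simp add: nu_bracket a_minus_def)
  qed
qed

lemma instr_inclusion: "linear_map R I G (\<lambda>X. X)"
  by (rule linear_mapI) (use instr_subset in auto)

lemma instr_a_inv: "X \<in> carrier I \<Longrightarrow> \<ominus>\<^bsub>I\<^esub> X = \<ominus>\<^bsub>G\<^esub> X"
  and instr_minus: "X \<in> carrier I \<Longrightarrow> Y \<in> carrier I \<Longrightarrow> X \<ominus>\<^bsub>I\<^esub> Y = X \<ominus>\<^bsub>G\<^esub> Y"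
  using linear_map_neg[OF I.module_L G.module_L instr_inclusion]
    linear_map_minus[OF I.module_L G.module_L instr_inclusion] by blast+

lemma instr_spanned: "carrier I = submodule_span R I nu_set"
  using span_in_span[OF G.module_L nu_set_closed] by (simp add: instr_def)

lemma nu_bilinear: "bilinear_map R M N I \<nu>"
  by (intro bilinear_mapI linear_mapI nu_in_instr) (simp_all add: nu_rules)

text \<open>
  The elements of \<open>instr(P)\<close> act as derivations of \<open>\<nu>\<close>. Both sides are linear in \<open>X\<close>, so the
  generators suffice.
\<close>

lemma instr_nu:
  assumes X: "X \<in> carrier I" and ab: "a \<in> carrier M" "b \<in> carrier N"
  shows "X \<otimes>\<^bsub>I\<^esub> \<nu> a b = \<nu> (fst X a) b \<oplus>\<^bsub>I\<^esub> \<nu> a (snd X b)"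
proof -
  note l1 = bilinear_map_left[OF G.bracket_bilinear nu_closed[OF ab]]
  note l2 = linear_map_compose[OF bilinear_map_left[OF fst_bilinear ab(1)] bilinear_map_left[OF nu_bilinear_gl ab(2)]]
  note l3 = linear_map_compose[OF bilinear_map_left[OF snd_bilinear ab(2)] bilinear_map_right[OF nu_bilinear_gl ab(1)]]
  have "X \<otimes>\<^bsub>G\<^esub> \<nu> a b = \<nu> (fst X a) b \<oplus>\<^bsub>G\<^esub> \<nu> a (snd X b)"
  proof (rule linear_map_eq_on_span[OF G.module_L G.module_L l1 linear_map_sum[OF G.module_L l2 l3] nu_set_closed])
    show "X \<in> submodule_span R G nu_set" using X by simp
    fix Y assume "Y \<in> nu_set"
    then show "Y \<otimes>\<^bsub>G\<^esub> \<nu> a b = \<nu> (fst Y a) b \<oplus>\<^bsub>G\<^esub> \<nu> a (snd Y b)"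
      using ab by (auto simp: nu_bracket nu_apply nu_rules s_rules t_rules a_minus_def)
  qed
  then show ?thesis by simp
qed

end

section \<open>The Lie algebra \<open>\<langle>P\<^sub>-, P\<^sub>+\<rangle>\<close>\<close>

context jordan_pair_space
begin

sublocale tp: tensor_product R M N
  by (intro tensor_product.intro M.module_axioms N.module_axioms)

abbreviation "T \<equiv> ptensor_module R P"
abbreviation ptens (infixl "\<otimes>\<^sub>P" 75) where "a \<otimes>\<^sub>P b \<equiv> ptensor R P a b"

lemma module_T: "module R T"
  unfolding ptensor_module_def by (rule tp.module_T)

sublocale T: module R T by (rule module_T)

lemma ptensor_bilinear: "bilinear_map R M N T (ptensor R P)"
  unfolding ptensor_module_def ptensor_def by (rule tp.tensor_bilinear)

lemmas ptensor_rules = bilinear_map_rules[OF M.module_axioms N.module_axioms module_T ptensor_bilinear]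

abbreviation "pure \<equiv> (\<lambda>(a, b). a \<otimes>\<^sub>P b) ` pair_carrier P"

lemma pure_closed: "pure \<subseteq> carrier T"
  by (auto simp: ptensor_rules)

lemma T_spanned: "carrier T = submodule_span R T pure"
  using tp.tensor_spanned by (simp add: ptensor_module_def ptensor_def)

lemma T_linear_eq:
  assumes "module R K" "linear_map R T K f" "linear_map R T K g"
    "\<And>a b. a \<in> carrier M \<Longrightarrow> b \<in> carrier N \<Longrightarrow> f (a \<otimes>\<^sub>P b) = g (a \<otimes>\<^sub>P b)" "m \<in> carrier T"
  shows "f m = g m"
proof (rule linear_map_eq_on_span[OF module_T assms(1-3) pure_closed])
  show "m \<in> submodule_span R T pure" using assms(5) by (simp only: T_spanned)
  show "f x = g x" if "x \<in> pure" for x using that assms(4) by fastforce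
qed

lemma ptensor_lift:
  assumes "module R K" "bilinear_map R M N K \<phi>"
  obtains f where "linear_map R T K f"
    "\<And>a b. a \<in> carrier M \<Longrightarrow> b \<in> carrier N \<Longrightarrow> f (a \<otimes>\<^sub>P b) = \<phi> a b"
  using tp.tensor_lift[OF assms] unfolding ptensor_module_def ptensor_def by blast

abbreviation "act \<equiv> tensor_act R P"
abbreviation "lam \<equiv> tensor_lambda R P"

text \<open>
  The choice in \<open>tensor_act\<close> is resolved: \<open>X \<otimes> 1 + 1 \<otimes> X\<close> exists for every pair of endomorphisms.
\<close>

lemma act_spec:
  assumes X: "X \<in> carrier G"
  shows "linear_map R T T (act X)"
    and "a \<in> carrier M \<Longrightarrow> b \<in> carrier N \<Longrightarrow> act X (a \<otimes>\<^sub>P b) = (fst X a \<otimes>\<^sub>P b) \<oplus>\<^bsub>T\<^esub> (a \<otimes>\<^sub>P snd X b)"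
proof -
  have "bilinear_map R M N T (\<lambda>a b. (fst X a \<otimes>\<^sub>P b) \<oplus>\<^bsub>T\<^esub> (a \<otimes>\<^sub>P snd X b))"
    using X by (intro bilinear_mapI linear_mapI)
      (simp_all add: ptensor_rules fst_rules snd_rules T.a_ac T.smult_r_distr)
  then obtain f where f: "linear_map R T T f"
    "\<And>a b. a \<in> carrier M \<Longrightarrow> b \<in> carrier N \<Longrightarrow> f (a \<otimes>\<^sub>P b) = (fst X a \<otimes>\<^sub>P b) \<oplus>\<^bsub>T\<^esub> (a \<otimes>\<^sub>P snd X b)"
    using ptensor_lift[OF module_T] by blast
  note * = linear_ext_eq[OF f(1), where S = "pair_carrier P" and g = "\<lambda>(a, b). a \<otimes>\<^sub>P b"
      and y = "\<lambda>(a, b). (fst X a \<otimes>\<^sub>P b) \<oplus>\<^bsub>T\<^esub> (a \<otimes>\<^sub>P snd X b)"]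
  show "linear_map R T T (act X)"
    unfolding tensor_act_def by (rule *(1)) (auto simp: f(2))
  show "act X (a \<otimes>\<^sub>P b) = (fst X a \<otimes>\<^sub>P b) \<oplus>\<^bsub>T\<^esub> (a \<otimes>\<^sub>P snd X b)" if "a \<in> carrier M" "b \<in> carrier N"
    unfolding tensor_act_def using *(2)[of "(a, b)"] that by (auto simp: f(2))
qed

lemmas act_linear_rules = linear_map_closed[OF act_spec(1)] linear_map_add[OF act_spec(1)]
  linear_map_smult[OF act_spec(1)]

lemma act_bilinear_gl: "bilinear_map R G T T act"
proof (intro bilinear_mapI linear_mapI)
  fix X Y m assume *: "X \<in> carrier G" "Y \<in> carrier G" "m \<in> carrier T"
  show "act (X \<oplus>\<^bsub>G\<^esub> Y) m = act X m \<oplus>\<^bsub>T\<^esub> act Y m"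
  proof (rule T_linear_eq[OF module_T _ _ _ *(3)])
    show "linear_map R T T (act (X \<oplus>\<^bsub>G\<^esub> Y))" using * by (intro act_spec(1) G.a_closed)
    show "linear_map R T T (\<lambda>m. act X m \<oplus>\<^bsub>T\<^esub> act Y m)"
      using * by (intro linear_map_sum module_T act_spec(1))
  qed (use * in \<open>simp_all add: act_spec(2) fst_rules snd_rules ptensor_rules T.a_ac\<close>)
next
  fix X r m assume *: "X \<in> carrier G" "r \<in> carrier R" "m \<in> carrier T"
  show "act (r \<odot>\<^bsub>G\<^esub> X) m = r \<odot>\<^bsub>T\<^esub> act X m"
  proof (rule T_linear_eq[OF module_T _ _ _ *(3)])
    show "linear_map R T T (act (r \<odot>\<^bsub>G\<^esub> X))" using * by (intro act_spec(1) G.smult_closed)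
    show "linear_map R T T (\<lambda>m. r \<odot>\<^bsub>T\<^esub> act X m)"
      using * by (intro linear_map_scaled module_T act_spec(1))
  qed (use * in \<open>simp_all add: act_spec(2) fst_rules snd_rules ptensor_rules T.smult_r_distr\<close>)
qed (simp_all add: act_linear_rules)

text \<open>
  On a pure tensor the mixed terms \<open>X a \<otimes> Y b\<close> cancel in the commutator.
\<close>

lemma act_bracket_gl:
  assumes "X \<in> carrier G" "Y \<in> carrier G" "m \<in> carrier T"
  shows "act (X \<otimes>\<^bsub>G\<^esub> Y) m = act X (act Y m) \<ominus>\<^bsub>T\<^esub> act Y (act X m)"
proof (rule T_linear_eq[OF module_T _ _ _ assms(3)])
  show "linear_map R T T (act (X \<otimes>\<^bsub>G\<^esub> Y))"
    using assms by (intro act_spec(1)) (simp add: G.bracket_rules)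
  show "linear_map R T T (\<lambda>m. act X (act Y m) \<ominus>\<^bsub>T\<^esub> act Y (act X m))"
    using assms(1,2) linear_map_compose[OF act_spec(1) act_spec(1)]
    by (intro linear_map_diff module_T)
  fix a b assume ab: "a \<in> carrier M" "b \<in> carrier N"
  let ?X = "fst X" and ?X' = "snd X" and ?Y = "fst Y" and ?Y' = "snd Y"
  have c: "?X (?Y a) \<otimes>\<^sub>P b \<in> carrier T" "?Y (?X a) \<otimes>\<^sub>P b \<in> carrier T"
    "a \<otimes>\<^sub>P ?X' (?Y' b) \<in> carrier T" "a \<otimes>\<^sub>P ?Y' (?X' b) \<in> carrier T"
    "?X a \<otimes>\<^sub>P ?Y' b \<in> carrier T" "?Y a \<otimes>\<^sub>P ?X' b \<in> carrier T"
    using assms ab by (simp_all add: ptensor_rules fst_rules snd_rules)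
  have "act X (act Y (a \<otimes>\<^sub>P b)) = (?X (?Y a) \<otimes>\<^sub>P b \<oplus>\<^bsub>T\<^esub> ?Y a \<otimes>\<^sub>P ?X' b) \<oplus>\<^bsub>T\<^esub>
       (?X a \<otimes>\<^sub>P ?Y' b \<oplus>\<^bsub>T\<^esub> a \<otimes>\<^sub>P ?X' (?Y' b))"
    "act Y (act X (a \<otimes>\<^sub>P b)) = (?Y (?X a) \<otimes>\<^sub>P b \<oplus>\<^bsub>T\<^esub> ?X a \<otimes>\<^sub>P ?Y' b) \<oplus>\<^bsub>T\<^esub>
       (?Y a \<otimes>\<^sub>P ?X' b \<oplus>\<^bsub>T\<^esub> a \<otimes>\<^sub>P ?Y' (?X' b))"
    "act (X \<otimes>\<^bsub>G\<^esub> Y) (a \<otimes>\<^sub>P b) = (?X (?Y a) \<otimes>\<^sub>P b \<ominus>\<^bsub>T\<^esub> ?Y (?X a) \<otimes>\<^sub>P b) \<oplus>\<^bsub>T\<^esub>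
       (a \<otimes>\<^sub>P ?X' (?Y' b) \<ominus>\<^bsub>T\<^esub> a \<otimes>\<^sub>P ?Y' (?X' b))"
    using assms ab by (simp_all add: act_spec(2) act_linear_rules fst_rules snd_rules ptensor_rules
        G.bracket_rules bracket_apply)
  then show "act (X \<otimes>\<^bsub>G\<^esub> Y) (a \<otimes>\<^sub>P b) = act X (act Y (a \<otimes>\<^sub>P b)) \<ominus>\<^bsub>T\<^esub> act Y (act X (a \<otimes>\<^sub>P b))"
    using c by (simp only:) algebra
qed

lemma lam_spec:
  shows lam_linear: "linear_map R T I lam"
    and lam_pure: "a \<in> carrier M \<Longrightarrow> b \<in> carrier N \<Longrightarrow> lam (a \<otimes>\<^sub>P b) = \<nu> a b"
proof -
  obtain f where f: "linear_map R T I f"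
    "\<And>a b. a \<in> carrier M \<Longrightarrow> b \<in> carrier N \<Longrightarrow> f (a \<otimes>\<^sub>P b) = \<nu> a b"
    using ptensor_lift[OF I.module_L nu_bilinear] by blast
  note * = linear_ext_eq[OF f(1), where S = "pair_carrier P" and g = "\<lambda>(a, b). a \<otimes>\<^sub>P b"
      and y = "\<lambda>(a, b). \<nu> a b"]
  show "linear_map R T I lam"
    unfolding tensor_lambda_def by (rule *(1)) (auto simp: f(2))
  show "lam (a \<otimes>\<^sub>P b) = \<nu> a b" if "a \<in> carrier M" "b \<in> carrier N"
    unfolding tensor_lambda_def using *(2)[of "(a, b)"] that by (auto simp: f(2))
qed

sublocale A: equivariant_to_adjoint R I T act lam
proof (intro equivariant_to_adjoint.intro equivariant_to_adjoint_axioms.intro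
    I.lie_algebra_axioms T.module_axioms lam_linear)
  show "bilinear_map R I T T act"
    using act_bilinear_gl instr_subset by (auto simp: bilinear_map_def linear_map_def)
  show "act (X \<otimes>\<^bsub>I\<^esub> Y) m = act X (act Y m) \<ominus>\<^bsub>T\<^esub> act Y (act X m)"
    if "X \<in> carrier I" "Y \<in> carrier I" "m \<in> carrier T" for X Y m
    using act_bracket_gl[OF instr_subset[OF that(1)] instr_subset[OF that(2)] that(3)] by simp
  show "lam (act X m) = X \<otimes>\<^bsub>I\<^esub> lam m" if "X \<in> carrier I" "m \<in> carrier T" for X m
  proof -
    note X = instr_subset[OF that(1)]
    show ?thesis
    proof (rule T_linear_eq[OF I.module_L linear_map_compose[OF act_spec(1)[OF X] lam_linear]
          linear_map_compose[OF lam_linear bilinear_map_right[OF I.bracket_bilinear that(1)]] _ that(2)])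
      fix a b assume ab: "a \<in> carrier M" "b \<in> carrier N"
      then show "lam (act X (a \<otimes>\<^sub>P b)) = X \<otimes>\<^bsub>I\<^esub> lam (a \<otimes>\<^sub>P b)"
        unfolding lam_pure[OF ab] instr_nu[OF that(1) ab]
        using X by (simp only: act_spec(2) fst_rules snd_rules ptensor_rules linear_map_add[OF lam_linear] lam_pure)
    qed
  qed
qed

abbreviation "D \<equiv> angle_algebra R P"
abbreviation "ang \<equiv> angle R P"

lemma squares_eq: "tensor_squares R P = A.squares"
  by (simp add: tensor_squares_def A.squares_def)

lemma angle_module_eq: "angle_module R P = A.Q.Q"
  by (simp add: angle_module_def squares_eq)

lemma angle_eq: "ang a b = A.Q.\<pi> (a \<otimes>\<^sub>P b)"
  by (simp add: angle_def squares_eq)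

lemma act_nu_pure:
  assumes "a \<in> carrier M" "b \<in> carrier N" "c \<in> carrier M" "d \<in> carrier N"
  shows "A.Q.\<pi> (act (lam (a \<otimes>\<^sub>P b)) (c \<otimes>\<^sub>P d)) = ang (s a b c) d \<ominus>\<^bsub>A.Q.Q\<^esub> ang c (t b a d)"
  using assms linear_map_minus[OF module_T A.Q.module_Q A.Q.proj_linear]
  by (simp add: lam_pure act_spec(2) nu_closed nu_apply ptensor_rules s_rules t_rules angle_eq
      T.minus_eq[symmetric])

text \<open>
  The bracket is specified only on the generators \<open>\<langle>a, b\<rangle>\<close>. The product of cosets obtained from the
  equivariant map satisfies this specification, and the chosen bracket agrees with it everywhere
  because both are bilinear and pure tensors span.
\<close>

lemma angle_bracket_spec:
  shows "bilinear_map R A.Q.Q A.Q.Q A.Q.Q (angle_bracket R P)"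
    and "m \<in> carrier T \<Longrightarrow> n \<in> carrier T \<Longrightarrow>
      angle_bracket R P (A.Q.\<pi> m) (A.Q.\<pi> n) = A.Q.\<pi> (act (lam m) n)"
proof -
  let ?spec = "\<lambda>\<beta>. bilinear_map R A.Q.Q A.Q.Q A.Q.Q \<beta> \<and>
     (\<forall>a\<in>carrier M. \<forall>b\<in>carrier N. \<forall>c\<in>carrier M. \<forall>d\<in>carrier N.
        \<beta> (ang a b) (ang c d) = ang (s a b c) d \<ominus>\<^bsub>A.Q.Q\<^esub> ang c (t b a d))"
  obtain \<beta> where \<beta>: "bilinear_map R A.Q.Q A.Q.Q A.Q.Q \<beta>"
    "\<And>m n. m \<in> carrier T \<Longrightarrow> n \<in> carrier T \<Longrightarrow> \<beta> (A.Q.\<pi> m) (A.Q.\<pi> n) = A.Q.\<pi> (act (lam m) n)"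
    by (rule A.quotient_bracket_exists) blast
  have "\<beta> (ang a b) (ang c d) = ang (s a b c) d \<ominus>\<^bsub>A.Q.Q\<^esub> ang c (t b a d)"
    if "a \<in> carrier M" "b \<in> carrier N" "c \<in> carrier M" "d \<in> carrier N" for a b c d
  proof -
    have "\<beta> (ang a b) (ang c d) = A.Q.\<pi> (act (lam (a \<otimes>\<^sub>P b)) (c \<otimes>\<^sub>P d))"
      unfolding angle_eq using that by (intro \<beta>(2) ptensor_rules(1))
    then show ?thesis unfolding act_nu_pure[OF that] .
  qed
  with \<beta>(1) have "?spec \<beta>" by blast
  then have spec: "?spec (angle_bracket R P)"
    unfolding angle_bracket_def angle_module_eq by (rule someI[of ?spec])
  then show bil: "bilinear_map R A.Q.Q A.Q.Q A.Q.Q (angle_bracket R P)" by blast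
  show "angle_bracket R P (A.Q.\<pi> m) (A.Q.\<pi> n) = A.Q.\<pi> (act (lam m) n)"
    if mn: "m \<in> carrier T" "n \<in> carrier T"
  proof (rule bilinear_map_eq_on_span[OF module_T module_T A.Q.module_Q _ _ pure_closed pure_closed,
        where f = "\<lambda>m n. angle_bracket R P (A.Q.\<pi> m) (A.Q.\<pi> n)"
          and g = "\<lambda>m n. A.Q.\<pi> (act (lam m) n)"])
    show "bilinear_map R T T A.Q.Q (\<lambda>m n. angle_bracket R P (A.Q.\<pi> m) (A.Q.\<pi> n))"
      using linear_map_compose[OF A.Q.proj_linear bilinear_map_left[OF bil]]
        linear_map_compose[OF A.Q.proj_linear bilinear_map_right[OF bil]]
        linear_map_closed[OF A.Q.proj_linear]
      by (auto intro: bilinear_mapI)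
    show "bilinear_map R T T A.Q.Q (\<lambda>m n. A.Q.\<pi> (act (lam m) n))"
      using linear_map_compose[OF linear_map_compose[OF lam_linear
            bilinear_map_left[OF A.act_bilinear]] A.Q.proj_linear]
        linear_map_compose[OF bilinear_map_right[OF A.act_bilinear] A.Q.proj_linear]
        linear_map_closed[OF lam_linear]
      by (intro bilinear_mapI) (simp_all del: instr_ops)
    fix x y assume "x \<in> pure" "y \<in> pure"
    then obtain a b c d where xy: "x = a \<otimes>\<^sub>P b" "y = c \<otimes>\<^sub>P d"
      and abcd: "a \<in> carrier M" "b \<in> carrier N" "c \<in> carrier M" "d \<in> carrier N" by auto
    then have "angle_bracket R P (ang a b) (ang c d) = A.Q.\<pi> (act (lam x) y)"
      using spec unfolding xy act_nu_pure[OF abcd] by blast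
    then show "angle_bracket R P (A.Q.\<pi> x) (A.Q.\<pi> y) = A.Q.\<pi> (act (lam x) y)"
      unfolding xy angle_eq .
  next
    show "m \<in> submodule_span R T pure" "n \<in> submodule_span R T pure"
      using mn by (simp_all only: T_spanned)
  qed
qed

lemma D_eq: "D = A.Q.Q\<lparr>mult := angle_bracket R P\<rparr>"
  by (simp add: angle_algebra_def angle_module_eq)

sublocale D: lie_algebra R D
  unfolding D_eq using angle_bracket_spec by (rule A.quotient_lie_algebra)

lemma proj_linear_D: "linear_map R T D A.Q.\<pi>"
  unfolding D_eq by (simp add: A.Q.proj_linear)

lemma angle_bilinear: "bilinear_map R M N D ang"
  unfolding angle_eq
  using linear_map_compose[OF bilinear_map_left[OF ptensor_bilinear] proj_linear_D]
    linear_map_compose[OF bilinear_map_right[OF ptensor_bilinear] proj_linear_D]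
  by (auto intro: bilinear_mapI)

lemma D_carrier: "carrier D = A.Q.\<pi> ` carrier T"
  by (simp add: D_eq A.Q.carrier_Q)

abbreviation "angle_set \<equiv> {ang a b | a b. a \<in> carrier M \<and> b \<in> carrier N}"

lemma angle_set_closed: "angle_set \<subseteq> carrier D"
  using bilinear_map_closed[OF angle_bilinear] by blast

lemma D_spanned: "carrier D = submodule_span R D angle_set"
proof
  show "submodule_span R D angle_set \<subseteq> carrier D" by (rule span_subset_carrier[OF D.module_L angle_set_closed])
  have "A.Q.\<pi> m \<in> submodule_span R D angle_set" if "m \<in> carrier T" for m
  proof (rule linear_map_image_span[OF module_T D.module_L proj_linear_D pure_closed
        span_is_submodule[OF D.module_L angle_set_closed]])
    show "m \<in> submodule_span R T pure" using that T_spanned by simp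
    fix x assume "x \<in> pure"
    then have "A.Q.\<pi> x \<in> angle_set" by (auto simp: angle_eq)
    then show "A.Q.\<pi> x \<in> submodule_span R D angle_set" by (rule subsetD[OF span_superset])
  qed
  then show "carrier D \<subseteq> submodule_span R D angle_set" by (auto simp: D_carrier)
qed

lemma mu_spec:
  shows mu_linear: "linear_map R D I (mu R P)"
    and mu_proj: "m \<in> carrier T \<Longrightarrow> mu R P (A.Q.\<pi> m) = lam m"
proof -
  obtain f where f: "linear_map R A.Q.Q I f" "\<And>m. m \<in> carrier T \<Longrightarrow> f (A.Q.\<pi> m) = lam m"
    using A.Q.quotient_lift[OF I.module_L lam_linear A.lam_squares] by blast
  have f1: "linear_map R D I f" unfolding D_eq by (simp add: f(1))
  have f2: "f (ang a b) = \<nu> a b" if "a \<in> carrier M" "b \<in> carrier N" for a b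
    using that by (simp add: angle_eq f(2) ptensor_rules lam_pure)
  note * = linear_ext_eq[OF f1, where S = "pair_carrier P" and g = "\<lambda>(a, b). ang a b"
      and y = "\<lambda>(a, b). \<nu> a b"]
  show lin: "linear_map R D I (mu R P)"
    unfolding mu_def by (rule *(1)) (auto simp: f2)
  have mu_ang: "mu R P (ang a b) = \<nu> a b" if "a \<in> carrier M" "b \<in> carrier N" for a b
    unfolding mu_def using *(2)[of "(a, b)"] that by (auto simp: f2)
  show "mu R P (A.Q.\<pi> m) = lam m" if "m \<in> carrier T"
    by (rule T_linear_eq[OF I.module_L linear_map_compose[OF proj_linear_D lin] lam_linear _ that])
      (simp add: mu_ang angle_eq[symmetric] lam_pure)
qed

lemma mu_angle: "a \<in> carrier M \<Longrightarrow> b \<in> carrier N \<Longrightarrow> mu R P (ang a b) = \<nu> a b"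
  by (simp add: angle_eq mu_proj ptensor_rules lam_pure)

text \<open>
  The adjoint action on \<open>\<langle>a, b\<rangle>\<close> factors through \<open>\<mu>\<close>: lift \<open>X\<close> to a tensor and use the definition
  of the action on pure tensors.
\<close>

lemma D_angle:
  assumes "X \<in> carrier D" "a \<in> carrier M" "b \<in> carrier N"
  shows "X \<otimes>\<^bsub>D\<^esub> ang a b = ang (fst (mu R P X) a) b \<oplus>\<^bsub>D\<^esub> ang a (snd (mu R P X) b)"
proof -
  obtain m where m: "m \<in> carrier T" "X = A.Q.\<pi> m" using assms(1) by (auto simp: D_carrier)
  have l: "lam m \<in> carrier G" using linear_map_closed[OF lam_linear m(1)] by (rule instr_subset)
  have "X \<otimes>\<^bsub>D\<^esub> ang a b = A.Q.\<pi> (act (lam m) (a \<otimes>\<^sub>P b))"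
    using m assms angle_bracket_spec(2) by (simp add: D_eq angle_eq ptensor_rules)
  also have "\<dots> = ang (fst (lam m) a) b \<oplus>\<^bsub>D\<^esub> ang a (snd (lam m) b)"
    using assms l by (simp add: act_spec(2) angle_eq linear_map_add[OF proj_linear_D] ptensor_rules fst_rules snd_rules)
  finally show ?thesis using m by (simp add: mu_proj)
qed

end

section \<open>The Lie algebra \<open>P\<^sub>- \<oplus> L \<oplus> P\<^sub>+\<close> of a cover\<close>

context abelian_group
begin

text \<open>
  The next three identities are the cancellations in the components of the Jacobi identity of a
  cover, with the iterated brackets replaced by variables. In the first one, for \<open>P\<^sub>-\<close>, the letters
  \<open>p\<close>, \<open>q\<close> and \<open>r\<close> stand for triple products and the others for iterated actions.
\<close>

lemma cyclic_cancel_left: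
  assumes "a \<in> carrier G" "b \<in> carrier G" "c \<in> carrier G" "d \<in> carrier G" "e \<in> carrier G"
    "f \<in> carrier G" "p \<in> carrier G" "q \<in> carrier G" "r \<in> carrier G"
  shows "a \<ominus> b \<ominus> (c \<ominus> d \<oplus> p \<ominus> q) \<oplus> (c \<ominus> e \<ominus> (f \<ominus> b \<oplus> r \<ominus> p)) \<oplus>
    (f \<ominus> d \<ominus> (a \<ominus> e \<oplus> q \<ominus> r)) = \<zero>"
  using assms by algebra

lemma cyclic_cancel_right:
  assumes "a \<in> carrier G" "b \<in> carrier G" "c \<in> carrier G" "d \<in> carrier G" "e \<in> carrier G"
    "f \<in> carrier G" "p \<in> carrier G" "q \<in> carrier G" "r \<in> carrier G"
  shows "a \<ominus> b \<ominus> (c \<ominus> d \<ominus> p \<oplus> q) \<oplus> (c \<ominus> e \<ominus> (f \<ominus> b \<ominus> q \<oplus> r)) \<oplus>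
    (f \<ominus> d \<ominus> (a \<ominus> e \<ominus> r \<oplus> p)) = \<zero>"
  using assms by algebra

lemma cyclic_cancel_middle:
  assumes J: "j1 \<oplus> j2 \<oplus> j3 = \<zero>"
    and j: "j1 \<in> carrier G" "j2 \<in> carrier G" "j3 \<in> carrier G"
    and c: "c1 \<in> carrier G" "c2 \<in> carrier G" "c3 \<in> carrier G" "c4 \<in> carrier G" "c5 \<in> carrier G"
      "c6 \<in> carrier G" "c7 \<in> carrier G" "c8 \<in> carrier G"
      "e1 \<in> carrier G" "e2 \<in> carrier G" "e3 \<in> carrier G" "e4 \<in> carrier G"
  shows "(j1 \<oplus> (c1 \<oplus> c2) \<ominus> (c3 \<oplus> c4) \<oplus> (c5 \<ominus> c6) \<ominus> (c7 \<ominus> c8)) \<oplus>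
    (j2 \<oplus> (c7 \<oplus> e1) \<ominus> (e2 \<oplus> c5) \<oplus> (e3 \<ominus> c2) \<ominus> (e4 \<ominus> c3)) \<oplus>
    (j3 \<oplus> (e4 \<oplus> c6) \<ominus> (c8 \<oplus> e3) \<oplus> (c4 \<ominus> e1) \<ominus> (c1 \<ominus> e2)) = \<zero>" (is "?l = _")
proof -
  \<comment> \<open>The twelve terms of each sign are collected so that only short expressions are normalized.\<close>
  define P1 P2 P3 where P: "P1 = c1 \<oplus> c2 \<oplus> c5 \<oplus> c8" "P2 = c7 \<oplus> e1 \<oplus> e3 \<oplus> c3" "P3 = e4 \<oplus> c6 \<oplus> c4 \<oplus> e2"
  define Q1 Q2 Q3 where Q: "Q1 = c3 \<oplus> c4 \<oplus> c6 \<oplus> c7" "Q2 = e2 \<oplus> c5 \<oplus> c2 \<oplus> e4" "Q3 = c8 \<oplus> e3 \<oplus> e1 \<oplus> c1"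
  have PQ: "P1 \<in> carrier G" "P2 \<in> carrier G" "P3 \<in> carrier G" "Q1 \<in> carrier G" "Q2 \<in> carrier G" "Q3 \<in> carrier G"
    using c by (simp_all add: P Q)
  have "j1 \<oplus> (c1 \<oplus> c2) \<ominus> (c3 \<oplus> c4) \<oplus> (c5 \<ominus> c6) \<ominus> (c7 \<ominus> c8) = j1 \<oplus> (P1 \<ominus> Q1)"
    unfolding P Q using j(1) c(1-8) by algebra
  moreover have "j2 \<oplus> (c7 \<oplus> e1) \<ominus> (e2 \<oplus> c5) \<oplus> (e3 \<ominus> c2) \<ominus> (e4 \<ominus> c3) = j2 \<oplus> (P2 \<ominus> Q2)"
    unfolding P Q using j(2) c(2,3,5,7,9-12) by algebra
  moreover have "j3 \<oplus> (e4 \<oplus> c6) \<ominus> (c8 \<oplus> e3) \<oplus> (c4 \<ominus> e1) \<ominus> (c1 \<ominus> e2) = j3 \<oplus> (P3 \<ominus> Q3)"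
    unfolding P Q using j(3) c(1,4,6,8,9-12) by algebra
  ultimately have "?l = (j1 \<oplus> (P1 \<ominus> Q1)) \<oplus> (j2 \<oplus> (P2 \<ominus> Q2)) \<oplus> (j3 \<oplus> (P3 \<ominus> Q3))" by (simp only:)
  also have "\<dots> = (j1 \<oplus> j2 \<oplus> j3) \<oplus> ((P1 \<oplus> P2 \<oplus> P3) \<ominus> (Q1 \<oplus> Q2 \<oplus> Q3))"
    using j PQ by algebra
  also have "P1 \<oplus> P2 \<oplus> P3 = Q1 \<oplus> Q2 \<oplus> Q3"
    unfolding P Q using c by (simp add: a_ac)
  finally show ?thesis using J PQ by (simp add: minus_eq r_neg)
qed

end

text \<open>
  The common structure of \<open>instr(P)\<close> and \<open>\<langle>P\<^sub>-, P\<^sub>+\<rangle>\<close>: a Lie algebra \<open>L\<close> that is spanned by the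
  values of \<open>\<beta>\<close> and acts on \<open>P\<close> through \<open>\<rho>\<close>. That \<open>\<rho>\<close> is a Lie homomorphism follows from these
  axioms.
\<close>

locale tkk_cover =
  jordan_pair_space R P + L: lie_algebra R L
  for R :: "'k ring" and P :: "('k, 'm, 'p) pair" and L :: "('k, 'd) module" +
  fixes \<rho> :: "'d \<Rightarrow> ('m \<Rightarrow> 'm) \<times> ('p \<Rightarrow> 'p)" and \<beta> :: "'m \<Rightarrow> 'p \<Rightarrow> 'd"
  assumes \<rho>_linear_instr: "linear_map R L I \<rho>"
    and \<beta>_bilinear: "bilinear_map R M N L \<beta>"
    and \<rho>_\<beta>: "a \<in> carrier M \<Longrightarrow> b \<in> carrier N \<Longrightarrow> \<rho> (\<beta> a b) = \<nu> a b"
    and bracket_\<beta>: "X \<in> carrier L \<Longrightarrow> a \<in> carrier M \<Longrightarrow> b \<in> carrier N \<Longrightarrow>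
      X \<otimes>\<^bsub>L\<^esub> \<beta> a b = \<beta> (fst (\<rho> X) a) b \<oplus>\<^bsub>L\<^esub> \<beta> a (snd (\<rho> X) b)"
    and L_spanned: "carrier L = submodule_span R L {\<beta> a b | a b. a \<in> carrier M \<and> b \<in> carrier N}"
begin

lemmas \<beta>_rules = bilinear_map_rules[OF M.module_axioms N.module_axioms L.module_L \<beta>_bilinear]

abbreviation "\<beta>_set \<equiv> {\<beta> a b | a b. a \<in> carrier M \<and> b \<in> carrier N}"

lemma \<beta>_set_closed: "\<beta>_set \<subseteq> carrier L" using \<beta>_rules(1) by blast

lemma linear_eq_on_\<beta>:
  assumes "module R K" "linear_map R L K f" "linear_map R L K g" "X \<in> carrier L"
    "\<And>a b. a \<in> carrier M \<Longrightarrow> b \<in> carrier N \<Longrightarrow> f (\<beta> a b) = g (\<beta> a b)"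
  shows "f X = g X"
proof (rule linear_map_eq_on_span[OF L.module_L assms(1-3) \<beta>_set_closed])
  show "X \<in> submodule_span R L \<beta>_set" using assms(4) by (simp only: L_spanned)
  show "f Y = g Y" if "Y \<in> \<beta>_set" for Y using that assms(5) by blast
qed

lemma \<rho>_linear: "linear_map R L G \<rho>"
  using linear_map_compose[OF \<rho>_linear_instr instr_inclusion] by simp

lemmas \<rho>_rules = linear_map_closed[OF \<rho>_linear] linear_map_add[OF \<rho>_linear]
  linear_map_smult[OF \<rho>_linear] linear_map_zero[OF L.module_L G.module_L \<rho>_linear]
  linear_map_minus[OF L.module_L G.module_L \<rho>_linear]
  linear_map_neg[OF L.module_L G.module_L \<rho>_linear]

text \<open>
  For \<open>Y = \<beta>(a, b)\<close> this is the derivation property in \<open>instr(P)\<close>, compared with the corresponding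
  axiom of a cover.
\<close>

lemma \<rho>_bracket:
  assumes "X \<in> carrier L" "Y \<in> carrier L"
  shows "\<rho> (X \<otimes>\<^bsub>L\<^esub> Y) = \<rho> X \<otimes>\<^bsub>G\<^esub> \<rho> Y"
proof (rule linear_eq_on_\<beta>[OF G.module_L _ _ assms(2)])
  show "linear_map R L G (\<lambda>Y. \<rho> (X \<otimes>\<^bsub>L\<^esub> Y))"
    by (rule linear_map_compose[OF bilinear_map_right[OF L.bracket_bilinear assms(1)] \<rho>_linear])
  show "linear_map R L G (\<lambda>Y. \<rho> X \<otimes>\<^bsub>G\<^esub> \<rho> Y)"
    by (rule linear_map_compose[OF \<rho>_linear bilinear_map_right[OF G.bracket_bilinear]])
      (simp add: \<rho>_rules assms)
  fix a b assume ab: "a \<in> carrier M" "b \<in> carrier N"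
  have "\<rho> X \<in> carrier I" using \<rho>_linear_instr assms(1) by (rule linear_map_closed)
  from instr_nu[OF this ab]
  show "\<rho> (X \<otimes>\<^bsub>L\<^esub> \<beta> a b) = \<rho> X \<otimes>\<^bsub>G\<^esub> \<rho> (\<beta> a b)"
    using assms ab by (simp add: bracket_\<beta> \<rho>_rules \<beta>_rules \<rho>_\<beta> fst_rules snd_rules)
qed

abbreviation "E \<equiv> tkk_algebra P L \<rho> \<beta>"

lemma E_simps [simp]:
  "carrier E = carrier M \<times> carrier L \<times> carrier N"
  "(a, X, b) \<oplus>\<^bsub>E\<^esub> (c, Y, d) = (a \<oplus>\<^bsub>M\<^esub> c, X \<oplus>\<^bsub>L\<^esub> Y, b \<oplus>\<^bsub>N\<^esub> d)"
  "r \<odot>\<^bsub>E\<^esub> (a, X, b) = (r \<odot>\<^bsub>M\<^esub> a, r \<odot>\<^bsub>L\<^esub> X, r \<odot>\<^bsub>N\<^esub> b)"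
  "\<zero>\<^bsub>E\<^esub> = (\<zero>\<^bsub>M\<^esub>, \<zero>\<^bsub>L\<^esub>, \<zero>\<^bsub>N\<^esub>)"
  "(a, X, b) \<otimes>\<^bsub>E\<^esub> (c, Y, d) = (fst (\<rho> X) c \<ominus>\<^bsub>M\<^esub> fst (\<rho> Y) a,
         (X \<otimes>\<^bsub>L\<^esub> Y \<oplus>\<^bsub>L\<^esub> \<beta> a d) \<ominus>\<^bsub>L\<^esub> \<beta> c b,
         snd (\<rho> X) d \<ominus>\<^bsub>N\<^esub> snd (\<rho> Y) b)"
  by (simp_all add: tkk_algebra_def Let_def)

lemma module_E: "module R E"
proof -
  have "abelian_group E"
  proof (rule abelian_groupI)
    fix x assume "x \<in> carrier E"
    then show "\<exists>y\<in>carrier E. y \<oplus>\<^bsub>E\<^esub> x = \<zero>\<^bsub>E\<^esub>"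
      by (intro bexI[of _ "(\<ominus>\<^bsub>M\<^esub> fst x, \<ominus>\<^bsub>L\<^esub> fst (snd x), \<ominus>\<^bsub>N\<^esub> snd (snd x))"])
        (auto simp: M.l_neg N.l_neg L.l_neg)
  qed (auto simp: M.a_ac N.a_ac L.a_ac)
  then show ?thesis
    by (intro moduleI M.R.cring_axioms)
      (auto simp: M.smult_l_distr N.smult_l_distr L.smult_l_distr M.smult_r_distr N.smult_r_distr
        L.smult_r_distr M.smult_assoc1 N.smult_assoc1 L.smult_assoc1)
qed

sublocale E: module R E by (rule module_E)

lemma E_neg [simp]:
  assumes "a \<in> carrier M" "X \<in> carrier L" "b \<in> carrier N"
  shows "\<ominus>\<^bsub>E\<^esub> (a, X, b) = (\<ominus>\<^bsub>M\<^esub> a, \<ominus>\<^bsub>L\<^esub> X, \<ominus>\<^bsub>N\<^esub> b)"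
  using assms by (intro E.minus_equality) (simp_all add: M.l_neg N.l_neg L.l_neg)

lemmas cover_rules = fst_rules snd_rules \<rho>_rules \<beta>_rules L.bracket_rules nu_apply \<rho>_\<beta> s_rules t_rules

text \<open>
  The identity is checked in each component. In degrees \<open>-1\<close> and \<open>1\<close> it combines the fact that
  \<open>\<rho>\<close> is a representation with the symmetry of the triple products; in degree \<open>0\<close> it combines the Jacobi
  identity of \<open>L\<close> with the derivation property of \<open>\<beta>\<close>.
\<close>

lemma E_jacobi:
  assumes "x \<in> carrier E" "y \<in> carrier E" "z \<in> carrier E"
  shows "x \<otimes>\<^bsub>E\<^esub> (y \<otimes>\<^bsub>E\<^esub> z) \<oplus>\<^bsub>E\<^esub> y \<otimes>\<^bsub>E\<^esub> (z \<otimes>\<^bsub>E\<^esub> x) \<oplus>\<^bsub>E\<^esub> z \<otimes>\<^bsub>E\<^esub> (x \<otimes>\<^bsub>E\<^esub> y) = \<zero>\<^bsub>E\<^esub>"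
proof -
  obtain a X b c Y d e Z f where xyz: "x = (a, X, b)" "y = (c, Y, d)" "z = (e, Z, f)"
    using prod_cases3 by metis
  have mem [simp]: "a \<in> carrier M" "c \<in> carrier M" "e \<in> carrier M" "b \<in> carrier N" "d \<in> carrier N"
    "f \<in> carrier N" "X \<in> carrier L" "Y \<in> carrier L" "Z \<in> carrier L"
    using assms xyz by simp_all
  \<comment> \<open>One summand of the cyclic sum, expanded; the variables are generalized to cover all rotations.\<close>
  have key_M: "(fst (\<rho> X) (fst (\<rho> Y) e \<ominus>\<^bsub>M\<^esub> fst (\<rho> Z) c) \<ominus>\<^bsub>M\<^esub>
      fst (\<rho> (Y \<otimes>\<^bsub>L\<^esub> Z \<oplus>\<^bsub>L\<^esub> \<beta> c f \<ominus>\<^bsub>L\<^esub> \<beta> e d)) a) =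
      fst (\<rho> X) (fst (\<rho> Y) e) \<ominus>\<^bsub>M\<^esub> fst (\<rho> X) (fst (\<rho> Z) c) \<ominus>\<^bsub>M\<^esub>
      (fst (\<rho> Y) (fst (\<rho> Z) a) \<ominus>\<^bsub>M\<^esub> fst (\<rho> Z) (fst (\<rho> Y) a) \<oplus>\<^bsub>M\<^esub> s c f a \<ominus>\<^bsub>M\<^esub> s e d a)"
    if "a \<in> carrier M" "c \<in> carrier M" "e \<in> carrier M" "d \<in> carrier N"
      "f \<in> carrier N" "X \<in> carrier L" "Y \<in> carrier L" "Z \<in> carrier L" for a c e d f X Y Z
    using that by (simp add: cover_rules \<rho>_bracket bracket_apply nu_closed G.bracket_rules)
  have key_N: "(snd (\<rho> X) (snd (\<rho> Y) f \<ominus>\<^bsub>N\<^esub> snd (\<rho> Z) d) \<ominus>\<^bsub>N\<^esub>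
      snd (\<rho> (Y \<otimes>\<^bsub>L\<^esub> Z \<oplus>\<^bsub>L\<^esub> \<beta> c f \<ominus>\<^bsub>L\<^esub> \<beta> e d)) b) =
      snd (\<rho> X) (snd (\<rho> Y) f) \<ominus>\<^bsub>N\<^esub> snd (\<rho> X) (snd (\<rho> Z) d) \<ominus>\<^bsub>N\<^esub>
      (snd (\<rho> Y) (snd (\<rho> Z) b) \<ominus>\<^bsub>N\<^esub> snd (\<rho> Z) (snd (\<rho> Y) b) \<ominus>\<^bsub>N\<^esub> t f c b \<oplus>\<^bsub>N\<^esub> t d e b)"
    if "b \<in> carrier N" "c \<in> carrier M" "e \<in> carrier M" "d \<in> carrier N"
      "f \<in> carrier N" "X \<in> carrier L" "Y \<in> carrier L" "Z \<in> carrier L" for b c e d f X Y Z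
    using that by (simp add: cover_rules \<rho>_bracket bracket_apply nu_closed G.bracket_rules N.minus_eq)
  have key_L: "X \<otimes>\<^bsub>L\<^esub> (Y \<otimes>\<^bsub>L\<^esub> Z \<oplus>\<^bsub>L\<^esub> \<beta> c f \<ominus>\<^bsub>L\<^esub> \<beta> e d) \<oplus>\<^bsub>L\<^esub>
      \<beta> a (snd (\<rho> Y) f \<ominus>\<^bsub>N\<^esub> snd (\<rho> Z) d) \<ominus>\<^bsub>L\<^esub> \<beta> (fst (\<rho> Y) e \<ominus>\<^bsub>M\<^esub> fst (\<rho> Z) c) b =
      X \<otimes>\<^bsub>L\<^esub> (Y \<otimes>\<^bsub>L\<^esub> Z) \<oplus>\<^bsub>L\<^esub> (\<beta> (fst (\<rho> X) c) f \<oplus>\<^bsub>L\<^esub> \<beta> c (snd (\<rho> X) f)) \<ominus>\<^bsub>L\<^esub>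
      (\<beta> (fst (\<rho> X) e) d \<oplus>\<^bsub>L\<^esub> \<beta> e (snd (\<rho> X) d)) \<oplus>\<^bsub>L\<^esub>
      (\<beta> a (snd (\<rho> Y) f) \<ominus>\<^bsub>L\<^esub> \<beta> a (snd (\<rho> Z) d)) \<ominus>\<^bsub>L\<^esub>
      (\<beta> (fst (\<rho> Y) e) b \<ominus>\<^bsub>L\<^esub> \<beta> (fst (\<rho> Z) c) b)"
    if "a \<in> carrier M" "c \<in> carrier M" "e \<in> carrier M" "b \<in> carrier N" "d \<in> carrier N"
      "f \<in> carrier N" "X \<in> carrier L" "Y \<in> carrier L" "Z \<in> carrier L" for a b c e d f X Y Z
    using that by (simp add: cover_rules bracket_\<beta>)
  \<comment> \<open>The symmetry of the triple products makes the terms of different summands syntactically equal.\<close>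
  have sM: "s c f a = s a f c" "s a d e = s e d a" "s e b c = s c b e"
    by (simp_all add: s_sym)
  have sN: "t f c b = t b c f" "t d e b = t b e d" "t f a d = t d a f"
    by (simp_all add: t_sym)
  have cM: "fst (\<rho> X) (fst (\<rho> Y) e) \<in> carrier M" "fst (\<rho> X) (fst (\<rho> Z) c) \<in> carrier M"
    "fst (\<rho> Y) (fst (\<rho> Z) a) \<in> carrier M" "fst (\<rho> Y) (fst (\<rho> X) e) \<in> carrier M"
    "fst (\<rho> Z) (fst (\<rho> X) c) \<in> carrier M" "fst (\<rho> Z) (fst (\<rho> Y) a) \<in> carrier M"
    "s a f c \<in> carrier M" "s e d a \<in> carrier M" "s c b e \<in> carrier M"
    by (simp_all add: cover_rules)
  have cN: "snd (\<rho> X) (snd (\<rho> Y) f) \<in> carrier N" "snd (\<rho> X) (snd (\<rho> Z) d) \<in> carrier N"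
    "snd (\<rho> Y) (snd (\<rho> Z) b) \<in> carrier N" "snd (\<rho> Y) (snd (\<rho> X) f) \<in> carrier N"
    "snd (\<rho> Z) (snd (\<rho> X) d) \<in> carrier N" "snd (\<rho> Z) (snd (\<rho> Y) b) \<in> carrier N"
    "t b c f \<in> carrier N" "t b e d \<in> carrier N" "t d a f \<in> carrier N"
    by (simp_all add: cover_rules)
  have cL: "X \<otimes>\<^bsub>L\<^esub> (Y \<otimes>\<^bsub>L\<^esub> Z) \<in> carrier L" "Y \<otimes>\<^bsub>L\<^esub> (Z \<otimes>\<^bsub>L\<^esub> X) \<in> carrier L"
    "Z \<otimes>\<^bsub>L\<^esub> (X \<otimes>\<^bsub>L\<^esub> Y) \<in> carrier L"
    "\<beta> (fst (\<rho> X) c) f \<in> carrier L" "\<beta> c (snd (\<rho> X) f) \<in> carrier L"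
    "\<beta> (fst (\<rho> X) e) d \<in> carrier L" "\<beta> e (snd (\<rho> X) d) \<in> carrier L"
    "\<beta> a (snd (\<rho> Y) f) \<in> carrier L" "\<beta> a (snd (\<rho> Z) d) \<in> carrier L"
    "\<beta> (fst (\<rho> Y) e) b \<in> carrier L" "\<beta> (fst (\<rho> Z) c) b \<in> carrier L"
    "\<beta> (fst (\<rho> Y) a) f \<in> carrier L" "\<beta> (fst (\<rho> Z) a) d \<in> carrier L"
    "\<beta> e (snd (\<rho> Y) b) \<in> carrier L" "\<beta> c (snd (\<rho> Z) b) \<in> carrier L"
    by (simp_all add: cover_rules)
  show ?thesis
    apply (simp only: xyz E_simps prod.inject)
    apply (intro conjI)
    subgoal by (simp only: key_M mem sM) (rule M.cyclic_cancel_left; fact cM)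
    subgoal by (simp only: key_L mem) (rule L.cyclic_cancel_middle; fact cL L.jacobi[OF mem(7-9)])
    subgoal by (simp only: key_N mem sN) (rule N.cyclic_cancel_right; fact cN)
    done
qed

lemma E_lie_algebra: "lie_algebra R E"
proof (intro lie_algebra.intro lie_algebra_axioms.intro module_E E_jacobi bilinear_mapI linear_mapI)
  show "x \<otimes>\<^bsub>E\<^esub> x = \<zero>\<^bsub>E\<^esub>" if "x \<in> carrier E" for x
    using that by (auto simp: cover_rules M.minus_eq N.minus_eq L.minus_eq M.r_neg N.r_neg L.r_neg
        L.bracket_alternating)
qed (auto simp: cover_rules M.minus_eq N.minus_eq L.minus_eq M.minus_add N.minus_add L.minus_add
    M.a_ac N.a_ac L.a_ac M.smult_r_distr N.smult_r_distr L.smult_r_distr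
    M.smult_r_minus N.smult_r_minus L.smult_r_minus)

sublocale E: lie_algebra R E by (rule E_lie_algebra)

end

section \<open>Gradings and central extensions of covers\<close>

context tkk_cover
begin

abbreviation "Gr \<equiv> canonical_grading P L"

lemma grading_simps:
  "Gr (-1) = carrier M \<times> {\<zero>\<^bsub>L\<^esub>} \<times> {\<zero>\<^bsub>N\<^esub>}"
  "Gr 0 = {\<zero>\<^bsub>M\<^esub>} \<times> carrier L \<times> {\<zero>\<^bsub>N\<^esub>}"
  "Gr 1 = {\<zero>\<^bsub>M\<^esub>} \<times> {\<zero>\<^bsub>L\<^esub>} \<times> carrier N"
  "i \<notin> {-1, 0, 1} \<Longrightarrow> Gr i = {(\<zero>\<^bsub>M\<^esub>, \<zero>\<^bsub>L\<^esub>, \<zero>\<^bsub>N\<^esub>)}"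
  by (simp_all add: canonical_grading_def Let_def)

lemma degree_cases:
  obtains "i = -1" | "i = 0" | "i = 1" | "i \<notin> {-1, 0, 1::int}"
  by blast

lemma grading_subset: "Gr i \<subseteq> carrier E"
  by (cases i rule: degree_cases) (auto simp: grading_simps)

lemma grading_submodule: "submodule (Gr i) R E"
  using grading_subset
  by (intro E.submodule_from_smult; cases i rule: degree_cases) (auto simp: grading_simps)

lemma E_direct_sum: "is_direct_sum3 R E Gr"
  unfolding is_direct_sum3_def
proof (intro conjI ballI grading_submodule)
  fix x assume "x \<in> carrier E"
  then obtain a X b where x: "x = (a, X, b)" "a \<in> carrier M" "X \<in> carrier L" "b \<in> carrier N"
    by auto
  let ?t = "((a, \<zero>\<^bsub>L\<^esub>, \<zero>\<^bsub>N\<^esub>), (\<zero>\<^bsub>M\<^esub>, X, \<zero>\<^bsub>N\<^esub>), (\<zero>\<^bsub>M\<^esub>, \<zero>\<^bsub>L\<^esub>, b))"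
  show "\<exists>!t. t \<in> Gr (-1) \<times> Gr 0 \<times> Gr 1 \<and>
      x = (case t of (u, v, w) \<Rightarrow> u \<oplus>\<^bsub>E\<^esub> v \<oplus>\<^bsub>E\<^esub> w)"
    by (rule ex1I[of _ ?t]) (use x in \<open>auto simp: grading_simps\<close>)
qed

lemma grading_bracket: "x \<in> Gr i \<Longrightarrow> y \<in> Gr j \<Longrightarrow> x \<otimes>\<^bsub>E\<^esub> y \<in> Gr (i + j)"
  by (cases i rule: degree_cases; cases j rule: degree_cases)
    (auto simp: canonical_grading_def Let_def cover_rules M.minus_eq N.minus_eq L.minus_eq)

lemma E_three_graded: "three_graded R E Gr"
  unfolding three_graded_def
proof (intro conjI allI impI ballI E_lie_algebra E_direct_sum grading_bracket)
  show "Gr i = {\<zero>\<^bsub>E\<^esub>}" if "\<bar>i\<bar> > 1" for i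
  proof -
    from that have "i \<notin> {-1, 0, 1}" by auto
    from grading_simps(4)[OF this] show ?thesis by (simp only: E_simps)
  qed
qed

end

context jordan_pair_space
begin

sublocale TKK: tkk_cover R P I "\<lambda>X. X" \<nu>
  by (intro tkk_cover.intro tkk_cover_axioms.intro jordan_pair_space_axioms I.lie_algebra_axioms
      linear_map_id nu_bilinear instr_nu refl instr_spanned)

lemma TKK_eq: "TKK R P = TKK.E" "TKK_grading R P = TKK.Gr"
  by (simp_all add: TKK_def TKK_grading_def)

sublocale hat: tkk_cover R P D "mu R P" ang
  by (intro tkk_cover.intro tkk_cover_axioms.intro jordan_pair_space_axioms D.lie_algebra_axioms
      mu_linear angle_bilinear mu_angle D_angle D_spanned)

lemma TKK_hat_eq: "TKK_hat R P = hat.E" "TKK_hat_grading R P = hat.Gr"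
  by (simp_all add: TKK_hat_def TKK_hat_grading_def)

end

context tkk_cover
begin

definition "proj = (\<lambda>(a, X, b). (a, \<rho> X, b))"

lemma proj_simps [simp]: "proj (a, X, b) = (a, \<rho> X, b)" by (simp add: proj_def)

lemma proj_lie_hom: "lie_hom R E TKK.E proj"
  unfolding lie_hom_def
proof (intro conjI E_lie_algebra TKK.E_lie_algebra linear_mapI ballI)
  have sub: "\<rho> X \<in> carrier I" if "X \<in> carrier L" for X
    using \<rho>_linear_instr that by (rule linear_map_closed)
  fix x y assume "x \<in> carrier E" "y \<in> carrier E"
  then obtain a X b c Y d where xy: "x = (a, X, b)" "y = (c, Y, d)" and
    mem: "a \<in> carrier M" "X \<in> carrier L" "b \<in> carrier N" "c \<in> carrier M" "Y \<in> carrier L" "d \<in> carrier N"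
    by auto
  have 1: "\<rho> X \<otimes>\<^bsub>I\<^esub> \<rho> Y \<oplus>\<^bsub>I\<^esub> \<nu> a d \<in> carrier I"
    using mem by (intro I.a_closed I.bracket_rules(1) sub nu_in_instr)
  have 2: "\<nu> c b \<in> carrier I" using mem by (intro nu_in_instr)
  show "proj (x \<otimes>\<^bsub>E\<^esub> y) = proj x \<otimes>\<^bsub>TKK.E\<^esub> proj y"
    using mem instr_minus[OF 1 2] by (simp add: xy cover_rules \<rho>_bracket)
  show "proj (x \<oplus>\<^bsub>E\<^esub> y) = proj x \<oplus>\<^bsub>TKK.E\<^esub> proj y"
    using mem by (simp add: xy \<rho>_rules)
  show "proj x \<in> carrier TKK.E" using mem sub[OF mem(2)] by (simp add: xy)
  show "proj (r \<odot>\<^bsub>E\<^esub> x) = r \<odot>\<^bsub>TKK.E\<^esub> proj x" if "r \<in> carrier R" for r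
    using mem that by (simp add: xy \<rho>_rules)
qed

lemma proj_graded: "graded_lie_hom R E Gr TKK.E TKK.Gr proj"
proof -
  have sub: "\<rho> X \<in> carrier I" if "X \<in> carrier L" for X
    using \<rho>_linear_instr that by (rule linear_map_closed)
  have "proj ` Gr i \<subseteq> TKK.Gr i" for i
    by (cases i rule: degree_cases)
      (use sub in \<open>auto simp: grading_simps TKK.grading_simps \<rho>_rules simp del: instr_ops(1)\<close>)
  then show ?thesis
    unfolding graded_lie_hom_def using E_three_graded TKK.E_three_graded proj_lie_hom by blast
qed

text \<open>
  The image is a submodule and contains the generators \<open>\<nu>(a, b)\<close>.
\<close>

lemma \<rho>_surj: "\<rho> ` carrier L = carrier I"
proof
  show sub: "\<rho> ` carrier L \<subseteq> carrier I"
    by (rule image_subsetI) (rule linear_map_closed[OF \<rho>_linear_instr])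
  have "submodule (\<rho> ` carrier L) R I"
  proof (rule I.submodule_from_smult)
    show "\<rho> ` carrier L \<subseteq> carrier I" by (rule sub)
    show "\<zero>\<^bsub>I\<^esub> \<in> \<rho> ` carrier L"
      by (rule image_eqI[of _ _ "\<zero>\<^bsub>L\<^esub>"]) (simp_all add: \<rho>_rules)
  next
    fix a b assume "a \<in> \<rho> ` carrier L" "b \<in> \<rho> ` carrier L"
    then obtain X Y where "a = \<rho> X" "b = \<rho> Y" "X \<in> carrier L" "Y \<in> carrier L" by blast
    then show "a \<oplus>\<^bsub>I\<^esub> b \<in> \<rho> ` carrier L"
      by (intro image_eqI[of _ _ "X \<oplus>\<^bsub>L\<^esub> Y"]) (simp_all add: \<rho>_rules)
  next
    fix r a assume r: "r \<in> carrier R" and "a \<in> \<rho> ` carrier L"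
    then obtain X where "a = \<rho> X" "X \<in> carrier L" by blast
    then show "r \<odot>\<^bsub>I\<^esub> a \<in> \<rho> ` carrier L"
      using r by (intro image_eqI[of _ _ "r \<odot>\<^bsub>L\<^esub> X"]) (simp_all add: \<rho>_rules)
  qed
  moreover have "nu_set \<subseteq> \<rho> ` carrier L"
  proof
    fix X assume "X \<in> nu_set"
    then obtain a b where "X = \<nu> a b" "a \<in> carrier M" "b \<in> carrier N" by blast
    then show "X \<in> \<rho> ` carrier L" using \<rho>_\<beta>[of a b] \<beta>_rules(1)[of a b] by (intro image_eqI) simp_all
  qed
  ultimately show "carrier I \<subseteq> \<rho> ` carrier L" unfolding instr_spanned by (rule span_least)
qed

text \<open>
  The bracket of \<open>X\<close> with \<open>\<beta>(a, b)\<close> depends on \<open>X\<close> only through \<open>\<rho>(X)\<close>.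
\<close>

lemma \<rho>_kernel_central:
  assumes "X \<in> carrier L" "\<rho> X = \<zero>\<^bsub>G\<^esub>" "Y \<in> carrier L"
  shows "X \<otimes>\<^bsub>L\<^esub> Y = \<zero>\<^bsub>L\<^esub>"
  by (rule linear_eq_on_\<beta>[OF L.module_L bilinear_map_right[OF L.bracket_bilinear assms(1)]
        linear_map_const_zero[OF L.module_L] assms(3)])
    (use assms in \<open>simp add: bracket_\<beta> \<beta>_rules fst_rules snd_rules\<close>)

lemma proj_central: "graded_central_extension R E Gr TKK.E TKK.Gr proj"
  unfolding graded_central_extension_def
proof (intro conjI proj_graded)
  show "proj ` carrier E = carrier TKK.E"
  proof -
    have "proj ` carrier E = carrier M \<times> \<rho> ` carrier L \<times> carrier N" by (force simp: image_iff)
    then show ?thesis unfolding \<rho>_surj TKK.E_simps .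
  qed
  show "a_kernel E TKK.E proj \<subseteq> lie_center E"
    using \<rho>_kernel_central
    by (auto simp: a_kernel_def' lie_center_def cover_rules M.minus_eq N.minus_eq L.minus_eq)
qed

end

section \<open>The exchange involution of a triple system\<close>

locale triple_system =
  fixes R :: "'k ring" and U :: "('k, 't) module" and p :: "'t \<Rightarrow> 't \<Rightarrow> 't \<Rightarrow> 't"
  assumes triple: "jordan_triple_system R U p"
begin

abbreviation "Q \<equiv> triple_pair U p"

lemma triple_pair_sel [simp]: "neg_part Q = U" "pos_part Q = U" "neg_prod Q = p" "pos_prod Q = p"
  by (simp_all add: triple_pair_def)

sublocale jordan_pair_space R Q
  by unfold_locales (use triple in \<open>simp add: jordan_pair_def jordan_triple_system_def\<close>)

sublocale U: module R U
  using triple by (simp add: jordan_triple_system_def)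

lemmas p_rules = s_rules[simplified triple_pair_sel]

lemma swap_linear: "linear_map R G G prod.swap"
  by (rule linear_mapI) (auto simp: pair_gl_ops intro!: prod_eqI)

text \<open>
  The sign is due to the sign in the second component of \<open>\<nu>\<close>.
\<close>

lemma swap_nu: "a \<in> carrier U \<Longrightarrow> b \<in> carrier U \<Longrightarrow> prod.swap (\<nu> a b) = \<ominus>\<^bsub>G\<^esub> \<nu> b a"
  by (rule pair_gl_ext) (simp_all add: linear_map_closed[OF swap_linear] nu_closed nu_rules
      fst_rules snd_rules nu_apply p_rules)

end

text \<open>
  A cover with a linear extension \<open>\<theta>\<close> of \<open>\<beta>(a, b) \<mapsto> -\<beta>(b, a)\<close>.
\<close>

locale triple_cover = triple_system R U p + tkk_cover R "triple_pair U p" L \<rho> \<beta>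
  for R :: "'k ring" and U :: "('k, 't) module" and p :: "'t \<Rightarrow> 't \<Rightarrow> 't \<Rightarrow> 't"
    and L :: "('k, 'd) module" and \<rho> \<beta> +
  fixes \<theta> :: "'d \<Rightarrow> 'd"
  assumes \<theta>_linear: "linear_map R L L \<theta>"
    and \<theta>_\<beta>: "a \<in> carrier U \<Longrightarrow> b \<in> carrier U \<Longrightarrow> \<theta> (\<beta> a b) = \<ominus>\<^bsub>L\<^esub> \<beta> b a"
begin

lemmas \<theta>_rules = linear_map_closed[OF \<theta>_linear] linear_map_add[OF \<theta>_linear]
  linear_map_smult[OF \<theta>_linear] linear_map_zero[OF L.module_L L.module_L \<theta>_linear]
  linear_map_minus[OF L.module_L L.module_L \<theta>_linear]
  linear_map_neg[OF L.module_L L.module_L \<theta>_linear]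

lemma \<rho>_\<theta>: "X \<in> carrier L \<Longrightarrow> \<rho> (\<theta> X) = prod.swap (\<rho> X)"
  by (rule linear_eq_on_\<beta>[OF G.module_L linear_map_compose[OF \<theta>_linear \<rho>_linear]
        linear_map_compose[OF \<rho>_linear swap_linear]])
    (simp_all add: \<theta>_\<beta> \<rho>_rules \<rho>_\<beta> \<beta>_rules swap_nu del: swap_simp)

lemma \<theta>_\<theta>: "X \<in> carrier L \<Longrightarrow> \<theta> (\<theta> X) = X"
  by (rule linear_eq_on_\<beta>[OF L.module_L linear_map_compose[OF \<theta>_linear \<theta>_linear] linear_map_id])
    (simp_all add: \<theta>_\<beta> \<theta>_rules \<beta>_rules)

text \<open>
  For \<open>Y = \<beta>(a, b)\<close> both sides are \<open>-\<beta>(b, X a) - \<beta>(X b, a)\<close>, since \<open>\<theta> X\<close> acts on each side as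
  \<open>X\<close> acts on the other.
\<close>

lemma \<theta>_bracket:
  assumes "X \<in> carrier L" "Y \<in> carrier L"
  shows "\<theta> (X \<otimes>\<^bsub>L\<^esub> Y) = \<theta> X \<otimes>\<^bsub>L\<^esub> \<theta> Y"
proof (rule linear_eq_on_\<beta>[OF L.module_L
      linear_map_compose[OF bilinear_map_right[OF L.bracket_bilinear assms(1)] \<theta>_linear]
      linear_map_compose[OF \<theta>_linear bilinear_map_right[OF L.bracket_bilinear \<theta>_rules(1)[OF assms(1)]]]
      assms(2)])
  fix a b assume "a \<in> carrier (neg_part Q)" "b \<in> carrier (pos_part Q)"
  then show "\<theta> (X \<otimes>\<^bsub>L\<^esub> \<beta> a b) = \<theta> X \<otimes>\<^bsub>L\<^esub> \<theta> (\<beta> a b)"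
    using assms fst_rules(1)[of "\<rho> X" a] snd_rules(1)[of "\<rho> X" b]
    by (simp add: bracket_\<beta> \<theta>_\<beta> \<theta>_rules \<beta>_rules \<rho>_\<theta> \<rho>_rules L.bracket_rules L.minus_add L.a_comm)
qed

definition "kappa = (\<lambda>(a, X, b). (b, \<theta> X, a))"

lemma kappa_simps [simp]: "kappa (a, X, b) = (b, \<theta> X, a)" by (simp add: kappa_def)

lemma kappa_anti_graded_involution: "anti_graded_involution R E Gr kappa"
  unfolding anti_graded_involution_def
proof (intro conjI E_three_graded ballI)
  show "lie_hom R E E kappa"
    unfolding lie_hom_def
  proof (intro conjI E_lie_algebra linear_mapI ballI)
    fix x y assume "x \<in> carrier E" "y \<in> carrier E"
    then obtain a X b c Y d where xy: "x = (a, X, b)" "y = (c, Y, d)" and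
      mem: "a \<in> carrier U" "X \<in> carrier L" "b \<in> carrier U" "c \<in> carrier U" "Y \<in> carrier L" "d \<in> carrier U"
      by auto
    have c: "\<beta> a d \<in> carrier L" "\<beta> d a \<in> carrier L" "\<beta> b c \<in> carrier L" "\<beta> c b \<in> carrier L"
      "\<theta> X \<otimes>\<^bsub>L\<^esub> \<theta> Y \<in> carrier L" "X \<otimes>\<^bsub>L\<^esub> Y \<in> carrier L"
      using mem by (simp_all add: \<beta>_rules \<theta>_rules L.bracket_rules)
    have "\<theta> (X \<otimes>\<^bsub>L\<^esub> Y \<oplus>\<^bsub>L\<^esub> \<beta> a d \<ominus>\<^bsub>L\<^esub> \<beta> c b) = \<theta> X \<otimes>\<^bsub>L\<^esub> \<theta> Y \<oplus>\<^bsub>L\<^esub> \<beta> b c \<ominus>\<^bsub>L\<^esub> \<beta> d a"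
      using mem c by (simp add: \<theta>_rules \<theta>_bracket \<theta>_\<beta> L.minus_eq L.a_ac)
    then show "kappa (x \<otimes>\<^bsub>E\<^esub> y) = kappa x \<otimes>\<^bsub>E\<^esub> kappa y"
      using mem by (simp add: xy \<rho>_\<theta>)
    show "kappa x \<in> carrier E" "kappa (x \<oplus>\<^bsub>E\<^esub> y) = kappa x \<oplus>\<^bsub>E\<^esub> kappa y"
      using mem by (simp_all add: xy \<theta>_rules)
    show "kappa (r \<odot>\<^bsub>E\<^esub> x) = r \<odot>\<^bsub>E\<^esub> kappa x" if "r \<in> carrier R" for r
      using mem that by (simp_all add: xy \<theta>_rules)
  qed
  show "kappa (kappa x) = x" if "x \<in> carrier E" for x using that by (auto simp: \<theta>_\<theta>)
  show "\<forall>i. kappa ` Gr i \<subseteq> Gr (- i)"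
  proof
    fix i show "kappa ` Gr i \<subseteq> Gr (- i)"
      by (cases i rule: degree_cases) (auto simp: canonical_grading_def Let_def \<theta>_rules)
  qed
qed

end

context triple_system
begin

notation ptens (infixl "\<otimes>\<^sub>P" 75)

definition "\<theta>\<^sub>I = linear_ext R I I (pair_carrier Q) (\<lambda>(c, d). \<nu> c d) (\<lambda>(c, d). \<ominus>\<^bsub>I\<^esub> \<nu> d c)"
definition "\<theta>\<^sub>D = linear_ext R D D (pair_carrier Q) (\<lambda>(c, d). ang c d) (\<lambda>(c, d). \<ominus>\<^bsub>D\<^esub> ang d c)"

lemma swap_instr:
  assumes "X \<in> carrier I" shows "prod.swap X \<in> carrier I"
proof (rule linear_map_image_span[OF G.module_L G.module_L swap_linear nu_set_closed instr_submodule])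
  show "X \<in> submodule_span R G nu_set" using assms by simp
  fix Y assume "Y \<in> nu_set"
  then obtain a b where "Y = \<nu> a b" "a \<in> carrier U" "b \<in> carrier U" by auto
  then show "prod.swap Y \<in> carrier I"
    using G.submoduleE(3)[OF instr_submodule nu_in_instr[of b a]] by (simp only: swap_nu triple_pair_sel)
qed

sublocale TKK_swap: triple_cover R U p I "\<lambda>X. X" \<nu> \<theta>\<^sub>I
proof (intro triple_cover.intro triple_cover_axioms.intro triple_system_axioms TKK.tkk_cover_axioms)
  have lin: "linear_map R I I prod.swap"
    using swap_linear swap_instr instr_subset by (auto simp: linear_map_def simp del: instr_ops(1))
  have val: "prod.swap (\<nu> a b) = \<ominus>\<^bsub>I\<^esub> \<nu> b a" if "a \<in> carrier U" "b \<in> carrier U" for a b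
    using that nu_in_instr[of b a] by (simp only: swap_nu instr_a_inv triple_pair_sel)
  note * = linear_ext_eq[OF lin, where S = "pair_carrier Q" and g = "\<lambda>(c, d). \<nu> c d"
      and y = "\<lambda>(c, d). \<ominus>\<^bsub>I\<^esub> \<nu> d c"]
  show "linear_map R I I \<theta>\<^sub>I" unfolding \<theta>\<^sub>I_def by (rule *(1)) (use val in auto)
  show "\<theta>\<^sub>I (\<nu> a b) = \<ominus>\<^bsub>I\<^esub> \<nu> b a" if "a \<in> carrier U" "b \<in> carrier U" for a b
    unfolding \<theta>\<^sub>I_def using *(2)[of "(a, b)"] val that by auto
qed

text \<open>
  The flip \<open>\<sigma>\<close> of \<open>T \<otimes> T\<close> satisfies \<open>\<sigma>(X m) = swap(X) \<sigma>(m)\<close> and \<open>swap(\<lambda>(m)) = -\<lambda>(\<sigma> m)\<close>. Hence it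
  sends the square \<open>\<lambda>(m) m\<close> to \<open>-\<lambda>(\<sigma> m) (\<sigma> m)\<close>, and \<open>-\<sigma>\<close> descends to \<open>\<langle>P\<^sub>-, P\<^sub>+\<rangle>\<close>.
\<close>

lemma hat_theta_exists:
  obtains f where "linear_map R D D f"
    "\<And>a b. a \<in> carrier U \<Longrightarrow> b \<in> carrier U \<Longrightarrow> f (ang a b) = \<ominus>\<^bsub>D\<^esub> ang b a"
proof -
  have "bilinear_map R M N T (\<lambda>a b. b \<otimes>\<^sub>P a)"
    using bilinear_map_left[OF ptensor_bilinear] bilinear_map_right[OF ptensor_bilinear]
    by (auto intro: bilinear_mapI)
  then obtain \<sigma> where \<sigma>: "linear_map R T T \<sigma>"
    and \<sigma>_pure: "\<And>a b. a \<in> carrier U \<Longrightarrow> b \<in> carrier U \<Longrightarrow> \<sigma> (a \<otimes>\<^sub>P b) = b \<otimes>\<^sub>P a"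
    using ptensor_lift[OF module_T] by (metis triple_pair_sel(1,2))
  have lam_\<sigma>: "lam (\<sigma> m) = \<ominus>\<^bsub>G\<^esub> prod.swap (lam m)" if m: "m \<in> carrier T" for m
  proof (rule T_linear_eq[OF G.module_L _ _ _ m])
    note l = linear_map_compose[OF lam_linear instr_inclusion]
    show "linear_map R T G (\<lambda>m. lam (\<sigma> m))" by (rule linear_map_compose[OF \<sigma> l])
    show "linear_map R T G (\<lambda>m. \<ominus>\<^bsub>G\<^esub> prod.swap (lam m))"
      by (rule linear_map_uminus[OF G.module_L linear_map_compose[OF l swap_linear]])
    fix a b assume "a \<in> carrier (neg_part Q)" "b \<in> carrier (pos_part Q)"
    then show "lam (\<sigma> (a \<otimes>\<^sub>P b)) = \<ominus>\<^bsub>G\<^esub> prod.swap (lam (a \<otimes>\<^sub>P b))"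
      by (simp add: \<sigma>_pure lam_pure swap_nu nu_closed del: swap_simp)
  qed
  have \<sigma>_act: "\<sigma> (act X m) = act (prod.swap X) (\<sigma> m)" if X: "X \<in> carrier G" and m: "m \<in> carrier T" for X m
  proof (rule T_linear_eq[OF module_T _ _ _ m])
    have X': "prod.swap X \<in> carrier G" using swap_linear X by (rule linear_map_closed)
    show "linear_map R T T (\<lambda>m. \<sigma> (act X m))" by (rule linear_map_compose[OF act_spec(1)[OF X] \<sigma>])
    show "linear_map R T T (\<lambda>m. act (prod.swap X) (\<sigma> m))"
      by (rule linear_map_compose[OF \<sigma> act_spec(1)[OF X']])
    fix a b assume ab: "a \<in> carrier (neg_part Q)" "b \<in> carrier (pos_part Q)"
    then show "\<sigma> (act X (a \<otimes>\<^sub>P b)) = act (prod.swap X) (\<sigma> (a \<otimes>\<^sub>P b))"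
      using X X' fst_rules(1)[OF X ab(1)] snd_rules(1)[OF X ab(2)]
      by (simp add: \<sigma>_pure act_spec(2) linear_map_add[OF \<sigma>] ptensor_rules T.a_comm)
  qed
  have \<sigma>_squares: "\<sigma> m \<in> A.squares" if "m \<in> A.squares" for m
  proof (rule linear_map_image_span[OF module_T module_T \<sigma> A.square_gens A.Q.N])
    show "m \<in> submodule_span R T {act (lam m) m |m. m \<in> carrier T}"
      using that by (simp add: A.squares_def)
    fix x assume "x \<in> {act (lam m) m |m. m \<in> carrier T}"
    then obtain m where m: "m \<in> carrier T" and x: "x = act (lam m) m" by blast
    have l: "lam m' \<in> carrier G" if "m' \<in> carrier T" for m'
      using linear_map_closed[OF lam_linear that] by (rule instr_subset)
    have \<sigma>m: "\<sigma> m \<in> carrier T" using \<sigma> m by (rule linear_map_closed)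
    have sw: "prod.swap (lam m) = \<ominus>\<^bsub>G\<^esub> lam (\<sigma> m)"
      using lam_\<sigma>[OF m] linear_map_closed[OF swap_linear l[OF m]] by simp
    have "\<sigma> x = act (\<ominus>\<^bsub>G\<^esub> lam (\<sigma> m)) (\<sigma> m)"
      unfolding x \<sigma>_act[OF l[OF m] m] sw ..
    also have "\<dots> = \<ominus>\<^bsub>T\<^esub> act (lam (\<sigma> m)) (\<sigma> m)"
      using linear_map_neg[OF G.module_L module_T bilinear_map_left[OF act_bilinear_gl \<sigma>m] l[OF \<sigma>m]] .
    also have "\<dots> \<in> A.squares"
      by (rule T.submoduleE(3)[OF A.Q.N A.square_mem[OF \<sigma>m]])
    finally show "\<sigma> x \<in> A.squares" .
  qed
  have lin: "linear_map R T D (\<lambda>m. \<ominus>\<^bsub>D\<^esub> A.Q.\<pi> (\<sigma> m))"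
    by (rule linear_map_uminus[OF D.module_L linear_map_compose[OF \<sigma> proj_linear_D]])
  have zero: "\<ominus>\<^bsub>D\<^esub> A.Q.\<pi> (\<sigma> m) = \<zero>\<^bsub>D\<^esub>" if "m \<in> A.squares" for m
  proof -
    have "\<sigma> m \<in> carrier T" using subsetD[OF A.Q.N_sub \<sigma>_squares[OF that]] .
    then have "A.Q.\<pi> (\<sigma> m) = \<zero>\<^bsub>D\<^esub>"
      using A.Q.proj_eq_zero_iff \<sigma>_squares[OF that] by (simp add: D_eq)
    then show ?thesis by simp
  qed
  obtain f where f: "linear_map R A.Q.Q D f" "\<And>m. m \<in> carrier T \<Longrightarrow> f (A.Q.\<pi> m) = \<ominus>\<^bsub>D\<^esub> A.Q.\<pi> (\<sigma> m)"
    by (rule A.Q.quotient_lift[OF D.module_L lin zero]) blast+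
  show thesis
  proof (rule that)
    have "linear_map R (A.Q.Q\<lparr>mult := angle_bracket R Q\<rparr>) D f"
      by (simp only: linear_map_mult_update f(1))
    then show "linear_map R D D f" by (simp only: D_eq)
    show "f (ang a b) = \<ominus>\<^bsub>D\<^esub> ang b a" if "a \<in> carrier U" "b \<in> carrier U" for a b
      using that f(2)[of "a \<otimes>\<^sub>P b"] by (simp add: angle_eq \<sigma>_pure ptensor_rules)
  qed
qed

sublocale hat_swap: triple_cover R U p D "mu R Q" ang \<theta>\<^sub>D
proof (intro triple_cover.intro triple_cover_axioms.intro triple_system_axioms hat.tkk_cover_axioms)
  obtain f where f: "linear_map R D D f"
    "\<And>a b. a \<in> carrier U \<Longrightarrow> b \<in> carrier U \<Longrightarrow> f (ang a b) = \<ominus>\<^bsub>D\<^esub> ang b a"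
    using hat_theta_exists by blast
  note * = linear_ext_eq[OF f(1), where S = "pair_carrier Q" and g = "\<lambda>(c, d). ang c d"
      and y = "\<lambda>(c, d). \<ominus>\<^bsub>D\<^esub> ang d c"]
  show "linear_map R D D \<theta>\<^sub>D" unfolding \<theta>\<^sub>D_def by (rule *(1)) (use f(2) in auto)
  show "\<theta>\<^sub>D (ang a b) = \<ominus>\<^bsub>D\<^esub> ang b a" if "a \<in> carrier U" "b \<in> carrier U" for a b
    unfolding \<theta>\<^sub>D_def using *(2)[of "(a, b)"] f(2) that by auto
qed

lemma kappa_eq: "kappa_bar R Q = TKK_swap.kappa" "kappa_hat R Q = hat_swap.kappa"
  unfolding kappa_bar_def kappa_hat_def TKK_swap.kappa_def hat_swap.kappa_def
  unfolding \<theta>\<^sub>I_def \<theta>\<^sub>D_def by simp_all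

end

lemma (in jordan_pair_space) upsilon_eq: "upsilon R P = hat.proj"
  by (simp add: upsilon_def hat.proj_def)

text \<open>
  On the middle term both sides are \<open>\<mu>(X)\<close> with its components exchanged.
\<close>

lemma (in triple_system) proj_kappa: "x \<in> carrier hat.E \<Longrightarrow> hat.proj (hat_swap.kappa x) = TKK_swap.kappa (hat.proj x)"
  using linear_map_closed[OF mu_linear]
  by (auto simp: hat_swap.\<rho>_\<theta> TKK_swap.\<rho>_\<theta> simp del: instr_ops(1))

section \<open>Jordan algebras as triple systems\<close>

lemma (in abelian_group) add_pow_two:
  assumes "x \<in> carrier G"
  shows "add_pow G (2::nat) x = x \<oplus> x" "add_pow G (2::int) x = x \<oplus> x"
    "add_pow G (-2::int) x = \<ominus> (x \<oplus> x)" "add_pow G (0::int) x = \<zero>"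
proof -
  show *: "add_pow G (2::nat) x = x \<oplus> x" using assms by (simp add: numeral_2_eq_2)
  show "add_pow G (2::int) x = x \<oplus> x" "add_pow G (-2::int) x = \<ominus> (x \<oplus> x)" "add_pow G (0::int) x = \<zero>"
    by (simp_all add: add_pow_int_ge add_pow_int_lt *)
qed

lemma (in abelian_group) no_torsion_two:
  assumes "no_torsion 2 G" "x \<in> carrier G"
  shows "x \<oplus> x = \<zero> \<longleftrightarrow> x = \<zero>" "\<ominus> (x \<oplus> x) = x \<oplus> x \<longleftrightarrow> x = \<zero>" "x \<oplus> x = \<ominus> (x \<oplus> x) \<longleftrightarrow> x = \<zero>"
    "\<zero> = x \<oplus> x \<longleftrightarrow> x = \<zero>" "\<zero> = \<ominus> (x \<oplus> x) \<longleftrightarrow> x = \<zero>" "\<ominus> (x \<oplus> x) = \<zero> \<longleftrightarrow> x = \<zero>"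
proof -
  have *: "y = \<zero>" if "y \<in> carrier G" "y \<oplus> y = \<zero>" for y
  proof -
    have "add_pow G (2::nat) y = \<zero>" using that by (simp only: add_pow_two)
    then show ?thesis using assms(1) that(1) unfolding no_torsion_def by blast
  qed
  show 1: "x \<oplus> x = \<zero> \<longleftrightarrow> x = \<zero>"
    by (rule iffI, rule *[OF assms(2)], assumption) simp
  then show 2: "\<zero> = x \<oplus> x \<longleftrightarrow> x = \<zero>" by metis
  have "\<ominus> (x \<oplus> x) = \<zero> \<longleftrightarrow> x \<oplus> x = \<zero>" using assms(2) by (simp only: add.inv_eq_1_iff a_closed)
  with 1 show "\<ominus> (x \<oplus> x) = \<zero> \<longleftrightarrow> x = \<zero>" "\<zero> = \<ominus> (x \<oplus> x) \<longleftrightarrow> x = \<zero>" by metis+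
  have "x = \<zero>" if "\<ominus> (x \<oplus> x) = x \<oplus> x"
  proof -
    have "(x \<oplus> x) \<oplus> (x \<oplus> x) = (x \<oplus> x) \<oplus> \<ominus> (x \<oplus> x)" by (simp only: that)
    then have "(x \<oplus> x) \<oplus> (x \<oplus> x) = \<zero>" using assms(2) by (simp only: r_neg a_closed)
    then have "x \<oplus> x = \<zero>" by (rule *[rotated]) (simp add: assms(2))
    then show ?thesis by (rule *[OF assms(2)])
  qed
  moreover have "\<ominus> (x \<oplus> x) = x \<oplus> x" if "x = \<zero>" using that by simp
  ultimately show "\<ominus> (x \<oplus> x) = x \<oplus> x \<longleftrightarrow> x = \<zero>" "x \<oplus> x = \<ominus> (x \<oplus> x) \<longleftrightarrow> x = \<zero>"
    by metis+
qed

lemma (in abelian_group) difference_from_balance: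
  assumes "p \<oplus> u \<oplus> s = q \<oplus> t \<oplus> r"
    and c: "p \<in> carrier G" "q \<in> carrier G" "r \<in> carrier G"
      "s \<in> carrier G" "t \<in> carrier G" "u \<in> carrier G"
  shows "p \<ominus> q = r \<ominus> s \<oplus> (t \<ominus> u)"
proof -
  have "p \<ominus> q = (p \<oplus> u \<oplus> s) \<ominus> (q \<oplus> u \<oplus> s)" using c by algebra
  also have "\<dots> = (q \<oplus> t \<oplus> r) \<ominus> (q \<oplus> u \<oplus> s)" by (simp only: assms(1))
  also have "\<dots> = r \<ominus> s \<oplus> (t \<ominus> u)" using c by algebra
  finally show ?thesis .
qed

text \<open>
  Let \<open>S\<close> be the cyclic sum of \<open>A\<close>, a symmetric trilinear map. The vanishing of \<open>A\<close> on
  \<open>x + y\<close> and \<open>x - y\<close> gives \<open>2 S(x, y, y) = 0\<close>, and then the vanishing of \<open>S(x, y + z, y + z)\<close> gives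
  \<open>2 S(x, y, z) = 0\<close>.
\<close>

lemma polarize_cubic:
  assumes M: "module R M" and K: "module R K" and A: "trilinear_map R M M M K A"
    and sym: "\<And>x y z. x \<in> carrier M \<Longrightarrow> y \<in> carrier M \<Longrightarrow> z \<in> carrier M \<Longrightarrow> A x y z = A y x z"
    and cube: "\<And>x. x \<in> carrier M \<Longrightarrow> A x x x = \<zero>\<^bsub>K\<^esub>"
    and tor: "no_torsion 2 K"
    and xyz: "x \<in> carrier M" "y \<in> carrier M" "z \<in> carrier M"
  shows "A x y z \<oplus>\<^bsub>K\<^esub> A y z x \<oplus>\<^bsub>K\<^esub> A z x y = \<zero>\<^bsub>K\<^esub>"
proof -
  interpret M: module R M by fact
  interpret K: module R K by fact
  note r = trilinear_map_rules[OF M M M K A]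
  define S where "S x y z = A x y z \<oplus>\<^bsub>K\<^esub> A y z x \<oplus>\<^bsub>K\<^esub> A z x y" for x y z
  have S_closed: "S x y z \<in> carrier K" if "x \<in> carrier M" "y \<in> carrier M" "z \<in> carrier M" for x y z
    using that by (simp add: S_def r)
  have two_one: "S x y y = \<zero>\<^bsub>K\<^esub>" if x: "x \<in> carrier M" and y: "y \<in> carrier M" for x y
  proof -
    have sum: "S x x y \<oplus>\<^bsub>K\<^esub> S x y y = \<zero>\<^bsub>K\<^esub>" if y: "y \<in> carrier M" for y
    proof -
      have c: "A x x y \<in> carrier K" "A x y x \<in> carrier K" "A x y y \<in> carrier K" "A y x x \<in> carrier K"
        "A y x y \<in> carrier K" "A y y x \<in> carrier K" using x y by (simp_all add: r)
      have "A (x \<oplus>\<^bsub>M\<^esub> y) (x \<oplus>\<^bsub>M\<^esub> y) (x \<oplus>\<^bsub>M\<^esub> y) =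
          A x x x \<oplus>\<^bsub>K\<^esub> A y y y \<oplus>\<^bsub>K\<^esub> (S x x y \<oplus>\<^bsub>K\<^esub> S x y y)"
        using x y c by (simp add: r S_def K.a_ac)
      then show ?thesis using x y cube[of "x \<oplus>\<^bsub>M\<^esub> y"] by (simp add: cube S_closed)
    qed
    have "S x x (\<ominus>\<^bsub>M\<^esub> y) = \<ominus>\<^bsub>K\<^esub> S x x y" "S x (\<ominus>\<^bsub>M\<^esub> y) (\<ominus>\<^bsub>M\<^esub> y) = S x y y"
      using x y by (simp_all add: S_def r K.minus_add)
    then have "\<ominus>\<^bsub>K\<^esub> S x x y \<oplus>\<^bsub>K\<^esub> S x y y = \<zero>\<^bsub>K\<^esub>" using sum[of "\<ominus>\<^bsub>M\<^esub> y"] y by simp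
    then have "S x y y \<ominus>\<^bsub>K\<^esub> S x x y = \<zero>\<^bsub>K\<^esub>"
      using x y S_closed by (simp add: a_minus_def K.a_comm)
    then have "S x y y = S x x y" using x y S_closed by (simp add: K.minus_eq_zero_iff)
    then show ?thesis using sum[OF y] K.no_torsion_two(1)[OF tor, of "S x y y"] x y S_closed by simp
  qed
  have "S x (y \<oplus>\<^bsub>M\<^esub> z) (y \<oplus>\<^bsub>M\<^esub> z) = S x y y \<oplus>\<^bsub>K\<^esub> S x z z \<oplus>\<^bsub>K\<^esub> (S x y z \<oplus>\<^bsub>K\<^esub> S x y z)"
    using xyz sym[of x z y] sym[of z y x] sym[of y x z] by (simp add: S_def r K.a_ac)
  then have "S x y z \<oplus>\<^bsub>K\<^esub> S x y z = \<zero>\<^bsub>K\<^esub>" using xyz by (simp add: two_one S_closed)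
  then have "S x y z = \<zero>\<^bsub>K\<^esub>" using K.no_torsion_two(1)[OF tor S_closed[OF xyz]] by (simp only:)
  then show ?thesis unfolding S_def .
qed

locale two_torsion_free_jordan_algebra = unital_jordan_algebra R J
  for R :: "'k ring" and J :: "('k, 'j) module" (structure) +
  assumes torsion: "no_torsion 2 J"
begin

lemma module_J: "module R J" by (rule module_axioms)

lemmas rules = bilinear_map_rules[OF module_J module_J module_J product_bilinear]

text \<open>
  The polarization of \<open>(x x \<cdot> b) x - (x x)(b x)\<close> in \<open>x\<close>.
\<close>

lemma linearized_jordan:
  assumes mem: "a \<in> carrier J" "b \<in> carrier J" "c \<in> carrier J" "d \<in> carrier J"
  shows "((a \<otimes> c) \<otimes> b) \<otimes> d \<oplus> ((c \<otimes> d) \<otimes> b) \<otimes> a \<oplus> ((d \<otimes> a) \<otimes> b) \<otimes> c =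
    (a \<otimes> c) \<otimes> (b \<otimes> d) \<oplus> (c \<otimes> d) \<otimes> (b \<otimes> a) \<oplus> (d \<otimes> a) \<otimes> (b \<otimes> c)"
    (is "?l1 \<oplus> ?l2 \<oplus> ?l3 = ?r1 \<oplus> ?r2 \<oplus> ?r3")
proof -
  let ?A = "\<lambda>x y z. ((x \<otimes> y) \<otimes> b) \<otimes> z \<ominus> (x \<otimes> y) \<otimes> (b \<otimes> z)"
  have "trilinear_map R J J J J ?A"
    unfolding trilinear_map_def using mem
    by (auto intro!: bilinear_mapI linear_mapI simp: rules M.minus_eq M.minus_add M.a_ac smult_r_distr smult_r_minus)
  moreover have "?A x x x = \<zero>" if "x \<in> carrier J" for x
    using that mem jordan_identity[of x b] by (simp add: rules M.minus_eq_zero_iff)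
  moreover have "?A x y z = ?A y x z" if "x \<in> carrier J" "y \<in> carrier J" for x y z
    using product_commute[OF that] by simp
  ultimately have "?A a c d \<oplus> ?A c d a \<oplus> ?A d a c = \<zero>"
    using mem by (intro polarize_cubic[OF module_J module_J _ _ _ torsion]) auto
  moreover have "?A a c d \<oplus> ?A c d a \<oplus> ?A d a c = (?l1 \<oplus> ?l2 \<oplus> ?l3) \<ominus> (?r1 \<oplus> ?r2 \<oplus> ?r3)"
    using mem by (simp add: rules M.minus_eq M.minus_add M.a_ac)
  ultimately show ?thesis using mem by (simp add: rules M.minus_eq_zero_iff)
qed

definition "inner a b x = a \<otimes> (b \<otimes> x) \<ominus> b \<otimes> (a \<otimes> x)"

lemma inner_closed: "a \<in> carrier J \<Longrightarrow> b \<in> carrier J \<Longrightarrow> x \<in> carrier J \<Longrightarrow> inner a b x \<in> carrier J"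
  by (simp add: inner_def rules)

lemma inner_add: "a \<in> carrier J \<Longrightarrow> b \<in> carrier J \<Longrightarrow> x \<in> carrier J \<Longrightarrow> y \<in> carrier J \<Longrightarrow>
    inner a b (x \<oplus> y) = inner a b x \<oplus> inner a b y"
  and inner_minus: "a \<in> carrier J \<Longrightarrow> b \<in> carrier J \<Longrightarrow> x \<in> carrier J \<Longrightarrow> y \<in> carrier J \<Longrightarrow>
    inner a b (x \<ominus> y) = inner a b x \<ominus> inner a b y"
  by (simp_all add: inner_def rules M.minus_eq M.minus_add M.a_ac)

text \<open>
  By commutativity the right-hand side of the linearized identity is symmetric in all four letters,
  while the left-hand side distinguishes one of them. Equating the left-hand sides that distinguish
  \<open>a\<close> and \<open>b\<close> gives the claim.
\<close>

lemma inner_derivation: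
  assumes mem: "a \<in> carrier J" "b \<in> carrier J" "x \<in> carrier J" "y \<in> carrier J"
  shows "inner a b (x \<otimes> y) = inner a b x \<otimes> y \<oplus> x \<otimes> inner a b y"
proof -
  note pc = product_commute
  have c: "a \<otimes> (b \<otimes> (x \<otimes> y)) \<in> carrier J" "b \<otimes> (a \<otimes> (x \<otimes> y)) \<in> carrier J"
    "(a \<otimes> (b \<otimes> x)) \<otimes> y \<in> carrier J" "(b \<otimes> (a \<otimes> x)) \<otimes> y \<in> carrier J"
    "x \<otimes> (a \<otimes> (b \<otimes> y)) \<in> carrier J" "x \<otimes> (b \<otimes> (a \<otimes> y)) \<in> carrier J"
    using mem by (simp_all add: rules)
  have r: "(x \<otimes> y) \<otimes> (b \<otimes> a) \<oplus> (y \<otimes> a) \<otimes> (b \<otimes> x) \<oplus> (a \<otimes> x) \<otimes> (b \<otimes> y) =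
      (x \<otimes> y) \<otimes> (a \<otimes> b) \<oplus> (y \<otimes> b) \<otimes> (a \<otimes> x) \<oplus> (b \<otimes> x) \<otimes> (a \<otimes> y)"
    using mem pc[of a b] pc[of "y \<otimes> a" "b \<otimes> x"] pc[of "a \<otimes> x" "b \<otimes> y"] pc[of y a] pc[of y b]
    by (simp add: rules M.a_ac)
  have "((x \<otimes> y) \<otimes> b) \<otimes> a \<oplus> ((y \<otimes> a) \<otimes> b) \<otimes> x \<oplus> ((a \<otimes> x) \<otimes> b) \<otimes> y =
    ((x \<otimes> y) \<otimes> a) \<otimes> b \<oplus> ((y \<otimes> b) \<otimes> a) \<otimes> x \<oplus> ((b \<otimes> x) \<otimes> a) \<otimes> y"
    using linearized_jordan[of x b y a] linearized_jordan[of x a y b] mem r by (simp only:)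
  moreover have "((x \<otimes> y) \<otimes> b) \<otimes> a = a \<otimes> (b \<otimes> (x \<otimes> y))" if "a \<in> carrier J" "b \<in> carrier J" for a b
    using that mem pc[of "x \<otimes> y" b] pc[of "b \<otimes> (x \<otimes> y)" a] by (simp add: rules)
  moreover have "((y \<otimes> a) \<otimes> b) \<otimes> x = x \<otimes> (b \<otimes> (a \<otimes> y))" if "a \<in> carrier J" "b \<in> carrier J" for a b
    using that mem pc[of y a] pc[of "a \<otimes> y" b] pc[of "b \<otimes> (a \<otimes> y)" x] by (simp add: rules)
  moreover have "((a \<otimes> x) \<otimes> b) \<otimes> y = (b \<otimes> (a \<otimes> x)) \<otimes> y" if "a \<in> carrier J" "b \<in> carrier J" for a b
    using that mem pc[of "a \<otimes> x" b] by (simp add: rules)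
  ultimately have eq: "a \<otimes> (b \<otimes> (x \<otimes> y)) \<oplus> x \<otimes> (b \<otimes> (a \<otimes> y)) \<oplus> (b \<otimes> (a \<otimes> x)) \<otimes> y =
     b \<otimes> (a \<otimes> (x \<otimes> y)) \<oplus> x \<otimes> (a \<otimes> (b \<otimes> y)) \<oplus> (a \<otimes> (b \<otimes> x)) \<otimes> y"
    using mem by (simp only:)
  have "inner a b x \<otimes> y = (a \<otimes> (b \<otimes> x)) \<otimes> y \<ominus> (b \<otimes> (a \<otimes> x)) \<otimes> y"
    "x \<otimes> inner a b y = x \<otimes> (a \<otimes> (b \<otimes> y)) \<ominus> x \<otimes> (b \<otimes> (a \<otimes> y))"
    using mem by (simp_all add: inner_def rules)
  then show ?thesis using M.difference_from_balance[OF eq] c by (simp add: inner_def)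
qed

abbreviation "V \<equiv> algebra_triple_product J"

lemma V_inner:
  assumes "a \<in> carrier J" "b \<in> carrier J" "c \<in> carrier J"
  shows "V a b c = (a \<otimes> b) \<otimes> c \<oplus> inner a b c"
  using assms product_commute[of c a]
  by (simp add: algebra_triple_product_def inner_def rules M.minus_eq M.a_assoc)

text \<open>
  The linearized identity, read as a relation between multiplication operators applied to \<open>e\<close>: the
  commutators \<open>[u, c d]\<close>, \<open>[c, d u]\<close> and \<open>[d, u c]\<close> add up to \<open>0\<close>.
\<close>

lemma multiplication_commutators:
  assumes mem: "u \<in> carrier J" "c \<in> carrier J" "d \<in> carrier J" "e \<in> carrier J"
  shows "u \<otimes> ((c \<otimes> d) \<otimes> e) \<ominus> (c \<otimes> d) \<otimes> (u \<otimes> e) =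
    ((u \<otimes> c) \<otimes> (d \<otimes> e) \<ominus> d \<otimes> ((u \<otimes> c) \<otimes> e)) \<oplus>
    ((u \<otimes> d) \<otimes> (c \<otimes> e) \<ominus> c \<otimes> ((u \<otimes> d) \<otimes> e))"
proof -
  note pc = product_commute
  have "((u \<otimes> c) \<otimes> e) \<otimes> d = d \<otimes> ((u \<otimes> c) \<otimes> e)"
    "((c \<otimes> d) \<otimes> e) \<otimes> u = u \<otimes> ((c \<otimes> d) \<otimes> e)"
    "((d \<otimes> u) \<otimes> e) \<otimes> c = c \<otimes> ((u \<otimes> d) \<otimes> e)"
    "e \<otimes> d = d \<otimes> e" "e \<otimes> u = u \<otimes> e" "e \<otimes> c = c \<otimes> e" "d \<otimes> u = u \<otimes> d"
    using mem pc[of "(u \<otimes> c) \<otimes> e" d] pc[of "(c \<otimes> d) \<otimes> e" u] pc[of "(u \<otimes> d) \<otimes> e" c]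
      pc[of d u] pc[of e d] pc[of e u] pc[of e c] by (simp_all add: rules)
  with linearized_jordan[of c e d u] mem show ?thesis
    by (intro M.difference_from_balance) (simp_all only: rules)
qed

text \<open>
  Write \<open>V\<^sub>a\<^sub>b\<close> as the multiplication by \<open>u = a b\<close> plus the derivation \<open>inner a b\<close>; for \<open>V\<^sub>b\<^sub>a\<close> the derivation
  changes sign. The terms of the five-linear identity that contain the derivation cancel by the
  Leibniz rule, and the remaining ones are the commutator relation.
\<close>

lemma algebra_triple_system: "jordan_triple_system R J V"
  unfolding jordan_triple_system_def jordan_triple_identities_def
proof (intro conjI module_J ballI)
  show "trilinear_map R J J J J V"
    unfolding trilinear_map_def algebra_triple_product_def
    by (auto intro!: bilinear_mapI linear_mapI simp: rules M.minus_eq M.minus_add M.a_ac smult_r_distr smult_r_minus)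
  show "V a b c = V c b a" if "a \<in> carrier J" "b \<in> carrier J" "c \<in> carrier J" for a b c
    using that product_commute[of "a \<otimes> b" c] product_commute[of a b] product_commute[of "b \<otimes> c" a]
      product_commute[of b c] product_commute[of c a]
    by (simp add: algebra_triple_product_def rules M.a_comm)
  fix a b c d e assume mem: "a \<in> carrier J" "b \<in> carrier J" "c \<in> carrier J" "d \<in> carrier J" "e \<in> carrier J"
  define u where "u = a \<otimes> b"
  define w where "w = c \<otimes> d"
  let ?D = "inner a b"
  have uw: "u \<in> carrier J" "w \<in> carrier J" using mem by (simp_all add: u_def w_def rules)
  have mem': "?D c \<in> carrier J" "?D d \<in> carrier J" "?D e \<in> carrier J"
    using mem by (simp_all add: inner_closed)
  note all = mem mem' uw
  have Vab: "V a b x = u \<otimes> x \<oplus> ?D x" if "x \<in> carrier J" for x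
    using that mem by (simp add: V_inner u_def)
  have Vba: "V b a x = u \<otimes> x \<ominus> ?D x" if "x \<in> carrier J" for x
  proof -
    have "inner b a x = \<ominus> inner a b x"
      using that mem by (simp add: inner_def rules M.minus_eq M.minus_add M.a_comm)
    then show ?thesis
      using that mem product_commute[of b a] by (simp add: V_inner u_def M.minus_eq)
  qed
  have Vcd: "V c d x = w \<otimes> x \<oplus> inner c d x" if "x \<in> carrier J" for x
    using that mem by (simp add: V_inner w_def)
  \<comment> \<open>All monomials of the identity are named, so that the four sides become short sums: \<open>r\<close> and \<open>y1\<close>, \<open>z1\<close>, \<open>z2\<close> contain the derivation.\<close>
  define p1 p2 p3 p4 q1 q2 where pq: "p1 = (u \<otimes> c) \<otimes> (d \<otimes> e)" "p2 = d \<otimes> ((u \<otimes> c) \<otimes> e)"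
    "p3 = (u \<otimes> d) \<otimes> (c \<otimes> e)" "p4 = c \<otimes> ((u \<otimes> d) \<otimes> e)"
    "q1 = ((u \<otimes> c) \<otimes> d) \<otimes> e" "q2 = (c \<otimes> (u \<otimes> d)) \<otimes> e"
  define r1 r2 r3 r4 r5 r6 where rs: "r1 = (?D c \<otimes> d) \<otimes> e" "r2 = (c \<otimes> ?D d) \<otimes> e"
    "r3 = ?D c \<otimes> (d \<otimes> e)" "r4 = d \<otimes> (?D c \<otimes> e)" "r5 = c \<otimes> (?D d \<otimes> e)"
    "r6 = ?D d \<otimes> (c \<otimes> e)"
  define x1 x2 x3 y1 z1 z2 where xs: "x1 = u \<otimes> (w \<otimes> e)" "x2 = w \<otimes> (u \<otimes> e)" "x3 = u \<otimes> inner c d e"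
    "y1 = w \<otimes> ?D e" "z1 = c \<otimes> (d \<otimes> ?D e)" "z2 = d \<otimes> (c \<otimes> ?D e)"
  have cl: "p1 \<in> carrier J" "p2 \<in> carrier J" "p3 \<in> carrier J" "p4 \<in> carrier J" "q1 \<in> carrier J" "q2 \<in> carrier J"
    "r1 \<in> carrier J" "r2 \<in> carrier J" "r3 \<in> carrier J" "r4 \<in> carrier J" "r5 \<in> carrier J" "r6 \<in> carrier J"
    "x1 \<in> carrier J" "x2 \<in> carrier J" "x3 \<in> carrier J" "y1 \<in> carrier J" "z1 \<in> carrier J" "z2 \<in> carrier J"
    using all by (simp_all add: pq rs xs rules inner_closed)
  have Dw: "?D w \<otimes> e = r1 \<oplus> r2"
    using all by (simp add: w_def inner_derivation rules rs)
  have DDe: "?D (inner c d e) = (r3 \<oplus> (r5 \<oplus> z1)) \<ominus> (r6 \<oplus> (r4 \<oplus> z2))"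
    unfolding inner_def[of c d e] using all by (simp add: inner_minus inner_derivation rules rs xs)
  have Du: "inner c d u \<otimes> e = q2 \<ominus> q1"
    unfolding inner_def[of c d u]
    using all product_commute[of d u] product_commute[of c u] product_commute[of d "u \<otimes> c"]
    by (simp add: rules pq)
  have 1: "V a b (V c d e) = x1 \<oplus> x3 \<oplus> ((r1 \<oplus> r2) \<oplus> y1 \<oplus>
      ((r3 \<oplus> (r5 \<oplus> z1)) \<ominus> (r6 \<oplus> (r4 \<oplus> z2))))"
    using all Dw DDe by (simp add: Vab Vcd inner_closed rules inner_add inner_derivation xs)
  have 2: "V c d (V a b e) = x2 \<oplus> y1 \<oplus> ((q2 \<ominus> q1) \<oplus> x3 \<oplus> (z1 \<ominus> z2))"
    using all Du by (simp add: Vab Vcd inner_closed rules inner_add inner_derivation xs inner_def[of c d "?D e"])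
  have 3: "V (V a b c) d e = (q1 \<oplus> r1) \<oplus> ((p1 \<oplus> r3) \<ominus> (p2 \<oplus> r4))"
    using all by (simp add: Vab V_inner[of "_ \<oplus> _"] rules inner_def[of "_ \<oplus> _"] pq rs)
  have 4: "V c (V b a d) e = (q2 \<ominus> r2) \<oplus> ((p4 \<ominus> r5) \<ominus> (p3 \<ominus> r6))"
    using all by (simp add: Vba V_inner[of c "_ \<ominus> _"] rules inner_def[of c "_ \<ominus> _"] pq rs)
  have key: "x1 = x2 \<oplus> ((p1 \<ominus> p2) \<oplus> (p3 \<ominus> p4))"
  proof -
    have "x1 \<ominus> x2 = (p1 \<ominus> p2) \<oplus> (p3 \<ominus> p4)"
      unfolding xs pq w_def using mem uw by (intro multiplication_commutators)
    moreover have "x1 = x2 \<oplus> (x1 \<ominus> x2)" using cl(13,14) by algebra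
    ultimately show ?thesis by simp
  qed
  \<comment> \<open>\<open>W\<close> is common to both terms on the left and cancels; the other groups keep the normalization short.\<close>
  define W A1 A2 B1 B2 where grp: "W = x3 \<oplus> y1 \<oplus> (z1 \<ominus> z2)" "A1 = p1 \<ominus> p2" "A2 = p3 \<ominus> p4"
    "B1 = r1 \<oplus> (r3 \<ominus> r4)" "B2 = r2 \<oplus> (r5 \<ominus> r6)"
  have gcl: "W \<in> carrier J" "A1 \<in> carrier J" "A2 \<in> carrier J" "B1 \<in> carrier J" "B2 \<in> carrier J"
    using cl by (simp_all add: grp)
  have 1: "V a b (V c d e) = x2 \<oplus> (A1 \<oplus> A2) \<oplus> W \<oplus> (B1 \<oplus> B2)"
    unfolding 1 grp(2,3) key[symmetric] unfolding grp(1,4,5) using cl(7-13,15-18) by algebra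
  have 2: "V c d (V a b e) = x2 \<oplus> W \<oplus> (q2 \<ominus> q1)"
    unfolding 2 grp using cl(5,6,14-18) by algebra
  have 3: "V (V a b c) d e = q1 \<oplus> A1 \<oplus> B1"
    unfolding 3 grp using cl(1,2,5,7,9,10) by algebra
  have 4: "V c (V b a d) e = q2 \<ominus> A2 \<ominus> B2"
    unfolding 4 grp using cl(3,4,6,8,11,12) by algebra
  show "V a b (V c d e) \<ominus> V c d (V a b e) = V (V a b c) d e \<ominus> V c (V b a d) e"
    unfolding 1 2 3 4 using gcl cl(5,6,14) by algebra
qed

end

section \<open>The \<open>sl\<^sub>2\<close>-triple of a unital Jordan algebra\<close>

locale algebra_cover =
  J: two_torsion_free_jordan_algebra R J + tkk_cover R "algebra_pair J" L \<rho> \<beta>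
  for R :: "'k ring" and J :: "('k, 'j) module" and L :: "('k, 'd) module" and \<rho> \<beta>
begin

lemma pair_sel [simp]: "neg_part (algebra_pair J) = J" "pos_part (algebra_pair J) = J"
  "neg_prod (algebra_pair J) = J.V" "pos_prod (algebra_pair J) = J.V"
  by (simp_all add: algebra_pair_def triple_pair_def)

abbreviation "two \<equiv> add_pow J (2::nat) \<one>\<^bsub>J\<^esub>"
abbreviation "h \<equiv> \<ominus>\<^bsub>L\<^esub> \<beta> \<one>\<^bsub>J\<^esub> two"

lemmas one_closed = J.unit_in_carrier

lemma two_eq: "two = \<one>\<^bsub>J\<^esub> \<oplus>\<^bsub>J\<^esub> \<one>\<^bsub>J\<^esub>"
  using one_closed by (rule J.M.add_pow_two)

lemma mult_one: "a \<in> carrier J \<Longrightarrow> a \<otimes>\<^bsub>J\<^esub> \<one>\<^bsub>J\<^esub> = a"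
  using J.product_commute[of a "\<one>\<^bsub>J\<^esub>"] J.unit_neutral one_closed by simp

lemma \<beta>_closed: "a \<in> carrier J \<Longrightarrow> b \<in> carrier J \<Longrightarrow> \<beta> a b \<in> carrier L"
  using \<beta>_rules(1) by simp

lemma h_closed: "h \<in> carrier L"
  using one_closed by (simp add: two_eq \<beta>_closed)

lemma V_one_two: "c \<in> carrier J \<Longrightarrow> J.V \<one>\<^bsub>J\<^esub> two c = c \<oplus>\<^bsub>J\<^esub> c"
  and V_two_one: "c \<in> carrier J \<Longrightarrow> J.V two \<one>\<^bsub>J\<^esub> c = c \<oplus>\<^bsub>J\<^esub> c"
  using one_closed by (simp_all add: two_eq algebra_triple_product_def J.rules J.unit_neutral mult_one
      J.M.minus_eq J.M.a_assoc J.M.r_neg)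

lemma h_acts:
  assumes "c \<in> carrier J"
  shows "fst (\<rho> h) c = \<ominus>\<^bsub>J\<^esub> (c \<oplus>\<^bsub>J\<^esub> c)" "snd (\<rho> h) c = c \<oplus>\<^bsub>J\<^esub> c"
proof -
  have t: "two \<in> carrier J" using one_closed by (simp add: two_eq)
  have b: "\<beta> \<one>\<^bsub>J\<^esub> two \<in> carrier L" using one_closed t by (rule \<beta>_closed)
  have r: "\<rho> h = \<ominus>\<^bsub>G\<^esub> \<nu> \<one>\<^bsub>J\<^esub> two" and n: "\<nu> \<one>\<^bsub>J\<^esub> two \<in> carrier G"
    using \<rho>_rules(6)[OF b] \<rho>_\<beta>[of "\<one>\<^bsub>J\<^esub>" two] nu_closed[of "\<one>\<^bsub>J\<^esub>" two] one_closed t by simp_all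
  show "fst (\<rho> h) c = \<ominus>\<^bsub>J\<^esub> (c \<oplus>\<^bsub>J\<^esub> c)"
    using fst_rules(6)[OF n, of c] nu_apply(1)[of c "\<one>\<^bsub>J\<^esub>" two] assms by (simp add: r V_one_two)
  show "snd (\<rho> h) c = c \<oplus>\<^bsub>J\<^esub> c"
    using snd_rules(6)[OF n, of c] nu_apply(2)[of c "\<one>\<^bsub>J\<^esub>" two] assms by (simp add: r V_two_one)
qed

text \<open>
  On \<open>\<beta>(a, b)\<close> the eigenvalues \<open>-2\<close> on \<open>P\<^sub>-\<close> and \<open>2\<close> on \<open>P\<^sub>+\<close> add up to \<open>0\<close>.
\<close>

lemma h_central:
  assumes X: "X \<in> carrier L"
  shows "h \<otimes>\<^bsub>L\<^esub> X = \<zero>\<^bsub>L\<^esub>"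
proof (rule linear_eq_on_\<beta>[OF L.module_L bilinear_map_right[OF L.bracket_bilinear h_closed]
      linear_map_const_zero[OF L.module_L] X])
  fix a b assume "a \<in> carrier (neg_part (algebra_pair J))" "b \<in> carrier (pos_part (algebra_pair J))"
  then have ab: "a \<in> carrier J" "b \<in> carrier J" by simp_all
  have "h \<otimes>\<^bsub>L\<^esub> \<beta> a b = \<beta> (\<ominus>\<^bsub>J\<^esub> (a \<oplus>\<^bsub>J\<^esub> a)) b \<oplus>\<^bsub>L\<^esub> \<beta> a (b \<oplus>\<^bsub>J\<^esub> b)"
    using bracket_\<beta>[OF h_closed, of a b] ab by (simp only: h_acts pair_sel)
  also have "\<dots> = \<ominus>\<^bsub>L\<^esub> (\<beta> a b \<oplus>\<^bsub>L\<^esub> \<beta> a b) \<oplus>\<^bsub>L\<^esub> (\<beta> a b \<oplus>\<^bsub>L\<^esub> \<beta> a b)"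
    using \<beta>_rules(2)[of a a b] \<beta>_rules(3)[of a b b] \<beta>_rules(6)[of "a \<oplus>\<^bsub>J\<^esub> a" b] ab by simp
  also have "\<dots> = \<zero>\<^bsub>L\<^esub>" using \<beta>_closed[OF ab] by (intro L.l_neg) simp
  finally show "h \<otimes>\<^bsub>L\<^esub> \<beta> a b = \<zero>\<^bsub>L\<^esub>" .
qed

abbreviation "sl2 \<equiv> ((\<zero>\<^bsub>J\<^esub>, h, \<zero>\<^bsub>J\<^esub>), (\<zero>\<^bsub>J\<^esub>, \<zero>\<^bsub>L\<^esub>, two), (\<one>\<^bsub>J\<^esub>, \<zero>\<^bsub>L\<^esub>, \<zero>\<^bsub>J\<^esub>))"

lemma zero_acts: "X \<in> carrier L \<Longrightarrow> fst (\<rho> X) \<zero>\<^bsub>J\<^esub> = \<zero>\<^bsub>J\<^esub>" "X \<in> carrier L \<Longrightarrow> snd (\<rho> X) \<zero>\<^bsub>J\<^esub> = \<zero>\<^bsub>J\<^esub>"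
  "c \<in> carrier J \<Longrightarrow> fst (\<rho> \<zero>\<^bsub>L\<^esub>) c = \<zero>\<^bsub>J\<^esub>" "c \<in> carrier J \<Longrightarrow> snd (\<rho> \<zero>\<^bsub>L\<^esub>) c = \<zero>\<^bsub>J\<^esub>"
  "c \<in> carrier J \<Longrightarrow> \<beta> \<zero>\<^bsub>J\<^esub> c = \<zero>\<^bsub>L\<^esub>" "c \<in> carrier J \<Longrightarrow> \<beta> c \<zero>\<^bsub>J\<^esub> = \<zero>\<^bsub>L\<^esub>"
  using fst_rules(11)[OF \<rho>_rules(1)] snd_rules(11)[OF \<rho>_rules(1)] fst_rules(10) snd_rules(10)
    \<beta>_rules(10,11) by (simp_all add: \<rho>_rules(4))

lemma h_bracket:
  assumes "a \<in> carrier J" "X \<in> carrier L" "b \<in> carrier J"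
  shows "(\<zero>\<^bsub>J\<^esub>, h, \<zero>\<^bsub>J\<^esub>) \<otimes>\<^bsub>E\<^esub> (a, X, b) = (\<ominus>\<^bsub>J\<^esub> (a \<oplus>\<^bsub>J\<^esub> a), \<zero>\<^bsub>L\<^esub>, b \<oplus>\<^bsub>J\<^esub> b)"
  using assms by (simp only: E_simps h_acts h_central zero_acts pair_sel) (simp add: J.M.minus_eq L.minus_eq)

lemma carrier_E: "carrier E = carrier J \<times> carrier L \<times> carrier J" by simp

lemma E_add_pow:
  assumes "a \<in> carrier J" "X \<in> carrier L" "b \<in> carrier J"
  shows "add_pow E (2::nat) (a, X, b) = (a \<oplus>\<^bsub>J\<^esub> a, X \<oplus>\<^bsub>L\<^esub> X, b \<oplus>\<^bsub>J\<^esub> b)"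
    "add_pow E (2::int) (a, X, b) = (a \<oplus>\<^bsub>J\<^esub> a, X \<oplus>\<^bsub>L\<^esub> X, b \<oplus>\<^bsub>J\<^esub> b)"
    "add_pow E (-2::int) (a, X, b) = (\<ominus>\<^bsub>J\<^esub> (a \<oplus>\<^bsub>J\<^esub> a), \<ominus>\<^bsub>L\<^esub> (X \<oplus>\<^bsub>L\<^esub> X), \<ominus>\<^bsub>J\<^esub> (b \<oplus>\<^bsub>J\<^esub> b))"
    "add_pow E (0::int) (a, X, b) = (\<zero>\<^bsub>J\<^esub>, \<zero>\<^bsub>L\<^esub>, \<zero>\<^bsub>J\<^esub>)"
proof -
  have x: "(a, X, b) \<in> carrier E" using assms by simp
  have n: "\<ominus>\<^bsub>E\<^esub> (a \<oplus>\<^bsub>J\<^esub> a, X \<oplus>\<^bsub>L\<^esub> X, b \<oplus>\<^bsub>J\<^esub> b) = (\<ominus>\<^bsub>J\<^esub> (a \<oplus>\<^bsub>J\<^esub> a), \<ominus>\<^bsub>L\<^esub> (X \<oplus>\<^bsub>L\<^esub> X), \<ominus>\<^bsub>J\<^esub> (b \<oplus>\<^bsub>J\<^esub> b))"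
    using E_neg[of "a \<oplus>\<^bsub>J\<^esub> a" "X \<oplus>\<^bsub>L\<^esub> X" "b \<oplus>\<^bsub>J\<^esub> b"] assms by simp
  show "add_pow E (2::nat) (a, X, b) = (a \<oplus>\<^bsub>J\<^esub> a, X \<oplus>\<^bsub>L\<^esub> X, b \<oplus>\<^bsub>J\<^esub> b)"
    "add_pow E (2::int) (a, X, b) = (a \<oplus>\<^bsub>J\<^esub> a, X \<oplus>\<^bsub>L\<^esub> X, b \<oplus>\<^bsub>J\<^esub> b)"
    "add_pow E (0::int) (a, X, b) = (\<zero>\<^bsub>J\<^esub>, \<zero>\<^bsub>L\<^esub>, \<zero>\<^bsub>J\<^esub>)"
    "add_pow E (-2::int) (a, X, b) = (\<ominus>\<^bsub>J\<^esub> (a \<oplus>\<^bsub>J\<^esub> a), \<ominus>\<^bsub>L\<^esub> (X \<oplus>\<^bsub>L\<^esub> X), \<ominus>\<^bsub>J\<^esub> (b \<oplus>\<^bsub>J\<^esub> b))"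
    by (simp_all only: E.add_pow_two[OF x] E_simps pair_sel n)
qed

lemma sl2_triple_E: "sl2_triple E sl2"
proof -
  have t: "two \<in> carrier J" using one_closed by (simp add: two_eq)
  have b: "\<beta> \<one>\<^bsub>J\<^esub> two \<in> carrier L" using one_closed t by (rule \<beta>_closed)
  have 1: "(\<zero>\<^bsub>J\<^esub>, \<zero>\<^bsub>L\<^esub>, two) \<otimes>\<^bsub>E\<^esub> (\<one>\<^bsub>J\<^esub>, \<zero>\<^bsub>L\<^esub>, \<zero>\<^bsub>J\<^esub>) = (\<zero>\<^bsub>J\<^esub>, h, \<zero>\<^bsub>J\<^esub>)"
    using t b one_closed by (simp only: E_simps zero_acts pair_sel J.M.zero_closed L.zero_closed one_closed)
      (simp add: J.M.minus_eq L.minus_eq L.bracket_rules)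
  have 2: "(\<zero>\<^bsub>J\<^esub>, h, \<zero>\<^bsub>J\<^esub>) \<otimes>\<^bsub>E\<^esub> (\<zero>\<^bsub>J\<^esub>, \<zero>\<^bsub>L\<^esub>, two) = add_pow E (2::nat) (\<zero>\<^bsub>J\<^esub>, \<zero>\<^bsub>L\<^esub>, two)"
    using h_bracket[of "\<zero>\<^bsub>J\<^esub>" "\<zero>\<^bsub>L\<^esub>" two] E_add_pow(1)[of "\<zero>\<^bsub>J\<^esub>" "\<zero>\<^bsub>L\<^esub>" two] t by simp
  have "\<ominus>\<^bsub>E\<^esub> (\<one>\<^bsub>J\<^esub> \<oplus>\<^bsub>J\<^esub> \<one>\<^bsub>J\<^esub>, \<zero>\<^bsub>L\<^esub>, \<zero>\<^bsub>J\<^esub>) = (\<ominus>\<^bsub>J\<^esub> (\<one>\<^bsub>J\<^esub> \<oplus>\<^bsub>J\<^esub> \<one>\<^bsub>J\<^esub>), \<zero>\<^bsub>L\<^esub>, \<zero>\<^bsub>J\<^esub>)"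
    using E_neg[of "\<one>\<^bsub>J\<^esub> \<oplus>\<^bsub>J\<^esub> \<one>\<^bsub>J\<^esub>" "\<zero>\<^bsub>L\<^esub>" "\<zero>\<^bsub>J\<^esub>"] one_closed by simp
  then have 3: "(\<zero>\<^bsub>J\<^esub>, h, \<zero>\<^bsub>J\<^esub>) \<otimes>\<^bsub>E\<^esub> (\<one>\<^bsub>J\<^esub>, \<zero>\<^bsub>L\<^esub>, \<zero>\<^bsub>J\<^esub>) = \<ominus>\<^bsub>E\<^esub> (add_pow E (2::nat) (\<one>\<^bsub>J\<^esub>, \<zero>\<^bsub>L\<^esub>, \<zero>\<^bsub>J\<^esub>))"
    using h_bracket[of "\<one>\<^bsub>J\<^esub>" "\<zero>\<^bsub>L\<^esub>" "\<zero>\<^bsub>J\<^esub>"] E_add_pow(1)[of "\<one>\<^bsub>J\<^esub>" "\<zero>\<^bsub>L\<^esub>" "\<zero>\<^bsub>J\<^esub>"] one_closed by simp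
  show ?thesis
    unfolding sl2_triple_def using 1 2 3 t one_closed h_closed by (simp del: E_simps(2-))
qed

text \<open>
  The bracket with \<open>h\<close> sends \<open>a + X + b\<close> to \<open>-2 a + 2 b\<close>. Comparison with a multiple \<open>2 i\<close> of
  \<open>a + X + b\<close> leaves conditions of the form \<open>2 x = 0\<close> or \<open>4 x = 0\<close> on the other components.
\<close>

lemma sl2_grading_eq:
  assumes tor: "no_torsion 2 L"
  shows "sl2_grading E sl2 = Gr"
proof
  fix i :: int
  note tJ = J.M.no_torsion_two[OF J.torsion] and tL = L.no_torsion_two[OF tor]
  note mono = grading_simps[unfolded pair_sel]
  consider "i = -1" | "i = 0" | "i = 1" | "i \<notin> {-1, 0, 1}" by blast
  then show "sl2_grading E sl2 i = Gr i"
  proof cases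
    case 1
    have "sl2_grading E sl2 (-1) = {x \<in> carrier E. (\<zero>\<^bsub>J\<^esub>, h, \<zero>\<^bsub>J\<^esub>) \<otimes>\<^bsub>E\<^esub> x = add_pow E (-2::int) x}"
      by (simp add: sl2_grading_def)
    also have "\<dots> = carrier J \<times> {\<zero>\<^bsub>L\<^esub>} \<times> {\<zero>\<^bsub>J\<^esub>}"
      by (auto simp: h_bracket E_add_pow carrier_E tJ tL simp del: E_simps)
    finally show ?thesis unfolding 1 mono .
  next
    case 2
    have "sl2_grading E sl2 0 = {x \<in> carrier E. (\<zero>\<^bsub>J\<^esub>, h, \<zero>\<^bsub>J\<^esub>) \<otimes>\<^bsub>E\<^esub> x = add_pow E (0::int) x}"
      by (simp add: sl2_grading_def)
    also have "\<dots> = {\<zero>\<^bsub>J\<^esub>} \<times> carrier L \<times> {\<zero>\<^bsub>J\<^esub>}"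
      by (auto simp: h_bracket E_add_pow carrier_E tJ tL simp del: E_simps)
    finally show ?thesis unfolding 2 mono .
  next
    case 3
    have "sl2_grading E sl2 1 = {x \<in> carrier E. (\<zero>\<^bsub>J\<^esub>, h, \<zero>\<^bsub>J\<^esub>) \<otimes>\<^bsub>E\<^esub> x = add_pow E (2::int) x}"
      by (simp add: sl2_grading_def)
    also have "\<dots> = {\<zero>\<^bsub>J\<^esub>} \<times> {\<zero>\<^bsub>L\<^esub>} \<times> carrier J"
      by (auto simp: h_bracket E_add_pow carrier_E tJ tL simp del: E_simps)
    finally show ?thesis unfolding 3 mono .
  next
    case 4
    then show ?thesis unfolding mono(4)[OF 4] by (simp add: sl2_grading_def)
  qed
qed

end

text \<open>
  The bracket of \<open>a\<close> in degree \<open>-1\<close> and \<open>b\<close> in degree \<open>1\<close> is \<open>\<beta>(a, b)\<close>.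
\<close>

lemma (in tkk_cover) degree_zero_generated:
  "Gr 0 = submodule_span R E {x \<otimes>\<^bsub>E\<^esub> y | x y. x \<in> Gr (-1) \<and> y \<in> Gr 1}" (is "_ = submodule_span R E ?B")
proof
  have B: "?B \<subseteq> Gr 0" using grading_bracket[of _ "-1" _ 1] by auto
  show "submodule_span R E ?B \<subseteq> Gr 0" by (rule span_least[OF grading_submodule B])
  have lin: "linear_map R L E (\<lambda>X. (\<zero>\<^bsub>M\<^esub>, X, \<zero>\<^bsub>N\<^esub>))"
    by (rule linear_mapI) simp_all
  have "(\<zero>\<^bsub>M\<^esub>, X, \<zero>\<^bsub>N\<^esub>) \<in> submodule_span R E ?B" if X: "X \<in> carrier L" for X
  proof (rule linear_map_image_span[OF L.module_L module_E lin \<beta>_set_closed])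
    show "submodule (submodule_span R E ?B) R E"
      by (rule span_is_submodule[OF module_E subset_trans[OF B grading_subset]])
    show "X \<in> submodule_span R L \<beta>_set" using X by (simp only: L_spanned)
    fix Y assume "Y \<in> \<beta>_set"
    then obtain a b where *: "Y = \<beta> a b" "a \<in> carrier M" "b \<in> carrier N" by blast
    have "(a, \<zero>\<^bsub>L\<^esub>, \<zero>\<^bsub>N\<^esub>) \<otimes>\<^bsub>E\<^esub> (\<zero>\<^bsub>M\<^esub>, \<zero>\<^bsub>L\<^esub>, b) = (\<zero>\<^bsub>M\<^esub>, Y, \<zero>\<^bsub>N\<^esub>)"
      using * by (simp add: cover_rules M.minus_eq N.minus_eq L.minus_eq)
    moreover have "(a, \<zero>\<^bsub>L\<^esub>, \<zero>\<^bsub>N\<^esub>) \<in> Gr (-1)" "(\<zero>\<^bsub>M\<^esub>, \<zero>\<^bsub>L\<^esub>, b) \<in> Gr 1"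
      using * by (simp_all add: grading_simps)
    ultimately have "(\<zero>\<^bsub>M\<^esub>, Y, \<zero>\<^bsub>N\<^esub>) \<in> ?B" by (metis (mono_tags, lifting) mem_Collect_eq)
    then show "(\<zero>\<^bsub>M\<^esub>, Y, \<zero>\<^bsub>N\<^esub>) \<in> submodule_span R E ?B" by (rule subsetD[OF span_superset])
  qed
  then show "Gr 0 \<subseteq> submodule_span R E ?B" by (auto simp: grading_simps)
qed

lemma (in algebra_cover) a1_graded_E:
  assumes "no_torsion 2 L"
  shows "a1_graded R E sl2"
  unfolding a1_graded_def sl2_grading_eq[OF assms]
  by (intro conjI E_lie_algebra sl2_triple_E E_direct_sum degree_zero_generated)

text \<open>
  Evaluation at the elements of \<open>P\<close> detects torsion of operators.
\<close>

lemma (in jordan_pair_space) instr_no_torsion: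
  assumes "no_torsion 2 M" "no_torsion 2 N"
  shows "no_torsion 2 I"
  unfolding no_torsion_def
proof (intro ballI impI)
  fix X assume X: "X \<in> carrier I" and "add_pow I (2::nat) X = \<zero>\<^bsub>I\<^esub>"
  then have e: "X \<oplus>\<^bsub>G\<^esub> X = \<zero>\<^bsub>G\<^esub>" using I.add_pow_two(1)[OF X] by simp
  note X = instr_subset[OF X]
  have "X = \<zero>\<^bsub>G\<^esub>"
  proof (rule pair_gl_ext[OF X G.zero_closed])
    show "fst X a = fst \<zero>\<^bsub>G\<^esub> a" if a: "a \<in> carrier M" for a
    proof -
      have "fst X a \<oplus>\<^bsub>M\<^esub> fst X a = \<zero>\<^bsub>M\<^esub>" using fst_rules(2)[OF X X a] fst_rules(10)[OF a] by (simp only: e)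
      then show ?thesis using M.no_torsion_two(1)[OF assms(1) fst_rules(1)[OF X a]] fst_rules(10)[OF a] by (simp only:)
    qed
    show "snd X b = snd \<zero>\<^bsub>G\<^esub> b" if b: "b \<in> carrier N" for b
    proof -
      have "snd X b \<oplus>\<^bsub>N\<^esub> snd X b = \<zero>\<^bsub>N\<^esub>" using snd_rules(2)[OF X X b] snd_rules(10)[OF b] by (simp only: e)
      then show ?thesis using N.no_torsion_two(1)[OF assms(2) snd_rules(1)[OF X b]] snd_rules(10)[OF b] by (simp only:)
    qed
  qed
  then show "X = \<zero>\<^bsub>I\<^esub>" by simp
qed

section \<open>The cover of \<open>TKK(P)\<close>\<close>

lemma TKK_hat_central_extension:
  assumes "jordan_pair k P"
  shows "three_graded k (TKK_hat k P) (TKK_hat_grading k P)"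
    "graded_central_extension k (TKK_hat k P) (TKK_hat_grading k P) (TKK k P) (TKK_grading k P) (upsilon k P)"
proof -
  interpret jordan_pair_space k P using assms by unfold_locales
  show "three_graded k (TKK_hat k P) (TKK_hat_grading k P)"
    "graded_central_extension k (TKK_hat k P) (TKK_hat_grading k P) (TKK k P) (TKK_grading k P) (upsilon k P)"
    unfolding TKK_hat_eq TKK_eq upsilon_eq by (rule hat.E_three_graded hat.proj_central)+
qed

lemma TKK_hat_involution:
  assumes "jordan_triple_system k T p"
  defines "Q \<equiv> triple_pair T p"
  shows "anti_graded_involution k (TKK_hat k Q) (TKK_hat_grading k Q) (kappa_hat k Q)"
    "involutary_morphism k (TKK_hat k Q) (TKK_hat_grading k Q) (kappa_hat k Q)
           (TKK k Q) (TKK_grading k Q) (kappa_bar k Q) (upsilon k Q)"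
proof -
  interpret triple_system k T p using assms by unfold_locales
  note eqs = Q_def TKK_hat_eq TKK_eq upsilon_eq kappa_eq
  show 1: "anti_graded_involution k (TKK_hat k Q) (TKK_hat_grading k Q) (kappa_hat k Q)"
    unfolding eqs by (rule hat_swap.kappa_anti_graded_involution)
  show "involutary_morphism k (TKK_hat k Q) (TKK_hat_grading k Q) (kappa_hat k Q)
           (TKK k Q) (TKK_grading k Q) (kappa_bar k Q) (upsilon k Q)"
    unfolding involutary_morphism_def eqs
    by (intro conjI ballI hat_swap.kappa_anti_graded_involution TKK_swap.kappa_anti_graded_involution
        hat.proj_graded proj_kappa)
qed

lemma TKK_hat_sl2:
  assumes "unital_jordan_algebra k J" "no_torsion 2 J"
  defines "Q \<equiv> algebra_pair J"
  shows "sl2_triple (TKK_hat k Q) (sl2_hat k J)"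
    "no_torsion 2 (angle_algebra k Q) \<Longrightarrow> sl2_grading (TKK_hat k Q) (sl2_hat k J) = TKK_hat_grading k Q"
    "no_torsion 2 (angle_algebra k Q) \<Longrightarrow>
      a1_graded_morphism k (TKK_hat k Q) (sl2_hat k J) (TKK k Q) (sl2_bar k J) (upsilon k Q)"
proof -
  interpret J: two_torsion_free_jordan_algebra k J
    using assms by (simp add: two_torsion_free_jordan_algebra_def two_torsion_free_jordan_algebra_axioms_def)
  have sel: "neg_part Q = J" "pos_part Q = J" by (simp_all add: Q_def algebra_pair_def triple_pair_def)
  have "jordan_pair k Q"
    using J.algebra_triple_system
    by (simp add: Q_def algebra_pair_def triple_pair_def jordan_pair_def jordan_triple_system_def)
  then interpret P: jordan_pair_space k Q by unfold_locales
  interpret hat: algebra_cover k J "angle_algebra k Q" "mu k Q" "angle k Q"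
    using P.hat.tkk_cover_axioms unfolding Q_def
    by (intro algebra_cover.intro J.two_torsion_free_jordan_algebra_axioms)
  interpret bar: algebra_cover k J "instr k Q" "\<lambda>X. X" "nu Q"
    using P.TKK.tkk_cover_axioms unfolding Q_def
    by (intro algebra_cover.intro J.two_torsion_free_jordan_algebra_axioms)
  have E: "TKK_hat k Q = hat.E" "TKK k Q = bar.E" "TKK_hat_grading k Q = hat.Gr"
    unfolding P.TKK_hat_eq P.TKK_eq by (simp_all only: Q_def)
  have sl2: "sl2_hat k J = hat.sl2" "sl2_bar k J = bar.sl2"
    by (simp_all only: sl2_hat_def sl2_bar_def Let_def Q_def)
  show "sl2_triple (TKK_hat k Q) (sl2_hat k J)"
    unfolding E sl2 by (rule hat.sl2_triple_E)
  assume tor: "no_torsion 2 (angle_algebra k Q)"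
  show "sl2_grading (TKK_hat k Q) (sl2_hat k J) = TKK_hat_grading k Q"
    unfolding E sl2 by (rule hat.sl2_grading_eq[OF tor])
  have "no_torsion 2 (instr k Q)"
    using P.instr_no_torsion assms(2) by (simp only: sel)
  note g = hat.a1_graded_E[OF tor] bar.a1_graded_E[OF this]
  have lie: "lie_hom k hat.E bar.E (upsilon k Q)"
    using P.hat.proj_lie_hom unfolding P.upsilon_eq by (simp only: Q_def)
  have one: "\<one>\<^bsub>J\<^esub> \<in> carrier J" "hat.two \<in> carrier J"
    using J.unit_in_carrier by (simp_all add: hat.two_eq)
  have b: "angle k Q \<one>\<^bsub>J\<^esub> hat.two \<in> carrier (angle_algebra k Q)"
    using hat.\<beta>_closed[OF one] .
  have "mu k Q (\<ominus>\<^bsub>angle_algebra k Q\<^esub> angle k Q \<one>\<^bsub>J\<^esub> hat.two) = \<ominus>\<^bsub>instr k Q\<^esub> nu Q \<one>\<^bsub>J\<^esub> hat.two"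
    using linear_map_neg[OF P.D.module_L P.I.module_L P.mu_linear b] P.mu_angle[of "\<one>\<^bsub>J\<^esub>" hat.two] one sel by simp
  moreover have "mu k Q \<zero>\<^bsub>angle_algebra k Q\<^esub> = \<zero>\<^bsub>instr k Q\<^esub>"
    by (rule linear_map_zero[OF P.D.module_L P.I.module_L P.mu_linear])
  ultimately have "(case hat.sl2 of (h, e, f) \<Rightarrow> (upsilon k Q h, upsilon k Q e, upsilon k Q f)) = bar.sl2"
    unfolding upsilon_def by (simp only: prod.case)
  with g lie show "a1_graded_morphism k (TKK_hat k Q) (sl2_hat k J) (TKK k Q) (sl2_bar k J) (upsilon k Q)"
    unfolding a1_graded_morphism_def E sl2 by blast
qed

theorem theorem5p3:
  fixes k :: "'k ring"
    and P :: "('k, 'm, 'p) pair"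
    and T :: "('k, 't) module" and p :: "'t \<Rightarrow> 't \<Rightarrow> 't \<Rightarrow> 't"
    and J :: "('k, 'j) module"
  assumes "cring k" and "no_torsion 2 k" and "no_torsion 3 k"
  shows
    "(jordan_pair k P \<longrightarrow>
        three_graded k (TKK_hat k P) (TKK_hat_grading k P) \<and>
        graded_central_extension k (TKK_hat k P) (TKK_hat_grading k P)
          (TKK k P) (TKK_grading k P) (upsilon k P)) \<and>
     (jordan_triple_system k T p \<longrightarrow>
        (let Q = triple_pair T p in
         anti_graded_involution k (TKK_hat k Q) (TKK_hat_grading k Q) (kappa_hat k Q) \<and>
         involutary_morphism k (TKK_hat k Q) (TKK_hat_grading k Q) (kappa_hat k Q)
           (TKK k Q) (TKK_grading k Q) (kappa_bar k Q) (upsilon k Q))) \<and>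
     (unital_jordan_algebra k J \<and> no_torsion 2 J \<longrightarrow>
        (let Q = algebra_pair J in
         sl2_triple (TKK_hat k Q) (sl2_hat k J) \<and>
         (no_torsion 2 (angle_algebra k Q) \<longrightarrow>
            sl2_grading (TKK_hat k Q) (sl2_hat k J) = TKK_hat_grading k Q \<and>
            a1_graded_morphism k (TKK_hat k Q) (sl2_hat k J) (TKK k Q) (sl2_bar k J)
              (upsilon k Q))))"
proof (intro conjI impI)
  assume "jordan_pair k P"
  note * = TKK_hat_central_extension[OF this]
  show "three_graded k (TKK_hat k P) (TKK_hat_grading k P)"
    "graded_central_extension k (TKK_hat k P) (TKK_hat_grading k P)
      (TKK k P) (TKK_grading k P) (upsilon k P)"
    by (fact *)+
next
  assume "jordan_triple_system k T p"
  then show "let Q = triple_pair T p in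
      anti_graded_involution k (TKK_hat k Q) (TKK_hat_grading k Q) (kappa_hat k Q) \<and>
      involutary_morphism k (TKK_hat k Q) (TKK_hat_grading k Q) (kappa_hat k Q)
        (TKK k Q) (TKK_grading k Q) (kappa_bar k Q) (upsilon k Q)"
    unfolding Let_def by (intro conjI TKK_hat_involution)
next
  assume "unital_jordan_algebra k J \<and> no_torsion 2 J"
  then show "let Q = algebra_pair J in
      sl2_triple (TKK_hat k Q) (sl2_hat k J) \<and>
      (no_torsion 2 (angle_algebra k Q) \<longrightarrow>
         sl2_grading (TKK_hat k Q) (sl2_hat k J) = TKK_hat_grading k Q \<and>
         a1_graded_morphism k (TKK_hat k Q) (sl2_hat k J) (TKK k Q) (sl2_bar k J) (upsilon k Q))"
    unfolding Let_def by (intro conjI impI TKK_hat_sl2) simp_all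
qed

end
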